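(* Let $(k,v)$ be a henselian field of characteristic $p>0$ and $(k_1|k,v)$ a minimal purely wild extension. Then there exist an additive polynomial ${\cal A}(X)\in{\cal O}_k[X]$ and an element $\vartheta\in k_1$ such that $k_1=k(\vartheta)$ and the polynomial ${\cal A}(X)-{\cal A}(\vartheta)$ is the minimal polynomial of $\vartheta$ over $k$.
   Context: $(k,v)$ is a valued field; it is henselian if $v$ extends uniquely to the algebraic closure of $k$. ${\cal O}_k$ denotes the valuation ring of $v$ on $k$. A polynomial $f\in k[X]$ is additive if $f(a+b)=f(a)+f(b)$ for all $a,b$ in every extension field of $k$. Let $k^{\rm sep}$ be the separable-algebraic closure of $k$ and let $k^r$ denote the ramification field of $k^{\rm sep}|k$, i.e. the fixed field in $k^{\rm sep}$ of the ramification group $\{\sigma\in{\rm Gal}(k^{\rm sep}|k)\mid v(\sigma x-x)>vx \text{ for all } x\in k^{\rm sep}\setminus\{0\}\}$. An algebraic extension $k_1|k$ (inside a fixed algebraic closure of $k$) is called purely wild if it is linearly disjoint from $k^r|k$ over $k$. An extension is called minimal if it does not admit any proper subextension (i.e. no field lies strictly between $k$ and $k_1$). *)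

theory Defs
  imports "HOL-Algebra.Algebraic_Closure_Type" "HOL-Library.Extended"
begin

text \<open>
  All fields are subsets of one algebraically closed field, the type \<open>'a\<close>. When every element
  of \<open>'a\<close> is algebraic over \<open>K\<close>, this type is the fixed algebraic closure of \<open>K\<close>.
\<close>

abbreviation is_subfield :: "'a::field set \<Rightarrow> bool" where
  "is_subfield K \<equiv> subfield K (ring_of_type_algebra :: 'a ring)"

abbreviation ring_on :: "'a::field set \<Rightarrow> 'a ring" where
  "ring_on E \<equiv> (ring_of_type_algebra :: 'a ring)\<lparr>carrier := E\<rparr>"

definition polys_over :: "'a::zero set \<Rightarrow> 'a poly set" where
  "polys_over R = {f. \<forall>i. poly.coeff f i \<in> R}"

definition algebraic_over :: "'a::field set \<Rightarrow> 'a \<Rightarrow> bool" where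
  "algebraic_over K x \<longleftrightarrow> (\<exists>f\<in>polys_over K. f \<noteq> 0 \<and> poly f x = 0)"

definition is_min_poly :: "'a::field set \<Rightarrow> 'a \<Rightarrow> 'a poly \<Rightarrow> bool" where
  "is_min_poly K x f \<longleftrightarrow>
     f \<in> polys_over K \<and> lead_coeff f = 1 \<and> poly f x = 0 \<and>
     (\<forall>g\<in>polys_over K. g \<noteq> 0 \<and> poly g x = 0 \<longrightarrow> Polynomial.degree f \<le> Polynomial.degree g)"

definition adjoin :: "'a::field set \<Rightarrow> 'a \<Rightarrow> 'a set" where
  "adjoin K x = is_subfield hull (insert x K)"

definition minimal_extension :: "'a::field set \<Rightarrow> 'a set \<Rightarrow> bool" where
  "minimal_extension K L \<longleftrightarrow> is_subfield L \<and> K \<subseteq> L \<and>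
     (\<forall>F. is_subfield F \<and> K \<subseteq> F \<and> F \<subseteq> L \<longrightarrow> F = K \<or> F = L)"

definition lin_indep_over :: "'a::field set \<Rightarrow> 'a set \<Rightarrow> bool" where
  "lin_indep_over K S \<longleftrightarrow>
     (\<forall>T c. finite T \<and> T \<subseteq> S \<and> (\<forall>x\<in>T. c x \<in> K) \<and> (\<Sum>x\<in>T. c x * x) = 0
            \<longrightarrow> (\<forall>x\<in>T. c x = 0))"

definition linearly_disjoint :: "'a::field set \<Rightarrow> 'a set \<Rightarrow> 'a set \<Rightarrow> bool" where
  "linearly_disjoint K E F \<longleftrightarrow> (\<forall>S\<subseteq>E. lin_indep_over K S \<longrightarrow> lin_indep_over F S)"

text \<open>
  Over the algebraically closed type \<open>'a\<close>, \<^const>\<open>rsquarefree\<close> says that the minimal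
  polynomial has no multiple root in the algebraic closure, i.e. that it is separable.
\<close>

definition sep_closure :: "'a::alg_closed_field set \<Rightarrow> 'a set" where
  "sep_closure K = {x. \<exists>f. is_min_poly K x f \<and> rsquarefree f}"

text \<open>Automorphisms of \<open>E\<close> are total functions that are \<^const>\<open>undefined\<close> outside \<open>E\<close>.\<close>

definition gal_group :: "'a::field set \<Rightarrow> 'a set \<Rightarrow> ('a \<Rightarrow> 'a) set" where
  "gal_group E K = {\<sigma> \<in> ring_iso (ring_on E) (ring_on E). \<sigma> \<in> extensional E \<and> (\<forall>x\<in>K. \<sigma> x = x)}"

text \<open>
  Krull valuations, written additively: the values lie in an arbitrary linearly ordered abelian
  group \<open>'g\<close> together with \<open>\<infinity> = v 0\<close>; the element \<open>-\<infinity>\<close> of \<^typ>\<open>'g extended\<close> is not used.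
\<close>

definition valuation_on :: "'a::field set \<Rightarrow> ('a \<Rightarrow> 'g::linordered_ab_group_add extended) \<Rightarrow> bool" where
  "valuation_on K v \<longleftrightarrow>
     (\<forall>x\<in>K. v x \<noteq> -\<infinity> \<and> (v x = \<infinity> \<longleftrightarrow> x = 0)) \<and>
     (\<forall>x\<in>K. \<forall>y\<in>K. v (x * y) = v x + v y \<and> min (v x) (v y) \<le> v (x + y))"

definition valuation_ring :: "'a::field set \<Rightarrow> ('a \<Rightarrow> 'g::linordered_ab_group_add extended) \<Rightarrow> 'a set" where
  "valuation_ring K v = {x\<in>K. 0 \<le> v x}"

text \<open>
  Any extension of \<open>v\<close> to the algebraic closure has the divisible hull of \<open>v(K\<^sup>\<times>)\<close> as its value group,
  and that hull embeds uniquely over \<open>v(K\<^sup>\<times>)\<close> into \<open>'g\<close> as soon as \<open>'g\<close> contains the values of one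
  extension. So uniqueness as a \<open>'g\<close>-valued function is the usual uniqueness up to equivalence of
  valuations.
\<close>

definition henselian :: "'a::alg_closed_field set \<Rightarrow> ('a \<Rightarrow> 'g::linordered_ab_group_add extended) \<Rightarrow> bool" where
  "henselian K v \<longleftrightarrow>
     valuation_on K v \<and> (\<exists>!w. valuation_on UNIV w \<and> (\<forall>x\<in>K. w x = v x))"

text \<open>In the following, \<open>v\<close> is a valuation on the whole of the algebraic closure \<open>'a\<close>.\<close>

definition ramification_group ::
  "'a::alg_closed_field set \<Rightarrow> ('a \<Rightarrow> 'g::linordered_ab_group_add extended) \<Rightarrow> ('a \<Rightarrow> 'a) set" where
  "ramification_group K v =
     {\<sigma> \<in> gal_group (sep_closure K) K. \<forall>x\<in>sep_closure K - {0}. v (\<sigma> x - x) > v x}"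

definition ramification_field ::
  "'a::alg_closed_field set \<Rightarrow> ('a \<Rightarrow> 'g::linordered_ab_group_add extended) \<Rightarrow> 'a set" where
  "ramification_field K v = {x\<in>sep_closure K. \<forall>\<sigma>\<in>ramification_group K v. \<sigma> x = x}"

definition purely_wild ::
  "'a::alg_closed_field set \<Rightarrow> 'a set \<Rightarrow> ('a \<Rightarrow> 'g::linordered_ab_group_add extended) \<Rightarrow> bool" where
  "purely_wild K L v \<longleftrightarrow> is_subfield L \<and> K \<subseteq> L \<and> (\<forall>x\<in>L. algebraic_over K x) \<and>
     linearly_disjoint K L (ramification_field K v)"

text \<open>
  Additivity is tested in all extension fields \<open>h : K \<rightarrow> L\<close> with carrier in the type \<open>'a\<close>.
  The field operations of \<open>L\<close> are arbitrary, so \<open>L\<close> need not be a subfield of \<open>'a\<close>.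
  Nothing is lost by fixing the carrier type: two elements \<open>a\<close>, \<open>b\<close> of any extension field of \<open>K\<close>
  lie in \<open>K(a,b)\<close>, whose cardinality is at most that of the infinite type \<open>'a\<close>.
  Lemma \<open>additive_poly_any_field\<close> below confirms this.
\<close>

definition eval_in :: "('b, 'm) ring_scheme \<Rightarrow> ('a::zero \<Rightarrow> 'b) \<Rightarrow> 'a poly \<Rightarrow> 'b \<Rightarrow> 'b" where
  "eval_in L h f a =
     (\<Oplus>\<^bsub>L\<^esub>i\<in>{..Polynomial.degree f}. h (poly.coeff f i) \<otimes>\<^bsub>L\<^esub> a [^]\<^bsub>L\<^esub> i)"

definition additive_poly :: "'a::alg_closed_field set \<Rightarrow> 'a poly \<Rightarrow> bool" where
  "additive_poly K f \<longleftrightarrow> f \<in> polys_over K \<and>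
     (\<forall>(L :: 'a ring) h. field L \<and> h \<in> ring_hom (ring_on K) L \<longrightarrow>
        (\<forall>a\<in>carrier L. \<forall>b\<in>carrier L.
           eval_in L h f (a \<oplus>\<^bsub>L\<^esub> b) = eval_in L h f a \<oplus>\<^bsub>L\<^esub> eval_in L h f b))"

lemma eval_in_type:
  fixes h :: "'a::zero \<Rightarrow> 'b::field"
  shows "eval_in (ring_of_type_algebra :: 'b ring) h f a =
         (\<Sum>i\<le>Polynomial.degree f. h (poly.coeff f i) * a ^ i)"
proof -
  let ?L = "ring_of_type_algebra :: 'b ring"
  interpret L: field ?L by (rule field_from_type_algebra)
  have pw: "a [^]\<^bsub>?L\<^esub> i = a ^ i" for i :: nat
    by (induction i) (simp_all add: ring_of_type_algebra_def nat_pow_def mult.commute)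
  have fs: "(\<Oplus>\<^bsub>?L\<^esub>i\<in>S. g i) = (\<Sum>i\<in>S. g i)" if "finite S" for S :: "nat set" and g
    using that
  proof (induction S)
    case empty
    show ?case by (simp only: L.finsum_empty sum.empty) (simp add: ring_of_type_algebra_def)
  next
    case (insert x S)
    have "g \<in> S \<rightarrow> carrier ?L" "g x \<in> carrier ?L" by (auto simp: ring_of_type_algebra_def)
    with insert show ?case by (simp add: L.finsum_insert) (simp add: ring_of_type_algebra_def)
  qed
  have mult: "x \<otimes>\<^bsub>?L\<^esub> y = x * y" for x y by (simp add: ring_of_type_algebra_def)
  show ?thesis unfolding eval_in_def by (simp add: fs pw mult)
qed

lemma additive_poly_any_field:
  fixes f :: "'a::alg_closed_field poly" and h :: "'a \<Rightarrow> 'b::field" and a b :: 'b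
  assumes K: "is_subfield K" and f: "additive_poly K f"
    and h: "h \<in> ring_hom (ring_on K) (ring_of_type_algebra :: 'b ring)"
  shows "eval_in ring_of_type_algebra h f (a + b) =
         eval_in ring_of_type_algebra h f a + eval_in ring_of_type_algebra h f b"
proof -
  let ?L = "ring_of_type_algebra :: 'a ring"
  define N where "N = Polynomial.degree f"
  define c where "c = poly.coeff f"
  note sub = subringE[OF subfieldE(1)[OF K]]
  have cK: "c i \<in> K" for i using f by (auto simp: additive_poly_def polys_over_def c_def)
  have K0: "0 \<in> K" using sub(2) by (simp add: ring_of_type_algebra_def)
  have "(\<lambda>x. x) \<in> ring_hom (ring_on K) ?L"
    by (auto simp: ring_hom_def ring_of_type_algebra_def)
  then have "eval_in ?L (\<lambda>x. x) f (x + y) = eval_in ?L (\<lambda>x. x) f x + eval_in ?L (\<lambda>x. x) f y" for x y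
    using f field_from_type_algebra[where 'a='a] unfolding additive_poly_def
    by (force simp: ring_of_type_algebra_def)
  then have add: "poly f (x + y) = poly f x + poly f y" for x y
    by (simp add: eval_in_type poly_altdef)
  have zero: "g = 0" if g: "\<And>x. poly g x = 0" for g :: "'a poly"
  proof (rule ccontr)
    assume "g \<noteq> 0"
    then have "Polynomial.degree g \<noteq> 0"
      using g by (metis degree_eq_zeroE pCons_0_0 poly_const_conv)
    then have "Polynomial.degree (g + 1) > 0"
      by (subst degree_add_eq_left) auto
    then obtain x where "poly (g + 1) x = 0" using alg_closed_imp_poly_has_root by blast
    then show False using g[of x] by simp
  qed
  have binom: "c n * of_nat (n choose i) = 0" if ni: "0 < i" "i < n" "n \<le> N" for n i
  proof -
    have eq: "(\<Sum>k\<le>N. c k * of_nat (k choose i) * y ^ (k - i)) = c i" for y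
    proof -
      define P where
        "P = (\<Sum>j\<le>N. Polynomial.monom (\<Sum>k\<le>N. c k * of_nat (k choose j) * y ^ (k - j)) j)"
      have "poly P x = poly f (x + y)" for x
      proof -
        have "poly f (x + y) = (\<Sum>k\<le>N. c k * (x + y) ^ k)"
          by (simp add: poly_altdef c_def N_def)
        also have "\<dots> = (\<Sum>k\<le>N. \<Sum>j\<le>N. c k * of_nat (k choose j) * y ^ (k - j) * x ^ j)"
        proof (rule sum.cong[OF refl])
          fix k assume "k \<in> {..N}"
          then have "(x + y) ^ k = (\<Sum>j\<le>N. of_nat (k choose j) * x ^ j * y ^ (k - j))"
            unfolding binomial_ring by (intro sum.mono_neutral_left) (auto simp: binomial_eq_0)
          then show "c k * (x + y) ^ k = (\<Sum>j\<le>N. c k * of_nat (k choose j) * y ^ (k - j) * x ^ j)"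
            by (simp add: sum_distrib_left mult_ac)
        qed
        also have "\<dots> = (\<Sum>j\<le>N. \<Sum>k\<le>N. c k * of_nat (k choose j) * y ^ (k - j) * x ^ j)"
          by (rule sum.swap)
        also have "\<dots> = poly P x"
          by (simp add: P_def poly_sum poly_monom sum_distrib_right)
        finally show ?thesis ..
      qed
      then have "P - (f + [:poly f y:]) = 0"
        by (intro zero) (simp add: add)
      then have "poly.coeff P i = poly.coeff (f + [:poly f y:]) i" by simp
      moreover have "poly.coeff P i = (\<Sum>k\<le>N. c k * of_nat (k choose i) * y ^ (k - i))"
        using ni by (simp add: P_def Polynomial.coeff_sum sum.delta' if_distrib)
      moreover have "poly.coeff (f + [:poly f y:]) i = c i"
        using ni by (cases i) (auto simp: c_def)
      ultimately show ?thesis by simp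
    qed
    define Q where
      "Q = (\<Sum>k\<in>{i..N}. Polynomial.monom (c k * of_nat (k choose i)) (k - i)) - [:c i:]"
    have "(\<Sum>k\<le>N. c k * of_nat (k choose i) * y ^ (k - i)) =
          (\<Sum>k\<in>{i..N}. c k * of_nat (k choose i) * y ^ (k - i))" for y
      by (intro sum.mono_neutral_right) (auto simp: binomial_eq_0)
    then have "Q = 0"
      using eq by (intro zero) (simp add: Q_def poly_sum poly_monom)
    then have "poly.coeff Q (n - i) = 0" by simp
    moreover have "poly.coeff Q (n - i) =
      (\<Sum>k\<in>{i..N}. if k - i = n - i then c k * of_nat (k choose i) else 0)"
      using ni unfolding Q_def by (simp add: Polynomial.coeff_sum coeff_pCons split: nat.split)
    moreover have "\<dots> = (\<Sum>k\<in>{i..N}. if k = n then c k * of_nat (k choose i) else 0)"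
      using ni by (intro sum.cong) auto
    ultimately show ?thesis using ni by simp
  qed
  have "poly f 0 = poly f 0 + poly f 0" using add[of 0 0] by (simp only: add_0_left)
  then have c0: "c 0 = 0" by (metis add_cancel_right_right c_def poly_0_coeff_0)
  have h_add: "h (x + y) = h x + h y" if "x \<in> K" "y \<in> K" for x y
    using h that by (auto simp: ring_hom_def ring_of_type_algebra_def)
  have "h 0 = h 0 + h 0" using h_add[OF K0 K0] by (simp only: add_0_left)
  then have h0: "h 0 = 0" by (metis add_cancel_right_right)
  have h_nat: "h (x * of_nat m) = h x * of_nat m \<and> x * of_nat m \<in> K" if "x \<in> K" for x m
    using that
  proof (induction m)
    case (Suc m)
    then have "x + x * of_nat m \<in> K"
      using sub(7)[of x "x * of_nat m"] by (simp add: ring_of_type_algebra_def)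
    with Suc show ?case by (simp add: distrib_left h_add)
  qed (simp add: h0 K0)
  have "h (c n) * (a + b) ^ n = h (c n) * a ^ n + h (c n) * b ^ n" if n: "n \<le> N" for n
  proof (cases "n = 0")
    case True
    then show ?thesis by (simp add: c0 h0)
  next
    case False
    have "h (c n) * (a + b) ^ n = (\<Sum>i\<le>n. h (c n) * of_nat (n choose i) * a ^ i * b ^ (n - i))"
      by (simp add: binomial_ring sum_distrib_left mult_ac)
    also have "\<dots> = (\<Sum>i\<in>{0, n}. h (c n) * of_nat (n choose i) * a ^ i * b ^ (n - i))"
    proof (intro sum.mono_neutral_right ballI)
      fix i assume "i \<in> {..n} - {0, n}"
      then have "c n * of_nat (n choose i) = 0" using n by (intro binom) auto
      then have "h (c n) * of_nat (n choose i) = 0"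
        using h_nat[OF cK, of n "n choose i"] h0 by metis
      then show "h (c n) * of_nat (n choose i) * a ^ i * b ^ (n - i) = 0" by simp
    qed auto
    finally show ?thesis using False by (simp add: add.commute)
  qed
  then show ?thesis
    by (simp add: eval_in_type sum.distrib[symmetric] c_def N_def)
qed

end

theory Submission
  imports Defs
begin

text \<open>
  Let \<open>z \<in> K1 - K\<close> have least degree. If \<open>z\<close> is inseparable, then \<open>z\<^sup>p \<in> K\<close> and \<open>X\<^sup>p\<close> does the
  job. Otherwise let \<open>L\<close> be the splitting field of the minimal polynomial of \<open>z\<close>, let \<open>G\<close> be the
  automorphism group over \<open>K\<close> of the algebraic closure, \<open>N\<close> the normal subgroup of those \<open>\<sigma>\<close>
  with \<open>v (\<sigma> x - x) > v x\<close> on \<open>L\<close>, and \<open>R\<close> the fixed field of \<open>N\<close> in \<open>L\<close>. Since \<open>R\<close> lies in the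
  ramification field, linear disjointness makes \<open>N\<close> transitive on the conjugates of \<open>z\<close>; on \<open>L\<close>,
  \<open>N\<close> acts like a \<open>p\<close>-group, and minimality of \<open>K1\<close> forces the stabilizer of \<open>z\<close> in \<open>N\<close> to act
  trivially, so \<open>L = R(z)\<close>. Consider the \<open>G\<close>-stable \<open>R\<close>-space \<open>W = {w \<in> L. \<forall>\<sigma> \<in> N. \<sigma> w - w \<in>
  R}\<close>. It is larger than \<open>R\<close>, and by Galois descent it contains some \<open>t \<in> K1 - K\<close>. Then \<open>\<sigma> \<mapsto> \<sigma> t
  - t\<close> is a homomorphism from \<open>N\<close> to the additive group of \<open>R\<close>, so the conjugates of \<open>t\<close> form a
  coset \<open>t + S\<close> of a finite additive group \<open>S\<close>, and \<open>A = \<Prod>a\<in>S. (X - a)\<close> is additive with \<open>A -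
  A(t)\<close> the minimal polynomial of \<open>t\<close>. Multiplying \<open>t\<close> by a suitable element of \<open>K\<close> makes \<open>S\<close>,
  and with it \<open>A\<close>, integral.
\<close>

section \<open>Subfields and minimal polynomials\<close>

text \<open>Stated with the operations of the type class and for subrings, so that subfields and the
  valuation ring \<open>V\<close> share the closure rules for polynomials.\<close>

locale ring_set =
  fixes F :: "'a::field set"
  assumes zero: "0 \<in> F" and one: "1 \<in> F"
    and add: "\<And>x y. x \<in> F \<Longrightarrow> y \<in> F \<Longrightarrow> x + y \<in> F"
    and mult: "\<And>x y. x \<in> F \<Longrightarrow> y \<in> F \<Longrightarrow> x * y \<in> F"
    and uminus: "\<And>x. x \<in> F \<Longrightarrow> - x \<in> F"
begin

lemma diff: "x \<in> F \<Longrightarrow> y \<in> F \<Longrightarrow> x - y \<in> F"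
  using add[of x "- y"] uminus[of y] by simp

lemma sum: "(\<And>i. i \<in> I \<Longrightarrow> g i \<in> F) \<Longrightarrow> sum g I \<in> F"
  by (induction I rule: infinite_finite_induct) (auto simp: zero add)

lemma power: "x \<in> F \<Longrightarrow> x ^ n \<in> F"
  by (induction n) (auto simp: one mult)

lemma of_nat: "of_nat n \<in> F"
  by (induction n) (auto simp: zero one add)

lemma of_int: "of_int n \<in> F"
  by (cases n) (auto simp: of_nat uminus simp flip: of_nat_Suc)

lemma poly_mem: "f \<in> polys_over F \<Longrightarrow> x \<in> F \<Longrightarrow> poly f x \<in> F"
  by (simp add: poly_altdef polys_over_def sum mult power)

lemma const_polys: "c \<in> F \<Longrightarrow> [:c:] \<in> polys_over F"
  by (auto simp: polys_over_def coeff_pCons zero split: nat.split)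

lemma X_polys: "[:0, 1:] \<in> polys_over F"
  by (auto simp: polys_over_def coeff_pCons zero one split: nat.split)

lemma zero_polys: "0 \<in> polys_over F"
  by (simp add: polys_over_def zero)

lemma add_polys: "f \<in> polys_over F \<Longrightarrow> g \<in> polys_over F \<Longrightarrow> f + g \<in> polys_over F"
  by (simp add: polys_over_def add)

lemma diff_polys: "f \<in> polys_over F \<Longrightarrow> g \<in> polys_over F \<Longrightarrow> f - g \<in> polys_over F"
  by (simp add: polys_over_def diff)

lemma mult_polys: "f \<in> polys_over F \<Longrightarrow> g \<in> polys_over F \<Longrightarrow> f * g \<in> polys_over F"
  by (simp add: polys_over_def coeff_mult sum mult)

lemma smult_polys: "c \<in> F \<Longrightarrow> f \<in> polys_over F \<Longrightarrow> Polynomial.smult c f \<in> polys_over F"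
  by (simp add: polys_over_def mult)

lemma monom_polys: "c \<in> F \<Longrightarrow> Polynomial.monom c n \<in> polys_over F"
  by (simp add: polys_over_def zero)

lemma pderiv_polys: "f \<in> polys_over F \<Longrightarrow> pderiv f \<in> polys_over F"
  by (simp add: polys_over_def coeff_pderiv mult of_nat del: of_nat_Suc)

lemma prod_polys: "(\<And>i. i \<in> I \<Longrightarrow> g i \<in> polys_over F) \<Longrightarrow> prod g I \<in> polys_over F"
  by (induction I rule: infinite_finite_induct) 
     (auto simp: mult_polys const_polys[OF one, folded one_pCons])

text \<open>Subtracting the multiple of \<open>f\<close> that cancels the leading term of
  \<open>h\<close> needs no inverse because \<open>f\<close> is monic, so quotient and remainder
  stay over the subring.\<close>

lemma monic_division:
  assumes f: "f \<in> polys_over F" "lead_coeff f = 1" and h: "h \<in> polys_over F"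
  shows "\<exists>q\<in>polys_over F. \<exists>r\<in>polys_over F.
           h = f * q + r \<and> (r = 0 \<or> Polynomial.degree r < Polynomial.degree f)"
  using h
proof (induction "Polynomial.degree h" arbitrary: h rule: less_induct)
  case (less h)
  show ?case
  proof (cases "h = 0 \<or> Polynomial.degree h < Polynomial.degree f")
    case True
    with less.prems zero_polys show ?thesis by (intro bexI[of _ 0] bexI[of _ h]) auto
  next
    case False
    define m where "m = Polynomial.monom (lead_coeff h) (Polynomial.degree h - Polynomial.degree f)"
    have m: "m \<in> polys_over F"
      using less.prems by (auto simp: m_def polys_over_def zero)
    have lch: "lead_coeff h \<noteq> 0" and f0: "f \<noteq> 0" using False f(2) by auto
    then have m0: "m \<noteq> 0" by (simp add: m_def)
    have deg: "Polynomial.degree (m * f) = Polynomial.degree h"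
      using False lch m0 f0 by (simp add: degree_mult_eq degree_monom_eq m_def)
    have lc: "lead_coeff (m * f) = lead_coeff h"
      using lead_coeff_mult[of m f] f(2) lch by (simp add: m_def degree_monom_eq)
    have *: "h - m * f = 0 \<or> Polynomial.degree (h - m * f) < Polynomial.degree h"
      using eq_zero_or_degree_less[of "h - m * f" "Polynomial.degree h"] deg lc
        degree_diff_le[of h _ "m * f"] by auto
    show ?thesis
    proof (cases "h - m * f = 0")
      case True
      then show ?thesis
        using m zero_polys by (intro bexI[of _ m] bexI[of _ 0]) (auto simp: mult.commute)
    next
      case False
      with * less.hyps[of "h - m * f"] obtain q r where
        "q \<in> polys_over F" "r \<in> polys_over F" "h - m * f = f * q + r"
        "r = 0 \<or> Polynomial.degree r < Polynomial.degree f"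
        using less.prems m f(1) diff_polys mult_polys by metis
      then show ?thesis
        using m add_polys by (intro bexI[of _ "q + m"] bexI[of _ r]) (auto simp: algebra_simps)
    qed
  qed
qed

lemma linear_polys: "a \<in> F \<Longrightarrow> [:- a, 1:] \<in> polys_over F"
  by (auto simp: polys_over_def coeff_pCons zero one uminus split: nat.split)

end

lemma polys_over_mono: "S \<subseteq> T \<Longrightarrow> polys_over S \<subseteq> polys_over T"
  by (auto simp: polys_over_def)

locale field_set = ring_set +
  assumes inverse: "\<And>x. x \<in> F \<Longrightarrow> inverse x \<in> F"
begin

lemma divide: "x \<in> F \<Longrightarrow> y \<in> F \<Longrightarrow> x / y \<in> F"
  by (simp add: divide_inverse mult inverse)

end

lemma is_subfield_iff: "is_subfield F \<longleftrightarrow> field_set F"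
proof
  let ?R = "ring_of_type_algebra :: 'a ring"
  interpret R: field ?R by (rule field_from_type_algebra)
  have minus: "\<ominus>\<^bsub>?R\<^esub> x = - x" for x
    by (rule R.minus_equality) (auto simp: ring_of_type_algebra_def)
  have inv: "inv\<^bsub>?R\<^esub> x = inverse x" if "x \<noteq> 0" for x
    by (rule R.comm_inv_char) (use that in \<open>auto simp: ring_of_type_algebra_def\<close>)
  {
    assume F: "is_subfield F"
    note sub = subringE[OF subfieldE(1)[OF F]]
    have "inverse x \<in> F" if "x \<in> F" for x
    proof (cases "x = 0")
      case False
      with that have "inv\<^bsub>?R\<^esub> x \<in> F"
        using R.subfield_m_inv(1)[OF F, of x] by (simp add: ring_of_type_algebra_def)
      with False inv show ?thesis by simp
    qed (use that in simp)
    with sub minus show "field_set F"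
      by unfold_locales (auto simp: ring_of_type_algebra_def)
  }
  assume "field_set F"
  then interpret field_set F .
  show "is_subfield F"
  proof (rule R.subfieldI')
    show "subring F ?R"
      by (rule R.subringI) (auto simp: minus uminus one mult add, auto simp: ring_of_type_algebra_def one mult add)
    show "inv\<^bsub>?R\<^esub> k \<in> F" if "k \<in> F - {\<zero>\<^bsub>?R\<^esub>}" for k
      using that inv[of k] inverse[of k] by (auto simp: ring_of_type_algebra_def)
  qed
qed

text \<open>The type is algebraically closed, so it is an algebraic closure of
  \<open>K\<close>.\<close>

locale alg_ext = field_set K for K :: "'a::alg_closed_field set" +
  assumes algebraic: "\<exists>f\<in>polys_over K. f \<noteq> 0 \<and> poly f x = 0"
begin

lemma least_degree_relation:
  obtains f where "f \<in> polys_over K" "f \<noteq> 0" "poly f x = 0"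
    "\<And>g. g \<in> polys_over K \<and> g \<noteq> 0 \<and> poly g x = 0 \<Longrightarrow>
       Polynomial.degree f \<le> Polynomial.degree g"
proof -
  obtain f0 where f0: "f0 \<in> polys_over K \<and> f0 \<noteq> 0 \<and> poly f0 x = 0"
    using algebraic by blast
  show ?thesis
    using ex_has_least_nat[of "\<lambda>f. f \<in> polys_over K \<and> f \<noteq> 0 \<and> poly f x = 0", OF f0,
        of Polynomial.degree] that by blast
qed

text \<open>A relation of least degree for \<open>x \<noteq> 0\<close> has a nonzero constant term,
  as otherwise \<open>x\<close> could be cancelled. Solving for that term writes
  \<open>inverse x\<close> as a polynomial in \<open>x\<close> over \<open>K\<close>.\<close>

lemma alg_ext_of_subring:
  assumes "K \<subseteq> F"
    and add: "\<And>x y. x \<in> F \<Longrightarrow> y \<in> F \<Longrightarrow> x + y \<in> F"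
    and mult: "\<And>x y. x \<in> F \<Longrightarrow> y \<in> F \<Longrightarrow> x * y \<in> F"
  shows "alg_ext F"
proof -
  have "- x \<in> F" if "x \<in> F" for x
    using mult[of "- 1" x] uminus[OF one] assms(1) that by auto
  then interpret F: ring_set F
    using assms zero one by unfold_locales auto
  have "inverse x \<in> F" if x: "x \<in> F" "x \<noteq> 0" for x
  proof -
    obtain f where f: "f \<in> polys_over K" "f \<noteq> 0" "poly f x = 0"
      and least: "\<And>g. g \<in> polys_over K \<and> g \<noteq> 0 \<and> poly g x = 0 \<Longrightarrow>
                   Polynomial.degree f \<le> Polynomial.degree g"
      using least_degree_relation by blast
    obtain c q where cq: "f = pCons c q" by (cases f) auto
    have c: "c \<in> K" and q: "q \<in> polys_over K"
      using f(1) unfolding cq polys_over_def mem_Collect_eq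
      by (metis coeff_pCons_0, metis coeff_pCons_Suc)
    have "c \<noteq> 0"
    proof
      assume "c = 0"
      with f cq x have "poly q x = 0" "q \<noteq> 0" by auto
      with least[of q] q have "Polynomial.degree f \<le> Polynomial.degree q" by blast
      with cq \<open>q \<noteq> 0\<close> show False by simp
    qed
    moreover have "c + x * poly q x = 0" using f cq by simp
    then have "c = - (x * poly q x)" by (simp add: eq_neg_iff_add_eq_0)
    ultimately have "inverse x = - (poly q x * inverse c)"
      using x by (auto simp: field_simps)
    moreover have "poly q x \<in> F" using q x polys_over_mono[OF assms(1)] by (blast intro: F.poly_mem)
    moreover have "inverse c \<in> F" using c assms(1) inverse by blast
    ultimately show ?thesis using F.mult F.uminus by simp
  qed
  then have "inverse x \<in> F" if "x \<in> F" for x using that by (cases "x = 0") auto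
  then show ?thesis
    using algebraic polys_over_mono[OF assms(1)] by unfold_locales blast+
qed

lemma min_poly_exists: obtains f where "is_min_poly K x f"
proof -
  obtain f where f: "f \<in> polys_over K" "f \<noteq> 0" "poly f x = 0"
    and least: "\<And>g. g \<in> polys_over K \<and> g \<noteq> 0 \<and> poly g x = 0 \<Longrightarrow>
                 Polynomial.degree f \<le> Polynomial.degree g"
    using least_degree_relation by blast
  have "inverse (lead_coeff f) \<in> K" using f by (auto simp: polys_over_def intro: inverse)
  then have "is_min_poly K x (Polynomial.smult (inverse (lead_coeff f)) f)"
    using f least by (auto simp: is_min_poly_def intro!: smult_polys)
  then show ?thesis by (rule that)
qed

lemma min_poly_dvd:
  assumes f: "is_min_poly K x f" and h: "h \<in> polys_over K" "poly h x = 0"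
  obtains q where "q \<in> polys_over K" "h = f * q"
proof -
  have f': "f \<in> polys_over K" "lead_coeff f = 1" "poly f x = 0"
    using f by (auto simp: is_min_poly_def)
  obtain q r where qr: "q \<in> polys_over K" "r \<in> polys_over K" "h = f * q + r"
    and r: "r = 0 \<or> Polynomial.degree r < Polynomial.degree f"
    using monic_division[OF f'(1,2) h(1)] by blast
  have "poly r x = 0" using h(2) f'(3) qr(3) by simp
  then have "r = 0" using f r qr(2) unfolding is_min_poly_def by (metis not_le)
  with qr that show ?thesis by simp
qed

end

section \<open>Automorphisms and fixed fields\<close>

text \<open>Automorphisms of the whole algebraic closure, not of a normal extension: as total
  functions they compose and invert freely, and \<open>iso_graph_extend\<close> obtains every
  partial isomorphism over \<open>K\<close> as a restriction of one.\<close>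

definition aut_over :: "'a::field set \<Rightarrow> ('a \<Rightarrow> 'a) set" where
  "aut_over F = {\<sigma>. bij \<sigma> \<and> (\<forall>x y. \<sigma> (x + y) = \<sigma> x + \<sigma> y) \<and> (\<forall>x y. \<sigma> (x * y) = \<sigma> x * \<sigma> y) \<and>
                     (\<forall>x\<in>F. \<sigma> x = x)}"

lemma aut_over_mono: "F \<subseteq> E \<Longrightarrow> aut_over E \<subseteq> aut_over F"
  by (auto simp: aut_over_def)

lemma aut_over_fix: "\<sigma> \<in> aut_over F \<Longrightarrow> x \<in> F \<Longrightarrow> \<sigma> x = x"
  by (auto simp: aut_over_def)

lemma aut_over_comp: "\<sigma> \<in> aut_over F \<Longrightarrow> \<tau> \<in> aut_over F \<Longrightarrow> \<sigma> \<circ> \<tau> \<in> aut_over F"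
  by (auto simp: aut_over_def bij_comp)

lemma aut_over_inj: "\<sigma> \<in> aut_over F \<Longrightarrow> \<sigma> x = \<sigma> y \<longleftrightarrow> x = y"
  by (auto simp: aut_over_def bij_def inj_eq)

lemma aut_over_inv_simps:
  assumes "\<sigma> \<in> aut_over F"
  shows "inv_into UNIV \<sigma> (\<sigma> x) = x" "\<sigma> (inv_into UNIV \<sigma> x) = x"
  using assms by (auto simp: aut_over_def bij_is_inj bij_is_surj surj_f_inv_f)

lemma aut_over_inv:
  assumes \<sigma>: "\<sigma> \<in> aut_over F"
  shows "inv_into UNIV \<sigma> \<in> aut_over F"
proof -
  have hom: "\<sigma> (x + y) = \<sigma> x + \<sigma> y" "\<sigma> (x * y) = \<sigma> x * \<sigma> y" for x y
    using \<sigma> by (auto simp: aut_over_def)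
  note s = aut_over_inv_simps[OF \<sigma>] and i = aut_over_inj[OF \<sigma>]
  have "inv_into UNIV \<sigma> (x + y) = inv_into UNIV \<sigma> x + inv_into UNIV \<sigma> y"
    "inv_into UNIV \<sigma> (x * y) = inv_into UNIV \<sigma> x * inv_into UNIV \<sigma> y" for x y
    by (subst i[symmetric], simp add: hom s)+
  moreover have "inv_into UNIV \<sigma> x = x" if "x \<in> F" for x
    using s(1)[of x] aut_over_fix[OF \<sigma> that] by simp
  moreover have "bij (inv_into UNIV \<sigma>)" using \<sigma> by (auto simp: aut_over_def bij_imp_bij_inv)
  ultimately show ?thesis by (auto simp: aut_over_def)
qed

lemma aut_over_id: "(\<lambda>x. x) \<in> aut_over F"
  by (auto simp: aut_over_def bij_def)

locale field_aut =
  fixes \<sigma> :: "'a::field \<Rightarrow> 'a"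
  assumes bij: "bij \<sigma>" and add: "\<sigma> (x + y) = \<sigma> x + \<sigma> y" and mult: "\<sigma> (x * y) = \<sigma> x * \<sigma> y"
begin

lemma inject: "\<sigma> x = \<sigma> y \<longleftrightarrow> x = y"
  using bij by (auto simp: bij_def inj_eq)

lemma zero: "\<sigma> 0 = 0"
  using add[of 0 0] by (simp only: add_0_left add_cancel_right_right)

lemma eq_0_iff: "\<sigma> x = 0 \<longleftrightarrow> x = 0"
  using inject[of x 0] by (simp add: zero)

lemma one: "\<sigma> 1 = 1"
  using mult[of 1 1] eq_0_iff[of 1] by simp

lemma uminus: "\<sigma> (- x) = - \<sigma> x"
  using add[of x "- x"] by (simp add: zero eq_neg_iff_add_eq_0 add.commute)

lemma diff: "\<sigma> (x - y) = \<sigma> x - \<sigma> y"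
  using add[of x "- y"] by (simp add: uminus)

lemma divide: "\<sigma> (x / y) = \<sigma> x / \<sigma> y"
proof (cases "y = 0")
  case False
  then have "\<sigma> (x / y) * \<sigma> y = \<sigma> x" by (simp flip: mult)
  with False show ?thesis by (simp add: eq_divide_eq eq_0_iff)
qed (simp add: zero)

lemma sum: "\<sigma> (sum g I) = (\<Sum>i\<in>I. \<sigma> (g i))"
  by (induction I rule: infinite_finite_induct) (auto simp: zero add)

lemma power: "\<sigma> (x ^ n) = \<sigma> x ^ n"
  by (induction n) (auto simp: one mult)

lemma of_nat: "\<sigma> (of_nat n) = of_nat n"
  by (induction n) (auto simp: zero one add)

lemma coeff_map: "poly.coeff (map_poly \<sigma> f) i = \<sigma> (poly.coeff f i)"
  by (rule coeff_map_poly) (rule zero)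

lemma degree_map: "Polynomial.degree (map_poly \<sigma> f) = Polynomial.degree f"
  by (rule degree_map_poly) (simp add: eq_0_iff)

lemma poly: "\<sigma> (poly f x) = poly (map_poly \<sigma> f) (\<sigma> x)"
  by (simp add: poly_altdef degree_map coeff_map sum mult power)

lemma map_linear_prod:
  assumes "finite Y"
  shows "map_poly \<sigma> (\<Prod>y\<in>Y. [:- y, 1:]) = (\<Prod>y\<in>\<sigma> ` Y. [:- y, 1:])"
proof -
  have "map_poly \<sigma> (\<Prod>y\<in>Y. [:- y, 1:]) = (\<Prod>y\<in>Y. [:- \<sigma> y, 1:])"
    using assms
  proof (induction Y)
    case empty
    show ?case by (simp add: map_poly_1' one)
  next
    case (insert y Y)
    have "map_poly \<sigma> ([:- y, 1:] * f) = [:- \<sigma> y, 1:] * map_poly \<sigma> f" for f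
      by (rule poly_eqI) (simp add: coeff_map coeff_pCons add mult uminus diff one zero split: nat.split)
    with insert show ?case by (simp del: mult_pCons_left mult_pCons_right)
  qed
  also have "\<dots> = (\<Prod>y\<in>\<sigma> ` Y. [:- y, 1:])"
    by (subst prod.reindex) (auto intro: inj_onI simp: inject)
  finally show ?thesis .
qed

end

lemma aut_over_field_aut: "\<sigma> \<in> aut_over F \<Longrightarrow> field_aut \<sigma>"
  by (auto simp: aut_over_def field_aut_def)

lemma aut_over_poly:
  assumes "\<sigma> \<in> aut_over F" "f \<in> polys_over F"
  shows "\<sigma> (poly f x) = poly f (\<sigma> x)"
proof -
  interpret field_aut \<sigma> using assms(1) by (rule aut_over_field_aut)
  have "map_poly \<sigma> f = f"
    using assms by (intro poly_eqI) (auto simp: coeff_map polys_over_def aut_over_fix)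
  then show ?thesis by (simp add: poly)
qed

text \<open>A partial isomorphism is encoded by its graph, a subring of the product ring.\<close>

definition iso_graph :: "'a::field set \<Rightarrow> ('a \<times> 'a) set \<Rightarrow> bool" where
  "iso_graph K P \<longleftrightarrow> (\<forall>x\<in>K. (x, x) \<in> P) \<and>
     (\<forall>a b c d. (a, b) \<in> P \<and> (c, d) \<in> P \<longrightarrow> (a + c, b + d) \<in> P \<and> (a * c, b * d) \<in> P) \<and>
     (\<forall>b. (0, b) \<in> P \<longrightarrow> b = 0)"

context alg_ext
begin

text \<open>Two pairs with the same first entry differ by a pair \<open>(0, b)\<close>, so the graph
  is single-valued. Its domain is a field, so the map it describes has trivial kernel.\<close>

lemma iso_graph_hom:
  assumes P: "iso_graph K P"
  shows "\<exists>s. alg_ext (fst ` P) \<and> (\<forall>a b. (a, b) \<in> P \<longleftrightarrow> a \<in> fst ` P \<and> b = s a) \<and>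
    (\<forall>x\<in>K. s x = x) \<and>
    (\<forall>x\<in>fst ` P. \<forall>y\<in>fst ` P. s (x + y) = s x + s y \<and> s (x * y) = s x * s y) \<and>
    (\<forall>x\<in>fst ` P. s x = 0 \<longleftrightarrow> x = 0)"
proof -
  have K: "\<And>x. x \<in> K \<Longrightarrow> (x, x) \<in> P"
    and Padd: "\<And>a b c d. (a, b) \<in> P \<Longrightarrow> (c, d) \<in> P \<Longrightarrow> (a + c, b + d) \<in> P"
    and Pmult: "\<And>a b c d. (a, b) \<in> P \<Longrightarrow> (c, d) \<in> P \<Longrightarrow> (a * c, b * d) \<in> P"
    and P0: "\<And>b. (0, b) \<in> P \<Longrightarrow> b = 0"
    using P by (auto simp: iso_graph_def)
  have dom: "alg_ext (fst ` P)"
  proof (rule alg_ext_of_subring)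
    show "K \<subseteq> fst ` P" using K by force
    fix x y assume "x \<in> fst ` P" "y \<in> fst ` P"
    then obtain b d where bd: "(x, b) \<in> P" "(y, d) \<in> P" by force
    show "x + y \<in> fst ` P" "x * y \<in> fst ` P"
      using Padd[OF bd] Pmult[OF bd] by force+
  qed
  interpret D: alg_ext "fst ` P" by (rule dom)
  have unique: "b = c" if "(a, b) \<in> P" "(a, c) \<in> P" for a b c
    using P0[of "b - c"] Padd[OF that(1) Pmult[OF K[OF uminus[OF one]] that(2)]] by simp
  define s where "s a = (SOME b. (a, b) \<in> P)" for a
  have s: "(a, s a) \<in> P" if "a \<in> fst ` P" for a
    using that unfolding s_def by (auto intro: someI)
  have s_eq: "s a = b" if "(a, b) \<in> P" for a b
    using unique[OF s[of a] that] that by (simp add: rev_image_eqI)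
  have hom: "s (x + y) = s x + s y \<and> s (x * y) = s x * s y" if "x \<in> fst ` P" "y \<in> fst ` P" for x y
    using s_eq[OF Padd[OF s s]] s_eq[OF Pmult[OF s s]] that by simp
  have sK: "s x = x" if "x \<in> K" for x using s_eq[OF K[OF that]] .
  have "s x = 0 \<longleftrightarrow> x = 0" if x: "x \<in> fst ` P" for x
  proof
    assume "s x = 0"
    show "x = 0"
    proof (rule ccontr)
      assume "x \<noteq> 0"
      then have "s 1 = s x * s (inverse x)" using hom[OF x D.inverse[OF x]] by simp
      with \<open>s x = 0\<close> sK[OF one] show False by simp
    qed
  qed (use sK[OF zero] in simp)
  moreover have "(a, b) \<in> P \<longleftrightarrow> a \<in> fst ` P \<and> b = s a" for a b
    using s[of a] s_eq[of a b] by (auto simp: rev_image_eqI)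
  ultimately show ?thesis using dom sK hom by (intro exI[of _ s]) simp
qed

text \<open>Zorn's lemma gives a maximal graph. It is defined everywhere, since an element outside
  its domain could be mapped to a root of its transported minimal polynomial.\<close>

theorem iso_graph_extend:
  assumes P: "iso_graph K P"
  shows "\<exists>\<sigma>\<in>aut_over K. \<forall>a b. (a, b) \<in> P \<longrightarrow> \<sigma> a = b"
proof -
  define A where "A = {Q. P \<subseteq> Q \<and> iso_graph K Q}"
  have "\<exists>M\<in>A. \<forall>Q\<in>A. M \<subseteq> Q \<longrightarrow> Q = M"
  proof (rule subset_Zorn_nonempty)
    show "A \<noteq> {}" using P by (auto simp: A_def)
    fix C assume "C \<noteq> {}" and C: "subset.chain A C"
    then have sub: "\<And>Q. Q \<in> C \<Longrightarrow> P \<subseteq> Q \<and> iso_graph K Q" by (auto simp: A_def subset_chain_def)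
    obtain Q0 where "Q0 \<in> C" using \<open>C \<noteq> {}\<close> by blast
    have common: "\<exists>Q\<in>C. u \<in> Q \<and> w \<in> Q" if "u \<in> \<Union>C" "w \<in> \<Union>C" for u w
    proof -
      from that obtain Q R where "Q \<in> C" "u \<in> Q" "R \<in> C" "w \<in> R" by blast
      moreover have "Q \<subseteq> R \<or> R \<subseteq> Q" using C calculation by (auto simp: subset_chain_def)
      ultimately show ?thesis by blast
    qed
    have "(a + c, b + d) \<in> \<Union>C \<and> (a * c, b * d) \<in> \<Union>C" if "(a, b) \<in> \<Union>C" "(c, d) \<in> \<Union>C" for a b c d
      using common[OF that] sub unfolding iso_graph_def by (metis UnionI)
    moreover have "(x, x) \<in> \<Union>C" if "x \<in> K" for x
      using sub[OF \<open>Q0 \<in> C\<close>] \<open>Q0 \<in> C\<close> that unfolding iso_graph_def by blast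
    moreover have "b = 0" if "(0, b) \<in> \<Union>C" for b
      using sub that unfolding iso_graph_def by blast
    ultimately show "\<Union>C \<in> A"
      unfolding A_def using sub[OF \<open>Q0 \<in> C\<close>] \<open>Q0 \<in> C\<close> by (auto simp: iso_graph_def)
  qed
  then obtain M where PM: "P \<subseteq> M" and M: "iso_graph K M"
    and maximal: "\<And>Q. iso_graph K Q \<Longrightarrow> M \<subseteq> Q \<Longrightarrow> Q = M"
    unfolding A_def by (smt (verit, ccfv_threshold) mem_Collect_eq order_trans)
  define D where "D = fst ` M"
  obtain s where "alg_ext D" and s: "\<And>a b. (a, b) \<in> M \<longleftrightarrow> a \<in> D \<and> b = s a"
    and sK: "\<And>x. x \<in> K \<Longrightarrow> s x = x"
    and hom: "\<And>x y. x \<in> D \<Longrightarrow> y \<in> D \<Longrightarrow> s (x + y) = s x + s y \<and> s (x * y) = s x * s y"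
    and s0: "\<And>x. x \<in> D \<Longrightarrow> s x = 0 \<longleftrightarrow> x = 0"
    using iso_graph_hom[OF M, folded D_def] by auto
  interpret D: alg_ext D by fact
  have s_zero: "s 0 = 0" and s_one: "s 1 = 1" using sK zero one by auto
  have KD: "K \<subseteq> D" using M by (auto simp: iso_graph_def s)
  have s_sum: "s (sum g I) = (\<Sum>i\<in>I. s (g i))" if "\<And>i. i \<in> I \<Longrightarrow> g i \<in> D" for g and I :: "nat set"
    using that by (induction I rule: infinite_finite_induct) (auto simp: s_zero hom D.sum)
  have "x \<in> D" for x
  proof (rule ccontr)
    assume x: "x \<notin> D"
    obtain f where f: "is_min_poly D x f" by (rule D.min_poly_exists)
    then have f': "f \<in> polys_over D" "lead_coeff f = 1" "poly f x = 0" by (auto simp: is_min_poly_def)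
    have cf: "poly.coeff (map_poly s h) i = s (poly.coeff h i)" for h i
      by (rule coeff_map_poly) (rule s_zero)
    have madd: "map_poly s (h + k) = map_poly s h + map_poly s k"
      if "h \<in> polys_over D" "k \<in> polys_over D" for h k
      using that by (intro poly_eqI) (auto simp: cf polys_over_def hom)
    have mmult: "map_poly s (h * k) = map_poly s h * map_poly s k"
      if "h \<in> polys_over D" "k \<in> polys_over D" for h k
      using that
      by (intro poly_eqI) (auto simp: cf polys_over_def hom coeff_mult s_sum D.mult)
    have "poly.coeff (map_poly s f) (Polynomial.degree f) \<noteq> 0"
      using f'(2) by (simp add: cf s_one)
    then have "Polynomial.degree f \<le> Polynomial.degree (map_poly s f)" by (rule le_degree)
    moreover have "Polynomial.degree f > 0"
    proof (rule ccontr)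
      assume "\<not> Polynomial.degree f > 0"
      then have "f = 1" using f'(2) by (metis degree_eq_zeroE gr0I lead_coeff_pCons(2) one_pCons)
      with f'(3) show False by simp
    qed
    ultimately obtain y where y: "poly (map_poly s f) y = 0"
      using alg_closed_imp_poly_has_root[of "map_poly s f"] by auto
    \<comment> \<open>Evaluation at \<open>x\<close> goes to evaluation at \<open>y\<close>. This is
      well defined because a polynomial vanishing at \<open>x\<close> is a multiple of
      \<open>f\<close>, whose transport vanishes at \<open>y\<close>.\<close>
    define Q where "Q = {(poly h x, poly (map_poly s h) y) | h. h \<in> polys_over D}"
    have QI: "(poly h x, poly (map_poly s h) y) \<in> Q" if "h \<in> polys_over D" for h
      using that by (auto simp: Q_def)
    have const: "(a, s a) \<in> Q" if "a \<in> D" for a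
      using QI[OF D.const_polys[OF that]] by (simp add: map_poly_pCons s_zero)
    have "iso_graph K Q"
      unfolding iso_graph_def
    proof (intro conjI allI impI ballI)
      show "(a, a) \<in> Q" if "a \<in> K" for a using const[of a] KD sK that by auto
    next
      fix a b c d assume "(a, b) \<in> Q \<and> (c, d) \<in> Q"
      then obtain h k where hk: "h \<in> polys_over D" "k \<in> polys_over D"
        "a = poly h x" "b = poly (map_poly s h) y" "c = poly k x" "d = poly (map_poly s k) y"
        by (auto simp: Q_def)
      show "(a + c, b + d) \<in> Q" using QI[OF D.add_polys[OF hk(1,2)]] hk by (simp add: madd)
      show "(a * c, b * d) \<in> Q" using QI[OF D.mult_polys[OF hk(1,2)]] hk by (simp add: mmult)
    next
      fix b assume "(0, b) \<in> Q"
      then obtain h where h: "h \<in> polys_over D" "poly h x = 0" "b = poly (map_poly s h) y"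
        by (auto simp: Q_def)
      obtain q where "q \<in> polys_over D" "h = f * q"
        using D.min_poly_dvd[OF f h(1,2)] by blast
      then show "b = 0" using f'(1) y by (simp add: h(3) mmult)
    qed
    moreover have "M \<subseteq> Q" using s const by (auto simp: Q_def)
    ultimately have "Q = M" by (rule maximal)
    moreover have "x \<in> fst ` Q" using QI[OF D.X_polys] by force
    ultimately show False using x by (simp add: D_def)
  qed
  then have all: "D = UNIV" by auto
  have inj: "inj s"
  proof (rule injI)
    fix x y assume "s x = s y"
    moreover have "s (- y) = - s y"
      using hom[of "- 1" y] sK[OF uminus[OF one]] by (simp add: all)
    ultimately have "s (x - y) = 0" using hom[of x "- y"] by (simp add: all)
    then show "x = y" using s0 by (simp add: all)
  qed
  \<comment> \<open>\<open>s\<close> is injective and maps the finite root set of each polynomial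
    over \<open>K\<close> into itself, so it permutes that set.\<close>
  have "surj s"
    unfolding surj_def
  proof
    fix y
    obtain f where f: "f \<in> polys_over K" "f \<noteq> 0" "poly f y = 0" using algebraic by blast
    let ?Z = "{x. poly f x = 0}"
    have s_poly: "s (poly f x) = poly f (s x)" for x
    proof -
      have "s (z ^ n) = s z ^ n" for z n by (induction n) (auto simp: s_one hom all)
      then show ?thesis using f(1) by (simp add: poly_altdef s_sum hom all polys_over_def sK)
    qed
    have "finite ?Z" using f(2) by (rule poly_roots_finite)
    moreover have "s ` ?Z \<subseteq> ?Z" using s_poly s_zero by (metis (mono_tags) image_subsetI mem_Collect_eq)
    moreover have "inj_on s ?Z" using inj by (rule inj_on_subset) auto
    ultimately have "s ` ?Z = ?Z" by (intro endo_inj_surj)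
    then show "\<exists>x. y = s x" using f(3) by auto
  qed
  with inj hom sK have "s \<in> aut_over K" by (auto simp: aut_over_def bij_def all)
  moreover have "s a = b" if "(a, b) \<in> P" for a b using subsetD[OF PM that] by (simp add: s)
  ultimately show ?thesis by blast
qed

text \<open>The assignment \<open>poly h x \<mapsto> poly h y\<close> is a partial isomorphism, as
  every \<open>h\<close> over \<open>K\<close> that vanishes at \<open>x\<close> is a multiple of
  \<open>f\<close>.\<close>

lemma min_poly_conjugate:
  assumes f: "is_min_poly K x f" and y: "poly f y = 0"
  obtains \<sigma> where "\<sigma> \<in> aut_over K" "\<sigma> x = y"
proof -
  define P where "P = {(poly h x, poly h y) | h. h \<in> polys_over K}"
  have PI: "(poly h x, poly h y) \<in> P" if "h \<in> polys_over K" for h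
    using that by (auto simp: P_def)
  have "iso_graph K P"
    unfolding iso_graph_def
  proof (intro conjI allI impI ballI)
    show "(a, a) \<in> P" if "a \<in> K" for a using PI[OF const_polys[OF that]] by simp
  next
    fix a b c d assume "(a, b) \<in> P \<and> (c, d) \<in> P"
    then obtain h k where hk: "h \<in> polys_over K" "k \<in> polys_over K"
      "a = poly h x" "b = poly h y" "c = poly k x" "d = poly k y"
      by (auto simp: P_def)
    show "(a + c, b + d) \<in> P" using PI[OF add_polys[OF hk(1,2)]] hk by simp
    show "(a * c, b * d) \<in> P" using PI[OF mult_polys[OF hk(1,2)]] hk by simp
  next
    fix b assume "(0, b) \<in> P"
    then obtain h where h: "h \<in> polys_over K" "poly h x = 0" "b = poly h y"
      by (auto simp: P_def)
    then show "b = 0" using min_poly_dvd[OF f h(1,2)] y by (metis mult_zero_left poly_mult)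
  qed
  from iso_graph_extend[OF this] obtain \<sigma> where
    "\<sigma> \<in> aut_over K" "\<And>a b. (a, b) \<in> P \<Longrightarrow> \<sigma> a = b"
    by blast
  with PI[OF X_polys] that[of \<sigma>] show ?thesis by simp
qed

end

section \<open>Fields generated by roots, and their fixed elements\<close>

definition gen :: "'a::semiring_1 set \<Rightarrow> 'a set \<Rightarrow> 'a set" where
  "gen K B = \<Inter>{S. K \<union> B \<subseteq> S \<and> (\<forall>x\<in>S. \<forall>y\<in>S. x + y \<in> S \<and> x * y \<in> S)}"

lemma gen_base: "x \<in> K \<union> B \<Longrightarrow> x \<in> gen K B"
  and gen_add: "x \<in> gen K B \<Longrightarrow> y \<in> gen K B \<Longrightarrow> x + y \<in> gen K B"
  and gen_mult: "x \<in> gen K B \<Longrightarrow> y \<in> gen K B \<Longrightarrow> x * y \<in> gen K B"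
  by (auto simp: gen_def)

lemma gen_induct [consumes 1, case_names base add mult]:
  assumes "x \<in> gen K B" "\<And>x. x \<in> K \<union> B \<Longrightarrow> P x"
    "\<And>x y. x \<in> gen K B \<Longrightarrow> y \<in> gen K B \<Longrightarrow> P x \<Longrightarrow> P y \<Longrightarrow> P (x + y)"
    "\<And>x y. x \<in> gen K B \<Longrightarrow> y \<in> gen K B \<Longrightarrow> P x \<Longrightarrow> P y \<Longrightarrow> P (x * y)"
  shows "P x"
proof -
  have "gen K B \<subseteq> {y \<in> gen K B. P y}"
    by (subst (1) gen_def, rule Inter_lower)
      (use assms(2-4) in \<open>simp add: subset_iff gen_base gen_add gen_mult\<close>)
  with assms(1) show ?thesis by blast
qed

text \<open>Closing under sums and products already makes \<open>gen K B\<close> the field generated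
  by \<open>B\<close> over \<open>K\<close>: inverses of algebraic elements are polynomials in
  them.\<close>

lemma (in alg_ext) alg_ext_gen: "alg_ext (gen K B)"
  by (rule alg_ext_of_subring) (auto intro: gen_base gen_add gen_mult)

lemma (in alg_ext) gen_insert:
  assumes "x \<in> gen K (insert z B)"
  obtains h where "h \<in> polys_over (gen K B)" "x = poly h z"
proof -
  interpret G: alg_ext "gen K B" by (rule alg_ext_gen)
  have "\<exists>h\<in>polys_over (gen K B). x = poly h z"
    using assms
  proof (induction rule: gen_induct)
    case (base x)
    then show ?case
      using G.X_polys G.const_polys[of x] gen_base[of x K B]
      by (cases "x = z") (force intro: bexI[of _ "[:0, 1:]"], force intro: bexI[of _ "[:x:]"])
  next
    case (add x y)
    then show ?case by (metis G.add_polys poly_add)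
  next
    case (mult x y)
    then show ?case by (metis G.mult_polys poly_mult)
  qed
  then show ?thesis using that by blast
qed

lemma aut_over_gen:
  assumes "\<sigma> \<in> aut_over K" "\<sigma> ` B \<subseteq> gen K B" "x \<in> gen K B"
  shows "\<sigma> x \<in> gen K B"
  using assms(3)
proof (induction rule: gen_induct)
  case (base x)
  then show ?case using assms(1,2) gen_base[of x K B] by (auto simp: aut_over_fix)
qed (use assms(1) in \<open>auto simp: aut_over_def intro: gen_base gen_add gen_mult\<close>)

lemma aut_over_gen_fix:
  assumes "\<sigma> \<in> aut_over K" "\<And>x. x \<in> B \<Longrightarrow> \<sigma> x = x" "x \<in> gen K B"
  shows "\<sigma> x = x"
  using assms(3)
  by (induction rule: gen_induct) (use assms(1,2) in \<open>auto simp: aut_over_def\<close>)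

text \<open>\<open>Y\<close> is the union of the root sets of \<open>g\<close> and \<open>q\<close>,
  each bounded by the degree, while the two degrees add up to \<open>card Y\<close>. Hence both
  bounds are attained.\<close>

lemma card_roots_of_dvd_linear_prod:
  fixes g :: "'a::idom poly"
  assumes "finite Y" "g * q = (\<Prod>y\<in>Y. [:- y, 1:])"
  shows "card {x. poly g x = 0} = Polynomial.degree g"
proof -
  have gq: "g * q \<noteq> 0" using assms by simp
  then have nz: "g \<noteq> 0" "q \<noteq> 0" by auto
  have fin: "finite {x. poly g x = 0}" "finite {x. poly q x = 0}"
    using nz by (auto intro: poly_roots_finite)
  have "Y = {x. poly (g * q) x = 0}" unfolding assms(2) using assms(1) by (auto simp: poly_prod)
  also have "\<dots> = {x. poly g x = 0} \<union> {x. poly q x = 0}" by auto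
  finally have "card Y \<le> card {x. poly g x = 0} + card {x. poly q x = 0}"
    using card_Un_le by metis
  moreover have "card Y = Polynomial.degree (g * q)"
    unfolding assms(2) by (subst degree_prod_eq_sum_degree) auto
  moreover have "\<dots> = Polynomial.degree g + Polynomial.degree q"
    using nz by (rule degree_mult_eq)
  moreover have "card {x. poly g x = 0} \<le> Polynomial.degree g" "card {x. poly q x = 0} \<le> Polynomial.degree q"
    using nz by (auto intro: card_poly_roots_bound)
  ultimately show ?thesis by linarith
qed

text \<open>Separability and normality of \<open>z\<close> in one condition. \<open>Y\<close> may be
  larger than the set of conjugates, so the condition survives any enlargement of
  \<open>K\<close>.\<close>

definition split_root :: "'a::field set \<Rightarrow> 'a \<Rightarrow> bool" where
  "split_root K z \<longleftrightarrow> (\<exists>Y. finite Y \<and> z \<in> Y \<and> (\<Prod>y\<in>Y. [:- y, 1:]) \<in> polys_over K)"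

context alg_ext
begin

text \<open>The remainder \<open>r\<close> of \<open>h\<close> modulo the minimal polynomial of
  \<open>z\<close> takes the same value at all conjugates of \<open>z\<close>. By separability their
  number exceeds the degree of \<open>r\<close>, so \<open>r\<close> is constant.\<close>

lemma fixed_simple:
  assumes z: "split_root K z"
    and h: "h \<in> polys_over K" and fixed: "\<And>\<sigma>. \<sigma> \<in> aut_over K \<Longrightarrow> \<sigma> (poly h z) = poly h z"
  shows "poly h z \<in> K"
proof -
  from z obtain Y where Y: "finite Y" "z \<in> Y" "(\<Prod>y\<in>Y. [:- y, 1:]) \<in> polys_over K"
    by (auto simp: split_root_def)
  obtain g where g: "is_min_poly K z g" by (rule min_poly_exists)
  then have g': "g \<in> polys_over K" "lead_coeff g = 1" "poly g z = 0" by (auto simp: is_min_poly_def)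
  have "poly (\<Prod>y\<in>Y. [:- y, 1:]) z = 0" using Y by (auto simp: poly_prod)
  from min_poly_dvd[OF g Y(3) this] obtain q where "(\<Prod>y\<in>Y. [:- y, 1:]) = g * q" by blast
  then have card: "card {x. poly g x = 0} = Polynomial.degree g"
    using card_roots_of_dvd_linear_prod[OF Y(1)] by metis
  have "finite {x. poly g x = 0}" using g'(2) by (intro poly_roots_finite) auto
  with card g'(3) have pos: "Polynomial.degree g > 0" by (metis (mono_tags) card_gt_0_iff emptyE mem_Collect_eq)
  obtain q r where qr: "q \<in> polys_over K" "r \<in> polys_over K" "h = g * q + r"
    and r: "r = 0 \<or> Polynomial.degree r < Polynomial.degree g"
    using monic_division[OF g'(1,2) h] by blast
  have hr: "poly h z = poly r z" using qr g' by simp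
  have "poly r y = poly r z" if "poly g y = 0" for y
    using min_poly_conjugate[OF g that] fixed qr(2) hr aut_over_poly by metis
  then have sub: "{x. poly g x = 0} \<subseteq> {x. poly (r - [:poly r z:]) x = 0}" by auto
  have "r - [:poly r z:] = 0"
  proof (rule ccontr)
    assume nz: "r - [:poly r z:] \<noteq> 0"
    have "Polynomial.degree g \<le> card {x. poly (r - [:poly r z:]) x = 0}"
      using card_mono[OF poly_roots_finite[OF nz] sub] card by simp
    also have "\<dots> \<le> Polynomial.degree (r - [:poly r z:])" using nz by (rule card_poly_roots_bound)
    also have "\<dots> < Polynomial.degree g"
      using r pos by (auto intro: degree_diff_less)
    finally show False by simp
  qed
  then have "poly.coeff r 0 = poly r z" by (metis coeff_pCons_0 eq_iff_diff_eq_0)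
  with qr(2) hr show ?thesis by (metis (mono_tags) mem_Collect_eq polys_over_def)
qed

text \<open>Generators are removed one at a time: over the field \<open>gen K B\<close>,
  \<open>fixed_simple\<close> puts \<open>x\<close> into \<open>gen K B\<close>, where the induction
  hypothesis applies.\<close>

theorem fixed_gen:
  assumes "finite B" "\<And>z. z \<in> B \<Longrightarrow> split_root K z"
    and "x \<in> gen K B" and "\<And>\<sigma>. \<sigma> \<in> aut_over K \<Longrightarrow> \<sigma> x = x"
  shows "x \<in> K"
  using assms
proof (induction B arbitrary: x)
  case empty
  have "y \<in> K" if "y \<in> gen K {}" for y
    using that by (induction rule: gen_induct) (auto intro: add mult)
  with empty show ?case by blast
next
  case (insert z B)
  interpret G: alg_ext "gen K B" by (rule alg_ext_gen)
  have K: "K \<subseteq> gen K B" by (auto intro: gen_base)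
  obtain h where h: "h \<in> polys_over (gen K B)" "x = poly h z"
    using gen_insert insert.prems(2) by blast
  have "split_root (gen K B) z"
    using insert.prems(1)[of z] polys_over_mono[OF K] by (auto simp: split_root_def)
  then have "x \<in> gen K B"
    unfolding h(2) using h insert.prems(3) aut_over_mono[OF K] by (intro G.fixed_simple) auto
  with insert show ?case by auto
qed

end

section \<open>Valuation rings and wild orbits\<close>

text \<open>A valuation ring with its maximal ideal, without a value group: comparisons of values
  become memberships of quotients in \<open>V\<close> or \<open>I\<close>. By
  \<open>inverse_in_I\<close>, elements of \<open>V\<close> outside \<open>I\<close> are
  units.\<close>

locale val_ring = O: ring_set V for V :: "'a::field set" +
  fixes I :: "'a set"
  assumes I_sub: "I \<subseteq> V" and I_zero: "0 \<in> I" and one_notin_I: "1 \<notin> I"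
    and I_add: "\<And>x y. x \<in> I \<Longrightarrow> y \<in> I \<Longrightarrow> x + y \<in> I"
    and I_mult: "\<And>x y. x \<in> V \<Longrightarrow> y \<in> I \<Longrightarrow> x * y \<in> I"
    and inverse_in_I: "\<And>x. x \<notin> V \<Longrightarrow> inverse x \<in> I"
begin

lemma I_uminus: "x \<in> I \<Longrightarrow> - x \<in> I"
  using I_mult[OF O.uminus[OF O.one], of x] by simp

lemma I_diff: "x \<in> I \<Longrightarrow> y \<in> I \<Longrightarrow> x - y \<in> I"
  using I_add[of x "- y"] I_uminus by simp

lemma I_sum: "(\<And>i. i \<in> J \<Longrightarrow> g i \<in> I) \<Longrightarrow> sum g J \<in> I"
  by (induction J rule: infinite_finite_induct) (auto simp: I_zero I_add)

text \<open>Bezout gives an inverse of \<open>n\<close> modulo the characteristic, so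
  \<open>of_nat n\<close> is a unit of \<open>V\<close>.\<close>

lemma of_nat_notin_I:
  assumes "prime CHAR('a)" "\<not> CHAR('a) dvd n"
  shows "of_nat n \<notin> I"
proof
  assume "of_nat n \<in> I"
  have "coprime n CHAR('a)" using assms prime_imp_coprime coprime_commute by blast
  then have "gcd (int n) (int CHAR('a)) = 1"
    by (simp add: coprime_iff_gcd_eq_1)
  with bezout_int[of "int n" "int CHAR('a)"] obtain u w where "u * int n + w * int CHAR('a) = 1"
    by metis
  then have "of_int (u * int n + w * int CHAR('a)) = (1 :: 'a)" by simp
  then have "of_int u * of_nat n = (1 :: 'a)" by simp
  with I_mult[OF O.of_int[of u] \<open>of_nat n \<in> I\<close>] one_notin_I show False by simp
qed

end

section \<open>Valuations, their rings, and invariance under automorphisms\<close>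

lemma valuation_fin:
  assumes "valuation_on UNIV v" "x \<noteq> 0"
  obtains g where "v x = Fin g"
  using assms by (cases "v x") (auto simp: valuation_on_def)

lemma valuation_simps:
  fixes v :: "'a::field \<Rightarrow> 'g::linordered_ab_group_add extended"
  assumes v: "valuation_on UNIV v"
  shows "v 0 = \<infinity>" "v 1 = 0" "v (x * y) = v x + v y" "v (- x) = v x"
    "min (v x) (v y) \<le> v (x + y)"
proof -
  show m: "v (x * y) = v x + v y" for x y using v by (auto simp: valuation_on_def)
  show "v 0 = \<infinity>" "min (v x) (v y) \<le> v (x + y)" using v by (auto simp: valuation_on_def)
  obtain g where g: "v 1 = Fin g" using valuation_fin[OF v, of 1] by auto
  with m[of 1 1] show v1: "v 1 = 0" by (simp add: zero_extended_def)
  obtain h where h: "v (- 1) = Fin h" using valuation_fin[OF v, of "- 1"] by auto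
  \<comment> \<open>A linearly ordered group has no 2-torsion, so \<open>v (- 1)\<close> is
    0.\<close>
  have "Fin (h + h) = (0 :: 'g extended)" using m[of "- 1" "- 1"] v1 h by simp
  then have "v (- 1) = 0" using h by (simp add: zero_extended_def double_zero)
  with m[of "- 1" x] show "v (- x) = v x" by simp
qed

lemma valuation_less_iff:
  fixes v :: "'a::field \<Rightarrow> 'g::linordered_ab_group_add extended"
  assumes v: "valuation_on UNIV v" and x: "x \<noteq> 0"
  shows "v x < v y \<longleftrightarrow> 0 < v (y / x)" "v x \<le> v y \<longleftrightarrow> 0 \<le> v (y / x)"
proof -
  obtain g where g: "v x = Fin g" using valuation_fin[OF v x] .
  have "v y = v (y / x) + v x" using valuation_simps(3)[OF v, of "y / x" x] x by simp
  with g show "v x < v y \<longleftrightarrow> 0 < v (y / x)" "v x \<le> v y \<longleftrightarrow> 0 \<le> v (y / x)"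
    by (cases "v (y / x)"; simp add: zero_extended_def)+
qed

lemma valuation_val_ring:
  fixes v :: "'a::field \<Rightarrow> 'g::linordered_ab_group_add extended"
  assumes v: "valuation_on UNIV v"
  shows "val_ring {x. 0 \<le> v x} {x. 0 < v x}"
proof -
  note s = valuation_simps[OF v]
  have pos: "(0 :: 'g extended) < \<infinity>" by (simp add: zero_extended_def)
  show ?thesis
  proof (unfold_locales, goal_cases)
    case (3 x y)
    then show ?case using s(5)[of x y] by (auto simp: min_def split: if_splits)
  next
    case (4 x y)
    then show ?case by (cases "v x"; cases "v y"; simp add: s zero_extended_def)
  next
    case (9 x y)
    then show ?case using s(5)[of x y] by (auto simp: min_def split: if_splits)
  next
    case (10 x y)
    then show ?case by (cases "v x"; cases "v y"; simp add: s zero_extended_def add_nonneg_pos)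
  next
    case (11 x)
    then have "x \<noteq> 0" using s(1) pos by auto
    then have "v x + v (inverse x) = 0" using s(3)[of x "inverse x"] s(2) by simp
    with 11 show ?case
      by (cases "v x"; cases "v (inverse x)"; auto simp: zero_extended_def)
        (metis add.commute less_add_same_cancel1 linorder_not_le neg_less_0_iff_less add_eq_0_iff)
  qed (use s pos in auto)
qed

text \<open>\<open>v \<circ> \<sigma>\<close> is another extension of the valuation of
  \<open>K\<close>, hence equal to \<open>v\<close>. Henselianity enters the proof through this
  invariance.\<close>

lemma henselian_aut:
  assumes h: "henselian K v" and v: "valuation_on UNIV v" and \<sigma>: "\<sigma> \<in> aut_over K"
  shows "v (\<sigma> x) = v x"
proof -
  interpret field_aut \<sigma> using \<sigma> by (rule aut_over_field_aut)
  have "valuation_on UNIV (\<lambda>x. v (\<sigma> x))"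
    using v unfolding valuation_on_def by (simp add: add mult eq_0_iff)
  moreover have "\<forall>x\<in>K. v (\<sigma> x) = v x" using \<sigma> by (simp add: aut_over_fix)
  ultimately have "(\<lambda>x. v (\<sigma> x)) = v" using h v unfolding henselian_def by blast
  then show ?thesis by (rule fun_cong)
qed

text \<open>If no nonzero multiple of \<open>a\<close> were integral, every \<open>c / a\<close>
  with \<open>c \<in> K\<close> would lie in \<open>I\<close>, and the minimal equation of
  \<open>a\<close>, divided by \<open>a ^ n\<close>, would put \<open>- 1\<close> into
  \<open>I\<close>.\<close>

lemma (in alg_ext) integral_multiple:
  assumes "val_ring V I"
  shows "\<exists>c\<in>K. c \<noteq> 0 \<and> c * a \<in> V"
proof (rule ccontr)
  interpret val_ring V I by fact
  assume "\<not> ?thesis"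
  then have none: "c * a \<notin> V" if "c \<in> K" "c \<noteq> 0" for c using that by blast
  then have "a \<notin> V" using one by force
  then have a0: "a \<noteq> 0" using O.zero by auto
  have small: "c * inverse a \<in> I" if "c \<in> K" for c
  proof (cases "c = 0")
    case False
    then have "inverse (inverse c * a) \<in> I"
      using that inverse none by (intro inverse_in_I) auto
    then show ?thesis by (simp add: inverse_mult_distrib)
  qed (simp add: I_zero)
  have ia: "inverse a \<in> I" using small[OF one] by simp
  obtain f where f: "is_min_poly K a f" by (rule min_poly_exists)
  define n where "n = Polynomial.degree f"
  have fK: "poly.coeff f i \<in> K" for i using f by (auto simp: is_min_poly_def polys_over_def)
  have lc: "poly.coeff f n = 1" and root: "poly f a = 0" using f by (auto simp: is_min_poly_def n_def)
  have "0 = poly f a * inverse a ^ n" by (simp add: root)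
  also have "\<dots> = (\<Sum>i\<le>n. poly.coeff f i * inverse a ^ (n - i))"
    unfolding poly_altdef n_def[symmetric] sum_distrib_right
  proof (rule sum.cong[OF refl])
    fix i assume "i \<in> {..n}"
    then have "inverse a ^ n = inverse a ^ i * inverse a ^ (n - i)" by (simp flip: power_add)
    then show "poly.coeff f i * a ^ i * inverse a ^ n = poly.coeff f i * inverse a ^ (n - i)"
      using a0 by (simp add: field_simps)
  qed
  also have "\<dots> = 1 + (\<Sum>i<n. poly.coeff f i * inverse a ^ (n - i))"
    by (simp add: lessThan_Suc_atMost[symmetric] lc)
  finally have "- 1 = (\<Sum>i<n. poly.coeff f i * inverse a ^ (n - i))"
    by (rule minus_unique[OF sym])
  moreover have "\<dots> \<in> I"
  proof (rule I_sum)
    fix i assume "i \<in> {..<n}"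
    then obtain k where k: "n - i = Suc k" by (metis Suc_diff_Suc lessThan_iff)
    have "inverse a ^ k \<in> V" using ia I_sub by (intro O.power) auto
    from I_mult[OF this small[OF fK[of i]]] show "poly.coeff f i * inverse a ^ (n - i) \<in> I"
      by (simp add: k ac_simps)
  qed
  ultimately show False using one_notin_I I_uminus by (metis minus_minus)
qed

lemma (in alg_ext) integral_multiple_finite:
  assumes "val_ring V I" "finite A"
  shows "\<exists>c\<in>K. c \<noteq> 0 \<and> (\<forall>a\<in>A. c * a \<in> V)"
  using assms(2)
proof (induction A)
  case empty
  then show ?case using one by (intro bexI[of _ 1]) auto
next
  case (insert a A)
  interpret val_ring V I by fact
  from insert obtain c where c: "c \<in> K" "c \<noteq> 0" "\<forall>a\<in>A. c * a \<in> V" by blast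
  obtain d where d: "d \<in> K" "d \<noteq> 0" "d * a \<in> V" using integral_multiple[OF assms(1)] by blast
  \<comment> \<open>One of \<open>c\<close> and \<open>d\<close> is a multiple of the other by an
    element of \<open>V\<close>; that multiple works for \<open>a\<close> and for
    \<open>A\<close>.\<close>
  show ?case
  proof (cases "c / d \<in> V")
    case True
    then have "c / d * (d * a) \<in> V" using d(3) by (rule O.mult)
    with c d show ?thesis by (intro bexI[of _ c]) auto
  next
    case False
    then have "inverse (c / d) \<in> V" using inverse_in_I I_sub by blast
    moreover have "d * b = inverse (c / d) * (c * b)" for b using c(2) by simp
    ultimately have "d * b \<in> V" if "b \<in> A" for b using c(3) that O.mult by metis
    with d show ?thesis by (intro bexI[of _ d]) auto
  qed
qed

section \<open>Groups of automorphisms and their orbits\<close>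

definition aut_subgroup :: "'a::field set \<Rightarrow> ('a \<Rightarrow> 'a) set \<Rightarrow> bool" where
  "aut_subgroup K D \<longleftrightarrow> D \<subseteq> aut_over K \<and> (\<lambda>x. x) \<in> D \<and> (\<forall>\<sigma>\<in>D. \<forall>\<tau>\<in>D. \<sigma> \<circ> \<tau> \<in> D) \<and>
     (\<forall>\<sigma>\<in>D. inv_into UNIV \<sigma> \<in> D)"

definition orbit_of :: "('a \<Rightarrow> 'a) set \<Rightarrow> 'a \<Rightarrow> 'a set" where
  "orbit_of D x = (\<lambda>\<sigma>. \<sigma> x) ` D"

lemma orbit_of_self: "aut_subgroup K D \<Longrightarrow> x \<in> orbit_of D x"
  by (auto simp: aut_subgroup_def orbit_of_def)

lemma orbit_of_image:
  assumes D: "aut_subgroup K D" and \<sigma>: "\<sigma> \<in> D"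
  shows "\<sigma> ` orbit_of D x = orbit_of D x"
proof
  show "\<sigma> ` orbit_of D x \<subseteq> orbit_of D x"
  proof clarify
    fix y assume "y \<in> orbit_of D x"
    then obtain \<tau> where "\<tau> \<in> D" "y = \<tau> x" by (auto simp: orbit_of_def)
    then have "\<sigma> \<circ> \<tau> \<in> D" "\<sigma> y = (\<sigma> \<circ> \<tau>) x" using D \<sigma> by (auto simp: aut_subgroup_def)
    then show "\<sigma> y \<in> orbit_of D x" unfolding orbit_of_def by blast
  qed
  show "orbit_of D x \<subseteq> \<sigma> ` orbit_of D x"
  proof
    fix y assume "y \<in> orbit_of D x"
    then obtain \<tau> where "\<tau> \<in> D" "y = \<tau> x" by (auto simp: orbit_of_def)
    then have "inv_into UNIV \<sigma> \<circ> \<tau> \<in> D" using D \<sigma> by (auto simp: aut_subgroup_def)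
    then have "inv_into UNIV \<sigma> y \<in> orbit_of D x"
      using \<open>y = \<tau> x\<close> unfolding orbit_of_def by (intro image_eqI) auto
    moreover have "\<sigma> (inv_into UNIV \<sigma> y) = y"
      using D \<sigma> aut_over_inv_simps(2) unfolding aut_subgroup_def by blast
    ultimately show "y \<in> \<sigma> ` orbit_of D x" by force
  qed
qed

lemma orbit_of_eq:
  assumes D: "aut_subgroup K D" and y: "y \<in> orbit_of D x"
  shows "orbit_of D y = orbit_of D x"
proof -
  have sub: "orbit_of D b \<subseteq> orbit_of D a" if "b \<in> orbit_of D a" for a b
    using orbit_of_image[OF D] that unfolding orbit_of_def[of D b] by blast
  obtain \<sigma> where \<sigma>: "\<sigma> \<in> D" "y = \<sigma> x" using y by (auto simp: orbit_of_def)
  then have "x = inv_into UNIV \<sigma> y" "inv_into UNIV \<sigma> \<in> D"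
    using D aut_over_inv_simps(1) unfolding aut_subgroup_def by fastforce+
  then have "x \<in> orbit_of D y" by (auto simp: orbit_of_def)
  with sub y show ?thesis by blast
qed

text \<open>
  The mean \<open>c\<close> of an orbit of size prime to the characteristic is fixed, and the conjugates of
  \<open>x - c\<close> agree with \<open>x - c\<close> to first order although they sum to \<open>0\<close>; hence \<open>x = c\<close>.
\<close>

lemma (in val_ring) orbit_trivial:
  assumes p: "prime CHAR('a)" and D: "aut_subgroup K D" and "field_set L"
    and wild: "\<And>\<sigma> z. \<sigma> \<in> D \<Longrightarrow> z \<in> L \<Longrightarrow> z \<noteq> 0 \<Longrightarrow> (\<sigma> z - z) / z \<in> I"
    and fin: "finite (orbit_of D x)" and sub: "orbit_of D x \<subseteq> L"
    and card: "\<not> CHAR('a) dvd card (orbit_of D x)" and \<sigma>: "\<sigma> \<in> D"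
  shows "\<sigma> x = x"
proof -
  interpret L: field_set L by fact
  define S where "S = orbit_of D x"
  define m where "m = (of_nat (card S) :: 'a)"
  define c where "c = (\<Sum>s\<in>S. s) / m"
  have m: "m \<noteq> 0" using card by (simp add: m_def S_def of_nat_eq_0_iff_char_dvd)
  have xS: "x \<in> S" unfolding S_def using D by (rule orbit_of_self)
  have hom: "field_aut \<tau>" if "\<tau> \<in> D" for \<tau>
    using that D aut_over_field_aut by (auto simp: aut_subgroup_def)
  have c_fix: "\<tau> c = c" if "\<tau> \<in> D" for \<tau>
  proof -
    interpret field_aut \<tau> using that by (rule hom)
    have "\<tau> (\<Sum>s\<in>S. s) = (\<Sum>s\<in>\<tau> ` S. s)"
      by (subst sum.reindex) (auto simp: inj_on_def inject sum)
    then show ?thesis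
      using orbit_of_image[OF D that, of x] by (simp add: c_def divide m_def of_nat S_def)
  qed
  have "c \<in> L" unfolding c_def m_def using sub by (intro L.divide L.sum L.of_nat) (auto simp: S_def)
  define y where "y = x - c"
  have yL: "y \<in> L" unfolding y_def using \<open>c \<in> L\<close> xS sub by (auto simp: S_def intro: L.diff)
  have "y = 0"
  proof (rule ccontr)
    assume y0: "y \<noteq> 0"
    have "(s - c) / y - 1 \<in> I" if "s \<in> S" for s
    proof -
      from that obtain \<tau> where \<tau>: "\<tau> \<in> D" "s = \<tau> x" by (auto simp: S_def orbit_of_def)
      interpret field_aut \<tau> using \<tau>(1) by (rule hom)
      have "\<tau> y = s - c" unfolding y_def using \<tau> c_fix by (simp add: diff)
      with wild[OF \<tau>(1) yL y0] y0 show ?thesis by (simp add: diff_divide_distrib)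
    qed
    then have "(\<Sum>s\<in>S. (s - c) / y - 1) \<in> I" by (rule I_sum)
    also have "(\<Sum>s\<in>S. (s - c) / y - 1) = ((\<Sum>s\<in>S. s) - m * c) / y - m"
      by (simp add: sum_subtractf m_def flip: sum_divide_distrib)
    also have "\<dots> = - m" using m by (simp add: c_def)
    finally have "m \<in> I" using I_uminus by force
    with of_nat_notin_I[OF p card] show False by (simp add: m_def S_def)
  qed
  then show ?thesis using c_fix[OF \<sigma>] by (simp add: y_def)
qed

text \<open>The orbits partition \<open>S - {x}\<close>, whose size is prime to the characteristic.
  So some orbit has size prime to it, and \<open>orbit_trivial\<close> shrinks that orbit to a
  point. This is the counting argument for \<open>p\<close>-groups, with
  \<open>orbit_trivial\<close> in place of the group order.\<close>

lemma (in val_ring) second_fixed_point: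
  assumes p: "prime CHAR('a)" and D: "aut_subgroup K D" and "field_set L"
    and wild: "\<And>\<sigma> z. \<sigma> \<in> D \<Longrightarrow> z \<in> L \<Longrightarrow> z \<noteq> 0 \<Longrightarrow> (\<sigma> z - z) / z \<in> I"
    and S: "finite S" "S \<subseteq> L" "CHAR('a) dvd card S" and stable: "\<And>\<sigma> s. \<sigma> \<in> D \<Longrightarrow> s \<in> S \<Longrightarrow> \<sigma> s \<in> S"
    and x: "x \<in> S" "\<And>\<sigma>. \<sigma> \<in> D \<Longrightarrow> \<sigma> x = x"
  shows "\<exists>y\<in>S. y \<noteq> x \<and> (\<forall>\<sigma>\<in>D. \<sigma> y = y)"
proof -
  let ?C = "orbit_of D ` (S - {x})"
  have orb_x: "orbit_of D x = {x}" using x(2) orbit_of_self[OF D, of x] by (auto simp: orbit_of_def)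
  have orb: "orbit_of D y \<subseteq> S - {x}" if "y \<in> S - {x}" for y
  proof
    fix z assume z: "z \<in> orbit_of D y"
    then have "z \<in> S" using that stable by (auto simp: orbit_of_def)
    moreover have "z \<noteq> x"
    proof
      assume "z = x"
      then have "orbit_of D y = {x}" using orbit_of_eq[OF D z] orb_x by simp
      with orbit_of_self[OF D, of y] that show False by auto
    qed
    ultimately show "z \<in> S - {x}" by simp
  qed
  have un: "\<Union>?C = S - {x}" using orb orbit_of_self[OF D] by blast
  have "\<exists>y\<in>S - {x}. \<not> CHAR('a) dvd card (orbit_of D y)"
  proof (rule ccontr)
    assume "\<not> ?thesis"
    then have "CHAR('a) dvd card (\<Union>?C)"
    proof (intro dvd_partition)
      show "finite (\<Union>?C)" unfolding un using S(1) by simp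
      show "\<forall>c1\<in>?C. \<forall>c2\<in>?C. c1 \<noteq> c2 \<longrightarrow> c1 \<inter> c2 = {}"
        using orbit_of_eq[OF D] by blast
    qed auto
    then have "CHAR('a) dvd card S - 1" using S(1) x(1) by (simp add: un card_Diff_singleton)
    moreover have "card S \<noteq> 0" using S(1) x(1) by auto
    ultimately have "CHAR('a) dvd 1" using S(3)
      by (metis One_nat_def Suc_pred dvd_add_right_iff gr0I plus_1_eq_Suc add.commute)
    with p show False by auto
  qed
  then obtain y where y: "y \<in> S - {x}" "\<not> CHAR('a) dvd card (orbit_of D y)" by blast
  have "\<sigma> y = y" if "\<sigma> \<in> D" for \<sigma>
  proof (rule orbit_trivial[OF p D \<open>field_set L\<close>])
    show "finite (orbit_of D y)" "orbit_of D y \<subseteq> L"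
      using orb[OF y(1)] S(1,2) by (auto intro: finite_subset)
  qed (use wild y that in auto)
  with y(1) show ?thesis by blast
qed

section \<open>Additive polynomials\<close>

text \<open>\<open>additive_poly\<close> quantifies over fields given as records, so the binomial
  theorem is needed in that form. The two products in the induction step are reindexed to
  \<open>{..Suc n}\<close> and joined by Pascal's rule.\<close>

lemma (in cring) binomial_cring:
  assumes a: "a \<in> carrier R" and b: "b \<in> carrier R"
  shows "(a \<oplus> b) [^] n = (\<Oplus>i\<in>{..n}. [(n choose i)] \<cdot> (a [^] i \<otimes> b [^] (n - i)))"
proof (induction n)
  case 0
  show ?case using a b by simp
next
  case (Suc n)
  define f where "f k i = [k] \<cdot> (a [^] i \<otimes> b [^] (Suc n - i))" for k i :: nat
  have fc: "f k i \<in> carrier R" for k i using a b by (simp add: f_def)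
  let ?B = "\<Oplus>i\<in>{..n}. [(n choose i)] \<cdot> (a [^] i \<otimes> b [^] (n - i))"
  have closed: "(\<lambda>i. [(n choose i)] \<cdot> (a [^] i \<otimes> b [^] (n - i))) \<in> {..n} \<rightarrow> carrier R"
    using a b by auto
  have "?B \<otimes> a = (\<Oplus>i\<in>{..n}. f (n choose i) (Suc i))"
    unfolding finsum_ldistr[OF finite_atMost a closed]
    using a b by (intro finsum_cong') (auto simp: f_def add_pow_ldistr add_pow_rdistr m_ac)
  \<comment> \<open>The index shift leaves a gap at \<open>i = 0\<close>, filled by the coefficient
    0.\<close>
  also have "\<dots> = (\<Oplus>i\<in>{..Suc n}. f (if i = 0 then 0 else n choose (i - 1)) i)"
    by (subst finsum_Suc2) (auto simp: fc, simp add: f_def a b)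
  finally have Ba: "?B \<otimes> a = \<dots>" .
  have "?B \<otimes> b = (\<Oplus>i\<in>{..n}. f (n choose i) i)"
    unfolding finsum_ldistr[OF finite_atMost b closed]
    using a b by (intro finsum_cong') (auto simp: f_def add_pow_ldistr m_assoc Suc_diff_le)
  also have "\<dots> = (\<Oplus>i\<in>{..Suc n}. f (n choose i) i)"
    by (subst finsum_Suc) (auto simp: fc, simp add: f_def a b fc binomial_eq_0)
  finally have Bb: "?B \<otimes> b = \<dots>" .
  have "(a \<oplus> b) [^] Suc n = ?B \<otimes> a \<oplus> ?B \<otimes> b"
    using a b Suc.IH closed by (simp add: r_distr)
  also have "\<dots> = (\<Oplus>i\<in>{..Suc n}. f (if i = 0 then 0 else n choose (i - 1)) i \<oplus> f (n choose i) i)"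
    unfolding Ba Bb by (rule finsum_addf[symmetric]) (auto simp: fc)
  also have "\<dots> = (\<Oplus>i\<in>{..Suc n}. f (Suc n choose i) i)"
  proof (intro finsum_cong')
    fix i
    have "f k i \<oplus> f l i = f (k + l) i" for k l
      using a b by (simp add: f_def add.nat_pow_mult)
    then show "f (if i = 0 then 0 else n choose (i - 1)) i \<oplus> f (n choose i) i = f (Suc n choose i) i"
      by (cases i) auto
  qed (auto simp: fc)
  finally show ?case by (simp add: f_def)
qed

text \<open>Adding 1 to the product of all linear factors would give a nonconstant polynomial
  without a root.\<close>

lemma infinite_alg_closed_field: "infinite (UNIV :: 'a::alg_closed_field set)"
proof
  assume fin: "finite (UNIV :: 'a set)"
  define f where "f = (\<Prod>y\<in>(UNIV :: 'a set). [:- y, 1:]) + 1"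
  have "Polynomial.degree (\<Prod>y\<in>(UNIV :: 'a set). [:- y, 1:]) = card (UNIV :: 'a set)"
    by (subst degree_prod_eq_sum_degree) auto
  then have "Polynomial.degree f > 0"
    unfolding f_def using fin by (subst degree_add_eq_left) (auto simp: card_gt_0_iff)
  then obtain x where "poly f x = 0" using alg_closed_imp_poly_has_root by blast
  moreover have "(\<Prod>y\<in>UNIV. x - y) = 0" using fin by (intro prod_zero) auto
  ultimately show False by (simp add: f_def poly_prod)
qed

lemma alg_closed_poly_ext:
  fixes f g :: "'a::alg_closed_field poly"
  assumes "\<And>x. poly f x = poly g x"
  shows "f = g"
proof (rule ccontr)
  assume "f \<noteq> g"
  then have "finite {x. poly (f - g) x = 0}" by (intro poly_roots_finite) simp
  with assms infinite_alg_closed_field[where 'a = 'a] show False by simp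
qed

text \<open>In \<open>A(X + y) = A(X) + A(y)\<close>, the coefficient of \<open>X ^ i\<close> is a
  polynomial in \<open>y\<close> on the left and a constant on the right. The coefficient of
  \<open>y ^ (n - i)\<close> in the former is the product in question.\<close>

lemma additive_coeff:
  fixes A :: "'a::alg_closed_field poly"
  assumes additive: "\<And>x y. poly A (x + y) = poly A x + poly A y" and i: "0 < i" "i < n"
  shows "of_nat (n choose i) * poly.coeff A n = 0"
proof -
  let ?c = "poly.coeff A"
  have coeff_power: "poly.coeff ([:y, 1:] ^ k) i = of_nat (k choose i) * y ^ (k - i)" for y :: 'a and k
    by (cases "i \<le> k") (auto simp: coeff_linear_poly_power binomial_eq_0 coeff_eq_0 degree_linear_power)
  have eq: "(\<Sum>k\<le>Polynomial.degree A. ?c k * (of_nat (k choose i) * y ^ (k - i))) = ?c i" for y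
  proof -
    have "pcompose A [:y, 1:] = A + [:poly A y:]"
      by (rule alg_closed_poly_ext) (simp add: poly_pcompose additive add.commute)
    then have "poly.coeff (pcompose A [:y, 1:]) i = ?c i"
      using i by (simp add: coeff_pCons split: nat.split)
    then show ?thesis
      by (simp add: pcompose_altdef poly_altdef Polynomial.coeff_sum coeff_map_poly
          degree_map_poly coeff_power)
  qed
  define Q where
    "Q = (\<Sum>k\<le>Polynomial.degree A. Polynomial.monom (?c k * of_nat (k choose i)) (k - i))"
  have "Q = [:?c i:]"
    by (rule alg_closed_poly_ext) (simp add: Q_def poly_sum poly_monom mult.assoc eq)
  then have "poly.coeff Q (n - i) = 0" using i by (simp add: coeff_pCons split: nat.split)
  moreover have "poly.coeff Q (n - i) =
    (\<Sum>k\<le>Polynomial.degree A. if k = n then ?c n * of_nat (n choose i) else 0)"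
    unfolding Q_def Polynomial.coeff_sum
  proof (intro sum.cong[OF refl])
    fix k
    show "poly.coeff (Polynomial.monom (?c k * of_nat (k choose i)) (k - i)) (n - i) =
          (if k = n then ?c n * of_nat (n choose i) else 0)"
      \<comment> \<open>For \<open>k < i\<close> the truncated difference \<open>k - i\<close> is 0,
        which still differs from \<open>n - i\<close>.\<close>
      using i by (cases "k < i") auto
  qed
  ultimately show ?thesis
    by (cases "n \<le> Polynomial.degree A") (auto simp: coeff_eq_0 mult.commute)
qed

text \<open>Additivity on the algebraically closed type kills the mixed binomial coefficients
  already in \<open>K\<close>. The map \<open>h\<close> carries this to any extension field
  \<open>L\<close>, where the binomial theorem leaves only the two outer terms.\<close>

lemma (in alg_ext) additive_polyI:
  assumes A: "A \<in> polys_over K" and additive: "\<And>x y. poly A (x + y) = poly A x + poly A y"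
  shows "additive_poly K A"
  unfolding additive_poly_def
proof (intro conjI A allI impI ballI)
  fix L :: "'a ring" and h a b
  assume "field L \<and> h \<in> ring_hom (ring_on K) L"
  then interpret L: field L by simp
  have h: "h \<in> ring_hom (ring_on K) L" using \<open>field L \<and> _\<close> by simp
  assume a: "a \<in> carrier L" and b: "b \<in> carrier L"
  let ?c = "poly.coeff A"
  have cK: "?c n \<in> K" for n using A by (simp add: polys_over_def)
  have hc: "h x \<in> carrier L" if "x \<in> K" for x
    using h that by (auto simp: ring_hom_def)
  have hadd: "h (x + y) = h x \<oplus>\<^bsub>L\<^esub> h y" if "x \<in> K" "y \<in> K" for x y
    using h that by (auto simp: ring_hom_def ring_of_type_algebra_def)
  have h0: "h 0 = \<zero>\<^bsub>L\<^esub>"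
    using hadd[OF zero zero] hc[OF zero] by (simp add: L.add.l_cancel_one')
  have hnat: "h (of_nat k * x) = [k] \<cdot>\<^bsub>L\<^esub> h x" if "x \<in> K" for k :: nat and x
  proof (induction k)
    case (Suc k)
    have "h (of_nat (Suc k) * x) = h (of_nat k * x + x)" by (simp add: algebra_simps)
    also have "\<dots> = [k] \<cdot>\<^bsub>L\<^esub> h x \<oplus>\<^bsub>L\<^esub> h x"
      using Suc that by (simp add: hadd mult of_nat)
    finally show ?case by simp
  qed (simp add: h0)
  have "poly A 0 = poly A 0 + poly A 0" using additive[of 0 0] by (simp only: add_0_left)
  then have c0: "?c 0 = 0" by (metis add_cancel_right_right poly_0_coeff_0)
  have "h (?c n) \<otimes>\<^bsub>L\<^esub> (a \<oplus>\<^bsub>L\<^esub> b) [^]\<^bsub>L\<^esub> n =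
        h (?c n) \<otimes>\<^bsub>L\<^esub> a [^]\<^bsub>L\<^esub> n \<oplus>\<^bsub>L\<^esub> h (?c n) \<otimes>\<^bsub>L\<^esub> b [^]\<^bsub>L\<^esub> n" for n
  proof (cases "n = 0")
    case True
    then show ?thesis by (simp add: c0 h0)
  next
    case False
    define f where "f i = h (?c n) \<otimes>\<^bsub>L\<^esub> ([(n choose i)] \<cdot>\<^bsub>L\<^esub> (a [^]\<^bsub>L\<^esub> i \<otimes>\<^bsub>L\<^esub> b [^]\<^bsub>L\<^esub> (n - i)))" for i
    have fc: "f i \<in> carrier L" for i using a b hc[OF cK] by (simp add: f_def)
    have f0: "f i = \<zero>\<^bsub>L\<^esub>" if "i \<in> {..n} - {0, n}" for i
    proof -
      have "f i = ([(n choose i)] \<cdot>\<^bsub>L\<^esub> h (?c n)) \<otimes>\<^bsub>L\<^esub> (a [^]\<^bsub>L\<^esub> i \<otimes>\<^bsub>L\<^esub> b [^]\<^bsub>L\<^esub> (n - i))"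
        using a b hc[OF cK] by (simp add: f_def L.add_pow_ldistr L.add_pow_rdistr)
      also have "[(n choose i)] \<cdot>\<^bsub>L\<^esub> h (?c n) = \<zero>\<^bsub>L\<^esub>"
        using hnat[OF cK[of n], of "n choose i"] additive_coeff[OF additive, of i n] that
        by (auto simp: h0)
      finally show ?thesis using a b by simp
    qed
    have "h (?c n) \<otimes>\<^bsub>L\<^esub> (a \<oplus>\<^bsub>L\<^esub> b) [^]\<^bsub>L\<^esub> n = (\<Oplus>\<^bsub>L\<^esub>i\<in>{..n}. f i)"
      unfolding L.binomial_cring[OF a b] f_def
      using a b hc[OF cK] by (intro L.finsum_rdistr) auto
    also have "\<dots> = (\<Oplus>\<^bsub>L\<^esub>i\<in>{0, n}. f i)"
      using f0 fc by (intro L.add.finprod_mono_neutral_cong_right) auto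
    also have "\<dots> = f n \<oplus>\<^bsub>L\<^esub> f 0"
      using False fc by (simp add: L.a_comm)
    finally show ?thesis using a b hc[OF cK] by (simp add: f_def)
  qed
  then show "eval_in L h A (a \<oplus>\<^bsub>L\<^esub> b) = eval_in L h A a \<oplus>\<^bsub>L\<^esub> eval_in L h A b"
    unfolding eval_in_def using a b hc[OF cK]
    by (subst L.finsum_addf[symmetric]) (auto intro!: L.finsum_cong')
qed

lemma degree_linear_prod:
  "finite S \<Longrightarrow> Polynomial.degree (\<Prod>a\<in>S. [:- a, 1 :: 'a::idom:]) = card S"
  "finite S \<Longrightarrow> poly.coeff (\<Prod>a\<in>S. [:- a, 1 :: 'a::idom:]) (card S) = 1"
proof -
  assume "finite S"
  show deg: "Polynomial.degree (\<Prod>a\<in>S. [:- a, 1 :: 'a:]) = card S"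
    by (subst degree_prod_eq_sum_degree) auto
  show "poly.coeff (\<Prod>a\<in>S. [:- a, 1 :: 'a:]) (card S) = 1"
    unfolding deg[symmetric] by (simp add: lead_coeff_prod)
qed

text \<open>For fixed \<open>y\<close>, both sides are monic polynomials in \<open>x\<close> of
  degree \<open>card S\<close>, and they agree on \<open>S\<close> because translation by an element
  of \<open>S\<close> permutes the roots of \<open>A\<close>.\<close>

lemma additive_linear_prod:
  fixes S :: "'a::idom set"
  assumes S: "finite S" "0 \<in> S" "\<And>a b. a \<in> S \<Longrightarrow> b \<in> S \<Longrightarrow> a + b \<in> S" "\<And>a. a \<in> S \<Longrightarrow> - a \<in> S"
  defines "A \<equiv> \<Prod>a\<in>S. [:- a, 1:]"
  shows "poly A (x + y) = poly A x + poly A y"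
proof -
  have root: "poly A a = 0" if "a \<in> S" for a
    using that S(1) by (auto simp: A_def poly_prod)
  have shift: "poly A (a + y) = poly A y" if a: "a \<in> S" for a
  proof -
    have "poly A (a + y) = (\<Prod>b\<in>S. y - (b - a))"
      by (simp add: A_def poly_prod algebra_simps)
    also have "\<dots> = (\<Prod>b\<in>(\<lambda>b. b - a) ` S. y - b)"
      by (subst prod.reindex) (auto simp: inj_on_def)
    also have "(\<lambda>b. b - a) ` S = S"
    proof
      show "(\<lambda>b. b - a) ` S \<subseteq> S" using S(3)[OF _ S(4)[OF a]] by auto
      show "S \<subseteq> (\<lambda>b. b - a) ` S"
      proof
        fix b assume "b \<in> S"
        then show "b \<in> (\<lambda>b. b - a) ` S" using S(3)[OF _ a] by (intro image_eqI[of _ _ "b + a"]) auto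
      qed
    qed
    finally show ?thesis by (simp add: A_def poly_prod)
  qed
  have pos: "card S > 0" using S by (auto simp: card_gt_0_iff)
  have comp: "pcompose A [:y, 1:] = (\<Prod>a\<in>(\<lambda>a. a - y) ` S. [:- a, 1:])"
    by (subst prod.reindex) (auto simp: inj_on_def A_def pcompose_prod pcompose_pCons)
  have card: "card ((\<lambda>a. a - y) ` S) = card S" by (rule card_image) (auto simp: inj_on_def)
  have "pcompose A [:y, 1:] = A + [:poly A y:]"
  proof (rule poly_eqI_degree_lead_coeff[where n = "card S" and A = S])
    show "poly.coeff (pcompose A [:y, 1:]) (card S) = poly.coeff (A + [:poly A y:]) (card S)"
      using degree_linear_prod(2)[OF S(1)] degree_linear_prod(2)[of "(\<lambda>a. a - y) ` S"] S(1) pos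
      by (simp add: comp card) (auto simp: A_def coeff_pCons card_gt_0_iff split: nat.split)
    show "Polynomial.degree (pcompose A [:y, 1:]) \<le> card S"
      using degree_linear_prod(1)[of "(\<lambda>a. a - y) ` S"] S(1) by (simp add: comp card)
    show "Polynomial.degree (A + [:poly A y:]) \<le> card S"
      using degree_linear_prod(1)[OF S(1)] by (intro degree_add_le) (auto simp: A_def)
    show "poly (pcompose A [:y, 1:]) z = poly (A + [:poly A y:]) z" if "z \<in> S" for z
      using root[OF that] shift[OF that] by (simp add: poly_pcompose add.commute)
  qed simp
  then have "poly (pcompose A [:y, 1:]) x = poly A x + poly A y" by simp
  then show ?thesis by (simp add: poly_pcompose add.commute)
qed

section \<open>Automorphism groups and additive groups\<close>

lemma aut_subgroup_aut_over: "aut_subgroup K (aut_over K)"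
  by (auto simp: aut_subgroup_def aut_over_id aut_over_comp aut_over_inv)

lemma aut_subgroupD:
  assumes "aut_subgroup K D" "\<sigma> \<in> D"
  shows "\<sigma> \<in> aut_over K" "field_aut \<sigma>" "inv_into UNIV \<sigma> \<in> D"
    "inv_into UNIV \<sigma> (\<sigma> x) = x" "\<sigma> (inv_into UNIV \<sigma> x) = x" "\<tau> \<in> D \<Longrightarrow> \<sigma> \<circ> \<tau> \<in> D"
  using assms aut_over_inv_simps aut_over_field_aut unfolding aut_subgroup_def by blast+

lemma aut_subgroup_stabilizer:
  assumes D: "aut_subgroup K D"
  shows "aut_subgroup K {\<sigma> \<in> D. \<sigma> ` S = S}"
proof -
  have "inv_into UNIV \<sigma> ` S = S" if "\<sigma> \<in> D" "\<sigma> ` S = S" for \<sigma>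
    using aut_subgroupD(4)[OF D that(1)] that(2) by (metis (no_types, lifting) image_cong image_ident image_image)
  moreover have "(\<sigma> \<circ> \<tau>) ` S = S" if "\<sigma> ` S = S" "\<tau> ` S = S" for \<sigma> \<tau>
    using that by (metis image_comp)
  ultimately show ?thesis using D by (simp add: aut_subgroup_def subset_iff)
qed

lemma field_set_fixed:
  assumes D: "aut_subgroup K D" and L: "field_set L"
  shows "field_set {x \<in> L. \<forall>\<sigma>\<in>D. \<sigma> x = x}"
proof -
  interpret L: field_set L by fact
  have hom: "field_aut \<sigma>" if "\<sigma> \<in> D" for \<sigma> using aut_subgroupD(2)[OF D that] .
  have inv: "\<sigma> (inverse x) = inverse (\<sigma> x)" if "\<sigma> \<in> D" for \<sigma> x
    using field_aut.divide[OF hom[OF that], of 1 x] field_aut.one[OF hom[OF that]] by (simp add: divide_inverse)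
  show ?thesis
    by unfold_locales
      (auto simp: inv hom field_aut.zero field_aut.one field_aut.add field_aut.mult field_aut.uminus
        intro: L.zero L.one L.add L.mult L.uminus L.inverse)
qed

text \<open>An element of \<open>D\<close> permutes the orbit, hence the linear factors, and so
  fixes every coefficient.\<close>

lemma orbit_prod_fixed:
  assumes D: "aut_subgroup K D" and L: "field_set L"
    and fin: "finite (orbit_of D x)" and sub: "orbit_of D x \<subseteq> L"
  shows "(\<Prod>y\<in>orbit_of D x. [:- y, 1:]) \<in> polys_over {x \<in> L. \<forall>\<sigma>\<in>D. \<sigma> x = x}"
proof -
  interpret L: field_set L by fact
  define f where "f = (\<Prod>y\<in>orbit_of D x. [:- y, 1:])"
  have "f \<in> polys_over L"
    unfolding f_def using sub by (intro L.prod_polys L.linear_polys) auto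
  moreover have "\<sigma> (poly.coeff f i) = poly.coeff f i" if "\<sigma> \<in> D" for \<sigma> i
  proof -
    interpret field_aut \<sigma> using aut_subgroupD(2)[OF D that] .
    have "map_poly \<sigma> f = f"
      unfolding f_def map_linear_prod[OF fin] orbit_of_image[OF D that] ..
    then show ?thesis by (metis coeff_map)
  qed
  ultimately show ?thesis by (auto simp: polys_over_def f_def)
qed

lemma (in alg_ext) finite_orbit:
  assumes "D \<subseteq> aut_over K"
  shows "finite (orbit_of D x)"
proof -
  obtain f where f: "f \<in> polys_over K" "f \<noteq> 0" "poly f x = 0" using algebraic by blast
  have "orbit_of D x \<subseteq> {y. poly f y = 0}"
  proof (clarsimp simp: orbit_of_def)
    fix \<sigma> assume "\<sigma> \<in> D"
    with assms have \<sigma>: "\<sigma> \<in> aut_over K" by blast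
    then have "\<sigma> 0 = 0" by (intro field_aut.zero aut_over_field_aut)
    with aut_over_poly[OF \<sigma> f(1), of x] f(3) show "poly f (\<sigma> x) = 0" by simp
  qed
  then show ?thesis using poly_roots_finite[OF f(2)] by (rule finite_subset)
qed

text \<open>Newton interpolation: the correction at the new node is a multiple of the polynomial
  vanishing at the old ones. Bounding the coefficients instead of the degree covers the empty set of
  nodes.\<close>

lemma (in field_set) interpolation:
  assumes "finite S" "S \<subseteq> F" "\<And>s. s \<in> S \<Longrightarrow> b s \<in> F"
  shows "\<exists>f\<in>polys_over F. (\<forall>i\<ge>card S. poly.coeff f i = 0) \<and> (\<forall>s\<in>S. poly f s = b s)"
  using assms
proof (induction S)
  case empty
  show ?case using zero_polys by (intro bexI[of _ 0]) auto
next
  case (insert a S)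
  then obtain f where f: "f \<in> polys_over F" "\<forall>i\<ge>card S. poly.coeff f i = 0" "\<forall>s\<in>S. poly f s = b s"
    by auto
  define q where "q = (\<Prod>s\<in>S. [:- s, 1:])"
  have q: "q \<in> polys_over F" unfolding q_def using insert.prems by (intro prod_polys linear_polys) auto
  have deg: "Polynomial.degree q = card S" unfolding q_def using insert.hyps degree_linear_prod by blast
  have qs: "poly q s = 0" if "s \<in> S" for s using insert.hyps that by (auto simp: q_def poly_prod)
  have qa: "poly q a \<noteq> 0" using insert.hyps by (auto simp: q_def poly_prod)
  define c where "c = (b a - poly f a) / poly q a"
  have "c \<in> F" unfolding c_def using insert.prems f(1) q by (intro divide diff poly_mem) auto
  then have "f + Polynomial.smult c q \<in> polys_over F" using f(1) q by (intro add_polys smult_polys)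
  moreover have "poly (f + Polynomial.smult c q) s = b s" if "s \<in> insert a S" for s
    using that f(3) qs qa by (cases "s = a") (auto simp: c_def)
  moreover have "poly.coeff (f + Polynomial.smult c q) i = 0" if "i \<ge> card (insert a S)" for i
    using that f(2) insert.hyps deg by (simp add: coeff_eq_0)
  ultimately show ?case by blast
qed

section \<open>Finite additive groups and elements of least value\<close>

definition additive_group :: "'a::ab_group_add set \<Rightarrow> bool" where
  "additive_group P \<longleftrightarrow> 0 \<in> P \<and> (\<forall>x\<in>P. \<forall>y\<in>P. x - y \<in> P)"

definition additive_hull :: "'a::ab_group_add set \<Rightarrow> 'a set" where
  "additive_hull S = additive_group hull S"

lemma additive_hull_group: "additive_group (additive_hull S)"
  unfolding additive_hull_def by (rule hull_in) (auto simp: additive_group_def)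

lemma additive_hull_subset: "S \<subseteq> additive_hull S"
  unfolding additive_hull_def by (rule hull_subset)

lemma additive_hull_least: "S \<subseteq> P \<Longrightarrow> additive_group P \<Longrightarrow> additive_hull S \<subseteq> P"
  unfolding additive_hull_def by (rule hull_minimal)

text \<open>Every element is an integer combination of the generators, and the integers matter only
  modulo the characteristic.\<close>

lemma finite_additive_hull:
  fixes S :: "'a::field set"
  assumes p: "CHAR('a) > 0" and "finite S"
  shows "finite (additive_hull S)"
  using assms(2)
proof (induction S)
  case empty
  have "additive_hull {} \<subseteq> {0 :: 'a}"
    by (rule additive_hull_least) (auto simp: additive_group_def)
  then show ?case by (rule finite_subset) simp
next
  case (insert a S)
  define P where "P = (\<lambda>(k, t). of_int k * a + t) ` (UNIV \<times> additive_hull S)"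
  have "P \<subseteq> (\<lambda>(k, t). of_int k * a + t) ` ({0..<int CHAR('a)} \<times> additive_hull S)"
  proof (clarsimp simp: P_def)
    fix k t assume "t \<in> additive_hull S"
    moreover have "of_int k = (of_int (k mod int CHAR('a)) :: 'a)"
    proof -
      have "of_int (int CHAR('a) * (k div int CHAR('a)) + k mod int CHAR('a)) =
            (of_int (k mod int CHAR('a)) :: 'a)"
        by (simp only: of_int_add of_int_mult of_int_of_nat_eq of_nat_CHAR) simp
      then show ?thesis by (simp only: mult_div_mod_eq)
    qed
    moreover have "k mod int CHAR('a) \<in> {0..<int CHAR('a)}" using p by simp
    ultimately show "of_int k * a + t \<in> (\<lambda>(k, t). of_int k * a + t) ` ({0..<int CHAR('a)} \<times> additive_hull S)"
      by (intro image_eqI[of _ _ "(k mod int CHAR('a), t)"]) auto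
  qed
  then have "finite P" by (rule finite_subset) (use insert.IH in simp)
  note H = additive_hull_group[of S, unfolded additive_group_def]
  have "additive_hull (insert a S) \<subseteq> P"
  proof (rule additive_hull_least)
    have "a \<in> P" unfolding P_def using H by (intro image_eqI[of _ _ "(1, 0)"]) auto
    moreover have "S \<subseteq> P"
    proof
      fix s assume "s \<in> S"
      then show "s \<in> P" unfolding P_def using additive_hull_subset[of S]
        by (intro image_eqI[of _ _ "(0, s)"]) auto
    qed
    ultimately show "insert a S \<subseteq> P" by simp
    have "0 \<in> P" unfolding P_def using H by (intro image_eqI[of _ _ "(0, 0)"]) auto
    moreover have "x - y \<in> P" if xP: "x \<in> P" and yP: "y \<in> P" for x y
    proof -
      from xP obtain k t where x: "x = of_int k * a + t" "t \<in> additive_hull S" by (auto simp: P_def)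
      from yP obtain l u where y: "y = of_int l * a + u" "u \<in> additive_hull S" by (auto simp: P_def)
      have "t - u \<in> additive_hull S" using H x y by auto
      then show ?thesis
        unfolding P_def x y by (intro image_eqI[of _ _ "(k - l, t - u)"]) (auto simp: algebra_simps)
    qed
    ultimately show "additive_group P" by (auto simp: additive_group_def)
  qed
  then show ?case using \<open>finite P\<close> by (rule finite_subset)
qed

text \<open>\<open>a\<close> is an element of least value.\<close>

lemma (in val_ring) divisor_exists:
  assumes "finite S" "S \<noteq> {}" "0 \<notin> S"
  obtains a where "a \<in> S" "\<And>s. s \<in> S \<Longrightarrow> s / a \<in> V"
proof -
  have "\<exists>a\<in>S. \<forall>s\<in>S. s / a \<in> V"
    using assms
  proof (induction S rule: finite_ne_induct)
    case (singleton a)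
    then show ?case using O.one by simp
  next
    case (insert b S)
    then obtain a where a: "a \<in> S" "\<forall>s\<in>S. s / a \<in> V" by auto
    show ?case
    proof (cases "b / a \<in> V")
      case True
      with a show ?thesis by auto
    next
      case False
      then have "a / b \<in> V" using inverse_in_I[OF False] I_sub by auto
      moreover have "s / b = s / a * (a / b)" if "s \<in> S" for s using a insert.prems by auto
      ultimately have "s / b \<in> V" if "s \<in> S" for s using a(2) that O.mult by metis
      then show ?thesis using O.one insert.prems by (intro bexI[of _ b]) auto
    qed
  qed
  with that show ?thesis by blast
qed

section \<open>The action of the wild group\<close>

text \<open>For a normal extension \<open>L\<close> of \<open>K\<close>, this is the preimage of its
  ramification group among the automorphisms of the algebraic closure. The condition
  \<open>v (\<sigma> x - x) > v x\<close> is expressed by the maximal ideal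
  \<open>I\<close>.\<close>

definition wild_group :: "'a::field set \<Rightarrow> 'a set \<Rightarrow> 'a set \<Rightarrow> ('a \<Rightarrow> 'a) set" where
  "wild_group K L I = {\<sigma> \<in> aut_over K. \<forall>x\<in>L - {0}. (\<sigma> x - x) / x \<in> I}"

text \<open>\<open>B\<close> is the root set of a separable polynomial over \<open>K\<close>, so
  \<open>L\<close> below is a splitting field and a finite Galois extension.\<close>

locale split_extension = alg_ext K for K :: "'a::alg_closed_field set" +
  fixes B :: "'a set"
  assumes fin_B: "finite B" and B_poly: "(\<Prod>y\<in>B. [:- y, 1:]) \<in> polys_over K"
begin

abbreviation "G \<equiv> aut_over K"

definition "L = gen K B"

sublocale L: alg_ext L
  unfolding L_def by (rule alg_ext_gen)

lemma G_hom: "\<sigma> \<in> G \<Longrightarrow> field_aut \<sigma>"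
  by (rule aut_over_field_aut)

lemma K_L: "K \<subseteq> L" and B_L: "B \<subseteq> L"
  by (auto simp: L_def intro: gen_base)

lemma G_B: "\<sigma> \<in> G \<Longrightarrow> y \<in> B \<Longrightarrow> \<sigma> y \<in> B"
proof -
  assume \<sigma>: "\<sigma> \<in> G" and y: "y \<in> B"
  have "poly (\<Prod>y\<in>B. [:- y, 1:]) (\<sigma> y) = \<sigma> (poly (\<Prod>y\<in>B. [:- y, 1:]) y)"
    using aut_over_poly[OF \<sigma> B_poly] by simp
  also have "poly (\<Prod>y\<in>B. [:- y, 1:]) y = 0" using y fin_B by (auto simp: poly_prod)
  finally show "\<sigma> y \<in> B"
    using fin_B field_aut.zero[OF G_hom[OF \<sigma>]] by (auto simp: poly_prod)
qed

lemma G_L: "\<sigma> \<in> G \<Longrightarrow> x \<in> L \<Longrightarrow> \<sigma> x \<in> L"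
  unfolding L_def by (rule aut_over_gen) (use G_B gen_base[of _ K B] in auto)

text \<open>Galois descent over any field \<open>F\<close> containing \<open>K\<close>: the elements
  of \<open>B\<close> are split roots over \<open>F\<close> as well, and \<open>L\<close> lies in
  \<open>gen F B\<close>.\<close>

lemma fixed_in:
  assumes "alg_ext F" "K \<subseteq> F" "x \<in> L" "\<And>\<sigma>. \<sigma> \<in> aut_over F \<Longrightarrow> \<sigma> x = x"
  shows "x \<in> F"
proof -
  interpret F: alg_ext F by fact
  have "gen K B \<subseteq> gen F B"
    using assms(2) by (auto simp: gen_def)
  moreover have "split_root F y" if "y \<in> B" for y
    using that fin_B B_poly polys_over_mono[OF assms(2)] by (auto simp: split_root_def)
  ultimately show ?thesis
    using F.fixed_gen[of B x] assms(3,4) fin_B unfolding L_def by blast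
qed

lemma fixed_K: "x \<in> L \<Longrightarrow> (\<And>\<sigma>. \<sigma> \<in> G \<Longrightarrow> \<sigma> x = x) \<Longrightarrow> x \<in> K"
  by (rule fixed_in[OF alg_ext_axioms]) auto

lemma orbit_L: "x \<in> L \<Longrightarrow> orbit_of G x \<subseteq> L"
  using G_L by (auto simp: orbit_of_def)

text \<open>The coefficients are fixed by \<open>G\<close>, hence in \<open>K\<close>. A polynomial
  over \<open>K\<close> that vanishes at \<open>x\<close> vanishes on the whole orbit, which bounds
  its degree from below.\<close>

lemma min_poly_orbit:
  assumes x: "x \<in> L"
  shows "is_min_poly K x (\<Prod>u\<in>orbit_of G x. [:- u, 1:])"
proof -
  define f where "f = (\<Prod>u\<in>orbit_of G x. [:- u, 1:])"
  have fin: "finite (orbit_of G x)" by (rule finite_orbit) simp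
  have "f \<in> polys_over {x \<in> L. \<forall>\<sigma>\<in>G. \<sigma> x = x}"
    unfolding f_def
    by (rule orbit_prod_fixed[OF aut_subgroup_aut_over L.field_set_axioms fin orbit_L[OF x]])
  moreover have "{x \<in> L. \<forall>\<sigma>\<in>G. \<sigma> x = x} \<subseteq> K" using fixed_K by blast
  ultimately have "f \<in> polys_over K" using polys_over_mono by blast
  then have "is_min_poly K x f"
    unfolding is_min_poly_def
  proof (intro conjI ballI impI)
    show "lead_coeff f = 1" by (simp add: f_def lead_coeff_prod)
    show "poly f x = 0"
      using fin orbit_of_self[OF aut_subgroup_aut_over, of x K] by (auto simp: f_def poly_prod)
    fix g assume g: "g \<in> polys_over K" "g \<noteq> 0 \<and> poly g x = 0"
    have "orbit_of G x \<subseteq> {y. poly g y = 0}"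
    proof (clarsimp simp: orbit_of_def)
      fix \<sigma> assume \<sigma>: "\<sigma> \<in> G"
      show "poly g (\<sigma> x) = 0"
        using aut_over_poly[OF \<sigma> g(1), of x] g(2) field_aut.zero[OF G_hom[OF \<sigma>]] by simp
    qed
    then have "card (orbit_of G x) \<le> card {y. poly g y = 0}"
      using poly_roots_finite g(2) by (intro card_mono) auto
    also have "\<dots> \<le> Polynomial.degree g" using g(2) by (intro card_poly_roots_bound) auto
    finally show "Polynomial.degree f \<le> Polynomial.degree g"
      using degree_linear_prod(1)[OF fin] by (simp add: f_def)
  qed
  then show ?thesis by (simp add: f_def)
qed

end

text \<open>The separable case: \<open>E\<close> is the minimal extension and \<open>z\<close> one
  of its elements outside \<open>K\<close>. Henselianity appears as \<open>aut_I\<close>, and linear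
  disjointness as \<open>disjoint\<close>: passing to the fixed field of the wild group does not
  lower the degree \<open>card B\<close> of \<open>z\<close>.\<close>

locale wild_setting = split_extension K B + val: val_ring V I + E: alg_ext E
  for K V I E B :: "'a::alg_closed_field set" +
  fixes z :: 'a
  assumes prime_char: "prime CHAR('a)"
    and aut_I: "\<And>\<sigma> x. \<sigma> \<in> aut_over K \<Longrightarrow> x \<in> I \<Longrightarrow> \<sigma> x \<in> I"
    and z_B: "z \<in> B" and z_E: "z \<in> E" and z_K: "z \<notin> K" and K_E: "K \<subseteq> E"
    and minimal: "\<And>F. alg_ext F \<Longrightarrow> K \<subseteq> F \<Longrightarrow> F \<subseteq> E \<Longrightarrow> F = K \<or> F = E"
    and disjoint: "\<And>g. g \<noteq> 0 \<Longrightarrow> poly g z = 0 \<Longrightarrow>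
      g \<in> polys_over {x \<in> L. \<forall>\<sigma>\<in>wild_group K L I. \<sigma> x = x} \<Longrightarrow>
      card B \<le> Polynomial.degree g"
begin

section \<open>The wild group, its fixed field and its transitivity\<close>

definition "N = wild_group K L I"

definition "R = {x \<in> L. \<forall>\<sigma>\<in>N. \<sigma> x = x}"

definition "W = {w \<in> L. \<forall>\<sigma>\<in>N. \<sigma> w - w \<in> R}"

text \<open>Automorphisms over \<open>E\<close> fix \<open>z\<close>, so invariance under the
  stabilizer of \<open>z\<close> is enough to descend to \<open>E\<close>.\<close>

lemma fixed_E:
  assumes "x \<in> L" "\<And>\<sigma>. \<sigma> \<in> G \<Longrightarrow> \<sigma> z = z \<Longrightarrow> \<sigma> x = x"
  shows "x \<in> E"
proof (rule fixed_in[OF E.alg_ext_axioms K_E assms(1)])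
  fix \<sigma> assume \<sigma>: "\<sigma> \<in> aut_over E"
  then have "\<sigma> \<in> G" "\<sigma> z = z" using aut_over_mono[OF K_E] z_E by (auto simp: aut_over_fix)
  then show "\<sigma> x = x" by (rule assms(2))
qed

lemma N_I: "\<sigma> \<in> N \<Longrightarrow> x \<in> L \<Longrightarrow> x \<noteq> 0 \<Longrightarrow> (\<sigma> x - x) / x \<in> I"
  by (auto simp: N_def wild_group_def)

lemma N_G: "\<sigma> \<in> N \<Longrightarrow> \<sigma> \<in> G"
  by (auto simp: N_def wild_group_def)

text \<open>\<open>\<sigma> x / x\<close> lies in \<open>1 + I\<close>, which consists of units of
  \<open>V\<close>.\<close>

lemma unit_ratio:
  assumes "\<sigma> \<in> N" "x \<in> L" "x \<noteq> 0"
  shows "\<sigma> x / x \<in> V" "x / \<sigma> x \<in> V"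
proof -
  have i: "\<sigma> x / x - 1 \<in> I" using N_I[OF assms] assms(3) by (simp add: diff_divide_distrib)
  then have "1 + (\<sigma> x / x - 1) \<in> V" using val.I_sub val.O.one by (intro val.O.add) auto
  then show "\<sigma> x / x \<in> V" by simp
  show "x / \<sigma> x \<in> V"
  proof (rule ccontr)
    assume "x / \<sigma> x \<notin> V"
    then have "\<sigma> x / x \<in> I" using val.inverse_in_I by fastforce
    from val.I_diff[OF this i] val.one_notin_I show False by simp
  qed
qed

lemma N_group: "aut_subgroup K N"
  unfolding aut_subgroup_def
proof (intro conjI ballI)
  show "N \<subseteq> G" using N_G by blast
  show "(\<lambda>x. x) \<in> N" by (auto simp: N_def wild_group_def aut_over_id val.I_zero)
  fix \<sigma> assume \<sigma>: "\<sigma> \<in> N"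
  then interpret \<sigma>: field_aut \<sigma> by (intro G_hom N_G)
  note inv = aut_over_inv_simps[OF N_G[OF \<sigma>]]
  show "inv_into UNIV \<sigma> \<in> N"
    unfolding N_def wild_group_def
  proof (intro CollectI conjI ballI)
    show "inv_into UNIV \<sigma> \<in> G" using N_G[OF \<sigma>] by (rule aut_over_inv)
    fix x assume x: "x \<in> L - {0}"
    define y where "y = inv_into UNIV \<sigma> x"
    have y: "\<sigma> y = x" "y \<in> L" "y \<noteq> 0"
      using x inv(2)[of x] \<sigma>.zero G_L[OF aut_over_inv[OF N_G[OF \<sigma>]]] by (auto simp: y_def)
    \<comment> \<open>With \<open>x = \<sigma> y\<close>, the relative change of \<open>x\<close>
      under the inverse is that of \<open>y\<close> under \<open>\<sigma>\<close>, up to sign and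
      the unit \<open>y / \<sigma> y\<close>.\<close>
    have "- (y / \<sigma> y * ((\<sigma> y - y) / y)) \<in> I"
      using unit_ratio(2)[OF \<sigma> y(2,3)] N_I[OF \<sigma> y(2,3)] by (intro val.I_uminus val.I_mult)
    also have "- (y / \<sigma> y * ((\<sigma> y - y) / y)) = (y - x) / x"
      using x y by (simp add: field_simps)
    finally show "(inv_into UNIV \<sigma> x - x) / x \<in> I" by (simp add: y_def)
  qed
  fix \<tau> assume \<tau>: "\<tau> \<in> N"
  then interpret \<tau>: field_aut \<tau> by (intro G_hom N_G)
  show "\<sigma> \<circ> \<tau> \<in> N"
    unfolding N_def wild_group_def
  proof (intro CollectI conjI ballI)
    show "\<sigma> \<circ> \<tau> \<in> G" using \<sigma> \<tau> by (intro aut_over_comp N_G)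
    fix x assume x: "x \<in> L - {0}"
    then have t: "\<tau> x \<in> L" "\<tau> x \<noteq> 0" using G_L[OF N_G[OF \<tau>]] by (auto simp: \<tau>.eq_0_iff)
    \<comment> \<open>The relative change under a composition is the sum of the two relative
      changes, the first scaled by the unit \<open>\<tau> x / x\<close>.\<close>
    have "\<tau> x / x * ((\<sigma> (\<tau> x) - \<tau> x) / \<tau> x) + (\<tau> x - x) / x \<in> I"
      using x t unit_ratio(1)[OF \<tau>] N_I[OF \<sigma> t] N_I[OF \<tau>] by (intro val.I_add val.I_mult) auto
    also have "\<tau> x / x * ((\<sigma> (\<tau> x) - \<tau> x) / \<tau> x) + (\<tau> x - x) / x = ((\<sigma> \<circ> \<tau>) x - x) / x"
      using t by (simp add: add_divide_distrib[symmetric])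
    finally show "((\<sigma> \<circ> \<tau>) x - x) / x \<in> I" .
  qed
qed

text \<open>The quotient of the conjugate at \<open>x\<close> is the image of the quotient of
  \<open>\<sigma>\<close> at \<open>\<tau> x\<close> under the inverse of \<open>\<tau>\<close>, and
  \<open>I\<close> is invariant under automorphisms over \<open>K\<close>.\<close>

lemma N_normal:
  assumes \<tau>: "\<tau> \<in> G" and \<sigma>: "\<sigma> \<in> N"
  shows "inv_into UNIV \<tau> \<circ> \<sigma> \<circ> \<tau> \<in> N"
  unfolding N_def wild_group_def
proof (intro CollectI conjI ballI)
  note inv = aut_over_inv[OF \<tau>]
  show "inv_into UNIV \<tau> \<circ> \<sigma> \<circ> \<tau> \<in> G" using inv \<tau> N_G[OF \<sigma>] by (intro aut_over_comp)
  interpret \<tau>: field_aut \<tau> using \<tau> by (rule G_hom)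
  interpret i: field_aut "inv_into UNIV \<tau>" using inv by (rule G_hom)
  fix x assume "x \<in> L - {0}"
  then have "\<tau> x \<in> L" "\<tau> x \<noteq> 0" using G_L[OF \<tau>] by (auto simp: \<tau>.eq_0_iff)
  then have "inv_into UNIV \<tau> ((\<sigma> (\<tau> x) - \<tau> x) / \<tau> x) \<in> I" by (intro aut_I[OF inv] N_I[OF \<sigma>])
  then show "((inv_into UNIV \<tau> \<circ> \<sigma> \<circ> \<tau>) x - x) / x \<in> I"
    by (simp add: i.divide i.diff aut_over_inv_simps[OF \<tau>])
qed

lemma N_conj:
  assumes "\<tau> \<in> G" "\<sigma> \<in> N"
  shows "\<exists>\<sigma>'\<in>N. \<forall>x. \<sigma> (\<tau> x) = \<tau> (\<sigma>' x)"
  using N_normal[OF assms] aut_over_inv_simps[OF assms(1)]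
  by (intro bexI[of _ "inv_into UNIV \<tau> \<circ> \<sigma> \<circ> \<tau>"]) simp_all

sublocale R: field_set R
  unfolding R_def by (rule field_set_fixed[OF N_group L.field_set_axioms])

lemma K_R: "K \<subseteq> R"
  using K_L N_G aut_over_fix unfolding R_def by blast

lemma R_L: "R \<subseteq> L"
  by (auto simp: R_def)

lemma R_fixed: "\<sigma> \<in> N \<Longrightarrow> x \<in> R \<Longrightarrow> \<sigma> x = x"
  by (auto simp: R_def)

lemma G_R:
  assumes \<tau>: "\<tau> \<in> G" and x: "x \<in> R"
  shows "\<tau> x \<in> R"
proof -
  have "\<sigma> (\<tau> x) = \<tau> x" if "\<sigma> \<in> N" for \<sigma>
    using N_conj[OF \<tau> that] R_fixed[OF _ x] by metis
  then show ?thesis using G_L[OF \<tau>] x by (auto simp: R_def)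
qed

lemma disjoint_R: "g \<in> polys_over R \<Longrightarrow> g \<noteq> 0 \<Longrightarrow> poly g z = 0 \<Longrightarrow> card B \<le> Polynomial.degree g"
  using disjoint by (auto simp: R_def N_def)

lemma card_B: "card B \<ge> 2"
proof -
  have "card B \<noteq> 1"
  proof
    assume "card B = 1"
    then have "B = {z}" using z_B by (auto simp: card_1_singleton_iff)
    then have "\<forall>i. poly.coeff [:- z, 1:] i \<in> K" using B_poly unfolding polys_over_def by simp
    then have "poly.coeff [:- z, 1:] 0 \<in> K" by (rule spec)
    then have "z \<in> K" using uminus[of "- z"] by simp
    with z_K show False by simp
  qed
  moreover have "card B \<noteq> 0" using fin_B z_B by auto
  ultimately show ?thesis by simp
qed

lemma orbit_sub_B: "D \<subseteq> G \<Longrightarrow> orbit_of D z \<subseteq> B"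
  using G_B z_B by (auto simp: orbit_of_def)

text \<open>The orbit polynomial of \<open>z\<close> has its coefficients in the fixed field of
  \<open>D\<close>, hence in \<open>R\<close>, so \<open>disjoint_R\<close> bounds its degree from
  below by \<open>card B\<close>. This serves for \<open>N\<close> and for the group
  \<open>J\<close> in \<open>D_trivial\<close>.\<close>

lemma orbit_eq_B:
  assumes D: "aut_subgroup K D" and R: "{x \<in> L. \<forall>\<sigma>\<in>D. \<sigma> x = x} \<subseteq> R"
  shows "orbit_of D z = B"
proof -
  let ?f = "\<Prod>y\<in>orbit_of D z. [:- y, 1:]"
  have sub: "orbit_of D z \<subseteq> B" using D by (intro orbit_sub_B) (auto simp: aut_subgroup_def)
  have fin: "finite (orbit_of D z)" using sub fin_B by (rule finite_subset)
  have "?f \<in> polys_over R"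
    using orbit_prod_fixed[OF D L.field_set_axioms fin] sub B_L polys_over_mono[OF R] by blast
  moreover have "poly ?f z = 0" using orbit_of_self[OF D, of z] fin by (auto simp: poly_prod)
  moreover have "?f \<noteq> 0" using fin by simp
  ultimately have "card B \<le> card (orbit_of D z)"
    using disjoint_R degree_linear_prod(1)[OF fin] by metis
  then show ?thesis using sub fin_B by (intro card_seteq)
qed

lemma orbit_N: "orbit_of N z = B"
  by (rule orbit_eq_B[OF N_group]) (simp add: R_def)

lemma N_transitive:
  assumes "y \<in> B"
  shows "\<exists>\<sigma>\<in>N. \<sigma> z = y"
proof -
  have "y \<in> orbit_of N z" using assms by (simp only: orbit_N)
  then show ?thesis by (auto simp: orbit_of_def)
qed

text \<open>Otherwise \<open>orbit_trivial\<close> would make \<open>N\<close> fix \<open>z\<close>,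
  although \<open>N\<close> is transitive on \<open>B\<close>.\<close>

lemma char_dvd_card_B: "CHAR('a) dvd card B"
proof (rule ccontr)
  assume ndvd: "\<not> CHAR('a) dvd card B"
  have "\<sigma> z = z" if "\<sigma> \<in> N" for \<sigma>
    by (rule val.orbit_trivial[OF prime_char N_group L.field_set_axioms])
      (use N_I that orbit_N fin_B B_L ndvd in simp_all)
  then have "B \<subseteq> {z}" using N_transitive by auto
  then have "card B \<le> 1" using card_mono[of "{z}" B] by simp
  with card_B show False by simp
qed

definition "D = {\<sigma> \<in> N. \<sigma> z = z}"

text \<open>
  The stabilizer \<open>D\<close> of \<open>z\<close> in \<open>N\<close> fixes a second conjugate of \<open>z\<close> (as a \<open>p\<close>-group, it is properly
  contained in its normalizer). So the stabilizer \<open>J\<close> of the set of all conjugates fixed by \<open>D\<close> is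
  larger than the stabilizer of \<open>z\<close>, and the minimality of \<open>E\<close> makes \<open>J\<close> transitive.
\<close>

lemma D_trivial:
  assumes "\<sigma> \<in> D" "x \<in> L"
  shows "\<sigma> x = x"
proof -
  have D_N: "D \<subseteq> N" by (auto simp: D_def)
  have D_group: "aut_subgroup K D"
    using aut_subgroupD(1,3,4,6)[OF N_group] N_group unfolding aut_subgroup_def D_def
    by (auto, metis)
  define F where "F = {y \<in> B. \<forall>\<sigma>\<in>D. \<sigma> y = y}"
  have fin_F: "finite F" using fin_B by (simp add: F_def)
  have z_F: "z \<in> F" using z_B by (auto simp: F_def D_def)
  have "\<exists>y\<in>B. y \<noteq> z \<and> (\<forall>\<sigma>\<in>D. \<sigma> y = y)"
    by (rule val.second_fixed_point[OF prime_char D_group L.field_set_axioms _ fin_B B_L char_dvd_card_B])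
      (use N_I G_B N_G z_B in \<open>auto simp: D_def\<close>)
  then obtain y where y: "y \<in> F" "y \<noteq> z" by (auto simp: F_def)
  then obtain n where n: "n \<in> N" "n z = y" using N_transitive by (auto simp: F_def)
  define J where "J = {\<tau> \<in> G. \<tau> ` F = F}"
  have J_group: "aut_subgroup K J"
    unfolding J_def using aut_subgroup_aut_over by (rule aut_subgroup_stabilizer)
  \<comment> \<open>By normality, conjugating an element of \<open>D\<close> by
    \<open>\<tau>\<close> gives an element of \<open>N\<close>; if the result fixes
    \<open>z\<close>, it lies in \<open>D\<close>. So \<open>\<tau>\<close> maps fixed points of
    \<open>D\<close> to fixed points.\<close>
  have JI: "\<tau> \<in> J"
    if \<tau>: "\<tau> \<in> G" and conj: "\<And>\<sigma> \<sigma>'. \<sigma> \<in> D \<Longrightarrow> \<sigma>' \<in> N \<Longrightarrow> (\<And>x. \<sigma> (\<tau> x) = \<tau> (\<sigma>' x)) \<Longrightarrow> \<sigma>' z = z" for \<tau>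
  proof -
    have "\<tau> ` F \<subseteq> F"
    proof
      fix w assume "w \<in> \<tau> ` F"
      then obtain u where u: "u \<in> F" "w = \<tau> u" by blast
      have "\<sigma> w = w" if "\<sigma> \<in> D" for \<sigma>
      proof -
        from N_conj[OF \<tau> subsetD[OF D_N that]] obtain \<sigma>'
          where \<sigma>': "\<sigma>' \<in> N" "\<And>x. \<sigma> (\<tau> x) = \<tau> (\<sigma>' x)" by blast
        then have "\<sigma>' \<in> D" using conj[OF that] by (simp add: D_def)
        with \<sigma>' u show ?thesis by (auto simp: F_def)
      qed
      then show "w \<in> F" using u G_B[OF \<tau>] by (auto simp: F_def)
    qed
    moreover have "inj_on \<tau> F" using aut_over_inj[OF \<tau>] by (auto simp: inj_on_def)
    ultimately have "\<tau> ` F = F" using fin_F by (intro endo_inj_surj)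
    with \<tau> show ?thesis by (simp add: J_def)
  qed
  have stab_J: "\<tau> \<in> J" if "\<tau> \<in> G" "\<tau> z = z" for \<tau>
  proof (rule JI[OF that(1)])
    fix \<sigma> \<sigma>' assume "\<sigma> \<in> D" "\<sigma>' \<in> N" and eq: "\<And>x. \<sigma> (\<tau> x) = \<tau> (\<sigma>' x)"
    then have "\<tau> (\<sigma>' z) = \<tau> z" using that(2) eq[of z] by (simp add: D_def)
    then show "\<sigma>' z = z" using aut_over_inj[OF that(1)] by simp
  qed
  \<comment> \<open>\<open>n\<close> maps \<open>z\<close> to another point fixed by
    \<open>D\<close>, so conjugating \<open>D\<close> by \<open>n\<close> gives elements fixing
    \<open>z\<close>.\<close>
  have n_J: "n \<in> J"
  proof (rule JI[OF N_G[OF n(1)]])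
    fix \<sigma> \<sigma>' assume "\<sigma> \<in> D" "\<sigma>' \<in> N" and eq: "\<And>x. \<sigma> (n x) = n (\<sigma>' x)"
    then have "n (\<sigma>' z) = n z" using n(2) y(1) eq[of z] by (auto simp: F_def)
    then show "\<sigma>' z = z" using aut_over_inj[OF N_G[OF n(1)]] by simp
  qed
  have J_G: "J \<subseteq> G" by (auto simp: J_def)
  \<comment> \<open>The elements of \<open>E\<close> fixed by \<open>J\<close> form an intermediate
    field without \<open>z\<close>, as \<open>n\<close> moves \<open>z\<close>; by minimality it is
    \<open>K\<close>. Elements of \<open>L\<close> fixed by \<open>J\<close> lie in
    \<open>E\<close>, because \<open>J\<close> contains the stabilizer of \<open>z\<close>.\<close>
  have fixed_J: "{x \<in> L. \<forall>\<sigma>\<in>J. \<sigma> x = x} \<subseteq> K"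
  proof -
    let ?F = "{x \<in> E. \<forall>\<sigma>\<in>J. \<sigma> x = x}"
    interpret F: field_set ?F by (rule field_set_fixed[OF J_group E.field_set_axioms])
    have KF: "K \<subseteq> ?F" using K_E J_G by (auto simp: aut_over_fix)
    then have "alg_ext ?F" by (rule alg_ext_of_subring) (fact F.add, fact F.mult)
    then have "?F = K \<or> ?F = E" using KF by (intro minimal) auto
    moreover have "z \<notin> ?F" using n_J n(2) y(2) by auto
    ultimately have "?F = K" using z_E by auto
    moreover have "{x \<in> L. \<forall>\<sigma>\<in>J. \<sigma> x = x} \<subseteq> ?F" using fixed_E stab_J by blast
    ultimately show ?thesis by simp
  qed
  \<comment> \<open>\<open>J\<close> is transitive on \<open>B\<close> and preserves
    \<open>F\<close>, so \<open>D\<close> fixes all of \<open>B\<close>.\<close>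
  have "B \<subseteq> F"
  proof
    fix w assume "w \<in> B"
    then have "w \<in> orbit_of J z" using orbit_eq_B[OF J_group] fixed_J K_R by blast
    then show "w \<in> F" using z_F by (auto simp: orbit_of_def J_def)
  qed
  then have "\<sigma> y = y" if "y \<in> B" for y using that assms(1) by (auto simp: F_def)
  then show ?thesis
    using aut_over_gen_fix[of \<sigma> K B x] assms D_N N_G unfolding L_def by blast
qed

lemma W_L: "W \<subseteq> L"
  by (auto simp: W_def)

text \<open>
  A finite \<open>N\<close>-stable group \<open>P\<close> strictly contains the group generated by all \<open>\<sigma> y - y\<close>: the latter
  misses the elements of \<open>P\<close> of least value.
\<close>

lemma W_not_in_R: "\<exists>w\<in>W. w \<notin> R"
proof -
  define Q where "Q P \<longleftrightarrow> finite P \<and> additive_group P \<and> P \<subseteq> L \<and> (\<forall>\<sigma>\<in>N. \<forall>y\<in>P. \<sigma> y \<in> P) \<and> \<not> P \<subseteq> R" for P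
  have stable: "\<tau> y \<in> additive_hull S"
    if \<tau>: "\<tau> \<in> N" and S: "\<And>s. s \<in> S \<Longrightarrow> \<tau> s \<in> S" and y: "y \<in> additive_hull S" for \<tau> S y
  proof -
    interpret \<tau>: field_aut \<tau> using \<tau> by (intro G_hom N_G)
    have "additive_hull S \<subseteq> {x. \<tau> x \<in> additive_hull S}"
    proof (rule additive_hull_least)
      show "S \<subseteq> {x. \<tau> x \<in> additive_hull S}" using S additive_hull_subset by blast
      show "additive_group {x. \<tau> x \<in> additive_hull S}"
        using additive_hull_group[of S] by (auto simp: additive_group_def \<tau>.zero \<tau>.diff)
    qed
    with y show ?thesis by blast
  qed
  have L_group: "additive_group L" by (auto simp: additive_group_def L.zero L.diff)
  have "Q (additive_hull B)"
    unfolding Q_def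
  proof (intro conjI ballI)
    show "finite (additive_hull B)"
      using prime_char fin_B by (intro finite_additive_hull) (auto simp: prime_gt_0_nat)
    show "additive_hull B \<subseteq> L" using B_L L_group by (rule additive_hull_least)
    have "z \<notin> R"
    proof
      assume "z \<in> R"
      then have "B \<subseteq> {z}" using N_transitive R_fixed by fastforce
      then have "card B \<le> 1" using card_mono[of "{z}" B] by simp
      with card_B show False by simp
    qed
    then show "\<not> additive_hull B \<subseteq> R" using additive_hull_subset z_B by blast
  qed (auto intro: additive_hull_group stable G_B N_G)
  \<comment> \<open>A candidate of least size: the smaller group \<open>P'\<close> below can fail to
    be a candidate only by lying in \<open>R\<close>, and that says
    \<open>P \<subseteq> W\<close>.\<close>
  then obtain P where P: "Q P" and least: "\<And>P'. Q P' \<Longrightarrow> card P \<le> card P'"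
    using ex_has_least_nat[of Q "additive_hull B" card] by blast
  define S where "S = {\<sigma> y - y | \<sigma> y. \<sigma> \<in> N \<and> y \<in> P}"
  define P' where "P' = additive_hull S"
  have P_group: "additive_group P" and P_L: "P \<subseteq> L" and fin_P: "finite P"
    and P_stable: "\<And>\<sigma> y. \<sigma> \<in> N \<Longrightarrow> y \<in> P \<Longrightarrow> \<sigma> y \<in> P" and P_R: "\<not> P \<subseteq> R"
    using P by (auto simp: Q_def)
  have "S \<subseteq> P" using P_stable P_group by (auto simp: S_def additive_group_def)
  then have P'_P: "P' \<subseteq> P" unfolding P'_def using P_group by (rule additive_hull_least)
  have S_stable: "\<tau> s \<in> S" if \<tau>: "\<tau> \<in> N" and s: "s \<in> S" for \<tau> s
  proof -
    interpret \<tau>: field_aut \<tau> using \<tau> by (intro G_hom N_G)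
    from s obtain \<sigma> y where s': "s = \<sigma> y - y" "\<sigma> \<in> N" "y \<in> P" by (auto simp: S_def)
    \<comment> \<open>\<open>\<tau>\<close> sends the difference of \<open>\<sigma>\<close> at
      \<open>y\<close> to the difference of the conjugate \<open>\<rho>\<close> at
      \<open>\<tau> y\<close>, so \<open>N\<close> preserves \<open>S\<close>.\<close>
    define \<rho> where "\<rho> = \<tau> \<circ> \<sigma> \<circ> inv_into UNIV \<tau>"
    have "\<rho> \<in> N" unfolding \<rho>_def using \<tau> s'(2) by (intro aut_subgroupD[OF N_group])
    moreover have "\<tau> s = \<rho> (\<tau> y) - \<tau> y"
      using aut_subgroupD(4)[OF N_group \<tau>] by (simp add: \<rho>_def s'(1) \<tau>.diff)
    ultimately show ?thesis using P_stable[OF \<tau> s'(3)] unfolding S_def by blast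
  qed
  have "P - {0} \<noteq> {}" using P_R R.zero by auto
  then obtain y0 where y0: "y0 \<in> P - {0}" and min: "\<And>y. y \<in> P - {0} \<Longrightarrow> y / y0 \<in> V"
    using val.divisor_exists[of "P - {0}"] fin_P by blast
  have "P' \<subseteq> {x. x / y0 \<in> I}"
    unfolding P'_def
  proof (rule additive_hull_least)
    show "additive_group {x. x / y0 \<in> I}"
      by (auto simp: additive_group_def val.I_zero diff_divide_distrib val.I_diff)
    show "S \<subseteq> {x. x / y0 \<in> I}"
    proof
      fix s assume "s \<in> S"
      then obtain \<sigma> y where s: "s = \<sigma> y - y" "\<sigma> \<in> N" "y \<in> P" by (auto simp: S_def)
      show "s \<in> {x. x / y0 \<in> I}"
      proof (cases "y = 0")
        case True
        then show ?thesis using s field_aut.zero[OF G_hom[OF N_G[OF s(2)]]] by (simp add: val.I_zero)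
      next
        case False
        then have "y / y0 * ((\<sigma> y - y) / y) \<in> I"
          using s P_L min by (intro val.I_mult N_I) auto
        then show ?thesis using False by (simp add: s)
      qed
    qed
  qed
  moreover have "y0 / y0 \<notin> I" using y0 val.one_notin_I by simp
  ultimately have "P' \<noteq> P" using y0 by blast
  then have "card P' < card P" using P'_P fin_P by (intro psubset_card_mono) auto
  then have "\<not> Q P'" using least[of P'] by auto
  moreover have "finite P'" using P'_P fin_P by (rule finite_subset)
  moreover have "\<tau> y \<in> P'" if "\<tau> \<in> N" "y \<in> P'" for \<tau> y
    using that stable[of \<tau> S y] S_stable unfolding P'_def by blast
  ultimately have "P' \<subseteq> R"
    using additive_hull_group[of S] P'_P P_L by (auto simp: Q_def P'_def)
  then have "S \<subseteq> R" using additive_hull_subset[of S] by (auto simp: P'_def)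
  then have "P \<subseteq> W" using P_L by (auto simp: W_def S_def)
  with P_R show ?thesis by blast
qed

text \<open>As the stabilizer \<open>D\<close> of \<open>z\<close> in \<open>N\<close> acts
  trivially on \<open>L\<close>, \<open>\<sigma> w\<close> depends only on
  \<open>\<sigma> z\<close>. The polynomial interpolating
  \<open>\<sigma> z \<mapsto> \<sigma> w\<close> is unique, hence invariant under \<open>N\<close>
  and so over \<open>R\<close>.\<close>

lemma L_simple:
  assumes w: "w \<in> L"
  obtains f where "f \<in> polys_over R" "Polynomial.degree f < card B" "poly f z = w"
proof -
  have "\<forall>y\<in>B. \<exists>\<sigma>. \<sigma> \<in> N \<and> \<sigma> z = y" using N_transitive by blast
  from bchoice[OF this] obtain n where n: "\<And>y. y \<in> B \<Longrightarrow> n y \<in> N" "\<And>y. y \<in> B \<Longrightarrow> n y z = y"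
    by blast
  have eq: "\<sigma> w = n (\<sigma> z) w" if \<sigma>: "\<sigma> \<in> N" for \<sigma>
  proof -
    define m where "m = n (\<sigma> z)"
    have m: "m \<in> N" "m z = \<sigma> z" using n[OF G_B[OF N_G[OF \<sigma>] z_B]] by (auto simp: m_def)
    then have "inv_into UNIV m \<circ> \<sigma> \<in> N" using \<sigma> by (intro aut_subgroupD[OF N_group])
    moreover have "(inv_into UNIV m \<circ> \<sigma>) z = z"
      using aut_subgroupD(4)[OF N_group m(1), of z] m(2) by simp
    ultimately have "inv_into UNIV m \<circ> \<sigma> \<in> D" unfolding D_def by blast
    then have "(inv_into UNIV m \<circ> \<sigma>) w = w" using w by (rule D_trivial)
    then show ?thesis using aut_subgroupD(5)[OF N_group m(1), of "\<sigma> w"] by (simp add: m_def)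
  qed
  obtain f where f: "f \<in> polys_over L" "\<forall>i\<ge>card B. poly.coeff f i = 0" "\<And>y. y \<in> B \<Longrightarrow> poly f y = n y w"
    using L.interpolation[OF fin_B B_L, of "\<lambda>y. n y w"] G_L N_G n(1) w by blast
  have deg: "Polynomial.degree f < card B" using f(2) card_B by (intro degree_lessI) auto
  have "\<sigma> (poly.coeff f i) = poly.coeff f i" if \<sigma>: "\<sigma> \<in> N" for \<sigma> i
  proof -
    interpret \<sigma>: field_aut \<sigma> using \<sigma> by (intro G_hom N_G)
    have "map_poly \<sigma> f = f"
    proof (rule poly_eqI_degree[of B])
      fix y assume y: "y \<in> B"
      define u where "u = inv_into UNIV \<sigma> y"
      have u: "\<sigma> u = y" "u \<in> B"
        using aut_subgroupD[OF N_group \<sigma>] G_B N_G y by (auto simp: u_def)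
      then have "\<sigma> \<circ> n u \<in> N" "(\<sigma> \<circ> n u) z = y"
        using \<sigma> n by (auto intro: aut_subgroupD[OF N_group])
      then have "\<sigma> (n u w) = n y w" using eq[of "\<sigma> \<circ> n u"] by simp
      then show "poly (map_poly \<sigma> f) y = poly f y"
        using \<sigma>.poly[of f u] f(3) u y by simp
    qed (use deg in \<open>simp_all add: \<sigma>.degree_map\<close>)
    then show ?thesis by (metis \<sigma>.coeff_map)
  qed
  then have "f \<in> polys_over R" using f(1) by (auto simp: polys_over_def R_def)
  moreover have "poly f z = w"
  proof -
    have "(\<lambda>x. x) \<in> N" using N_group by (simp add: aut_subgroup_def)
    from eq[OF this] show ?thesis using f(3)[OF z_B] by simp
  qed
  ultimately show ?thesis using deg that by blast
qed

lemma W_R_linear: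
  assumes "w \<in> W" "r \<in> R" "c \<in> R"
  shows "c * (w - r) \<in> W"
proof -
  have "\<sigma> (c * (w - r)) - c * (w - r) \<in> R" if \<sigma>: "\<sigma> \<in> N" for \<sigma>
  proof -
    interpret \<sigma>: field_aut \<sigma> using \<sigma> by (intro G_hom N_G)
    have "\<sigma> (c * (w - r)) - c * (w - r) = c * (\<sigma> w - w)"
      using assms R_fixed[OF \<sigma>] by (simp add: \<sigma>.mult \<sigma>.diff algebra_simps)
    moreover have "\<sigma> w - w \<in> R" using assms \<sigma> by (simp add: W_def)
    ultimately show ?thesis using R.mult[OF assms(3)] by simp
  qed
  moreover have "c * (w - r) \<in> L" using assms W_L R_L by (intro L.mult L.diff) auto
  ultimately show ?thesis by (simp add: W_def)
qed

lemma W_diff: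
  assumes "u \<in> W" "w \<in> W"
  shows "u - w \<in> W"
proof -
  have "\<sigma> (u - w) - (u - w) \<in> R" if \<sigma>: "\<sigma> \<in> N" for \<sigma>
  proof -
    interpret \<sigma>: field_aut \<sigma> using \<sigma> by (intro G_hom N_G)
    have eq: "\<sigma> (u - w) - (u - w) = (\<sigma> u - u) - (\<sigma> w - w)" by (simp add: \<sigma>.diff)
    show ?thesis unfolding eq by (rule R.diff) (use assms \<sigma> in \<open>simp_all add: W_def\<close>)
  qed
  with assms show ?thesis by (auto simp: W_def intro: L.diff)
qed

lemma G_W:
  assumes \<tau>: "\<tau> \<in> G" and w: "w \<in> W"
  shows "\<tau> w \<in> W"
proof -
  interpret \<tau>: field_aut \<tau> using \<tau> by (rule G_hom)
  have "\<sigma> (\<tau> w) - \<tau> w \<in> R" if "\<sigma> \<in> N" for \<sigma>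
  proof -
    from N_conj[OF \<tau> that] obtain \<sigma>'
      where \<sigma>': "\<sigma>' \<in> N" "\<And>x. \<sigma> (\<tau> x) = \<tau> (\<sigma>' x)" by blast
    then have "\<sigma>' w - w \<in> R" using w by (simp add: W_def)
    with G_R[OF \<tau> this] show ?thesis by (simp add: \<tau>.diff \<sigma>'(2))
  qed
  with G_L[OF \<tau>] w show ?thesis by (simp add: W_def)
qed

text \<open>
  Galois descent: write elements of \<open>W\<close> as polynomials in \<open>z\<close> over \<open>R\<close>. One of minimal support,
  normalized, is fixed by every automorphism fixing \<open>z\<close>.
\<close>

lemma W_meets_E: "\<exists>w\<in>W. w \<in> E \<and> w \<notin> R \<and> (\<forall>\<tau>\<in>G. \<tau> z = z \<longrightarrow> \<tau> w = w)"
proof -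
  define Q where "Q f \<longleftrightarrow> f \<in> polys_over R \<and> Polynomial.degree f < card B \<and> poly f z \<in> W \<and> poly f z \<notin> R" for f
  \<comment> \<open>The constant term is left out, as it lies in \<open>R\<close> and affects
    neither membership in \<open>W\<close> nor being outside \<open>R\<close>.\<close>
  define supp where "supp f = {i. 0 < i \<and> poly.coeff f i \<noteq> 0}" for f :: "'a poly"
  have fin: "finite (supp f)" for f
    by (rule finite_subset[of _ "{..Polynomial.degree f}"]) (auto simp: supp_def le_degree)
  obtain w where w: "w \<in> W" "w \<notin> R" using W_not_in_R by blast
  obtain f0 where "f0 \<in> polys_over R" "Polynomial.degree f0 < card B" "poly f0 z = w"
    using L_simple w W_L by blast
  with w have "Q f0" by (simp add: Q_def)
  then obtain f where f: "Q f" and least: "\<And>g. Q g \<Longrightarrow> card (supp f) \<le> card (supp g)"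
    using ex_has_least_nat[of Q f0 "\<lambda>f. card (supp f)"] by blast
  have cf: "poly.coeff f i \<in> R" for i using f by (simp add: Q_def polys_over_def)
  have "\<exists>j. j \<in> supp f"
  proof (rule ccontr)
    assume "\<nexists>j. j \<in> supp f"
    then have "Polynomial.degree f = 0" by (auto simp: supp_def)
    then obtain r where "f = [:r:]" by (rule degree_eq_zeroE)
    with cf[of 0] f show False by (simp add: Q_def)
  qed
  then obtain j where j: "j \<in> supp f" by blast
  \<comment> \<open>Scaling the coefficient at \<open>j\<close> to 1 makes it invariant, so
    \<open>map_poly \<tau> h - h\<close> loses the exponent \<open>j\<close>.\<close>
  define c where "c = inverse (poly.coeff f j)"
  have c: "c \<in> R" "c \<noteq> 0" using cf R.inverse j by (auto simp: c_def supp_def)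
  define h where "h = Polynomial.smult c (f - [:poly.coeff f 0:])"
  have h_R: "h \<in> polys_over R"
    unfolding h_def using f cf c by (intro R.smult_polys R.diff_polys R.const_polys) (auto simp: Q_def)
  have deg_h: "Polynomial.degree h < card B"
    unfolding h_def using f by (auto simp: Q_def intro!: le_less_trans[OF degree_smult_le] degree_diff_less)
  have h_0: "poly.coeff h 0 = 0" by (simp add: h_def)
  have h_i: "poly.coeff h i = c * poly.coeff f i" if "i > 0" for i
    using that by (simp add: h_def coeff_pCons split: nat.split)
  have h_j: "poly.coeff h j = 1" using j h_i[of j] by (simp add: supp_def c_def)
  have hz: "poly h z = c * (poly f z - poly.coeff f 0)" by (simp add: h_def)
  have hz_W: "poly h z \<in> W" unfolding hz using f c cf by (intro W_R_linear) (auto simp: Q_def)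
  have "poly h z \<notin> R"
  proof
    assume "poly h z \<in> R"
    then have "inverse c * poly h z + poly.coeff f 0 \<in> R" using c cf by (intro R.add R.mult R.inverse)
    moreover have "inverse c * poly h z + poly.coeff f 0 = poly f z"
      using c by (simp add: hz mult.assoc[symmetric])
    ultimately show False using f by (simp add: Q_def)
  qed
  moreover have fixed: "\<tau> (poly h z) = poly h z" if \<tau>: "\<tau> \<in> G" "\<tau> z = z" for \<tau>
  proof -
    interpret \<tau>: field_aut \<tau> using \<tau>(1) by (rule G_hom)
    \<comment> \<open>Its support is smaller than the least possible, so its value at
      \<open>z\<close> lies in \<open>R\<close>. As its degree is below that of \<open>z\<close>
      over \<open>R\<close>, it is constant, equal to its constant term 0.\<close>
    define g where "g = map_poly \<tau> h - h"
    have gz: "poly g z = \<tau> (poly h z) - poly h z" by (simp add: g_def \<tau>.poly \<tau>(2))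
    have g_R: "g \<in> polys_over R"
      using h_R G_R[OF \<tau>(1)] by (auto simp: g_def polys_over_def \<tau>.coeff_map intro: R.diff)
    have deg_g: "Polynomial.degree g < card B"
      unfolding g_def using deg_h by (intro degree_diff_less) (auto simp: \<tau>.degree_map)
    have "supp g \<subseteq> supp f - {j}"
      by (auto simp: supp_def g_def \<tau>.coeff_map h_j h_i \<tau>.one \<tau>.zero)
    then have "card (supp g) < card (supp f)"
      using j fin by (metis card_Diff1_less card_mono finite_Diff le_less_trans)
    then have "\<not> Q g" using least[of g] by auto
    moreover have "poly g z \<in> W" unfolding gz using hz_W G_W[OF \<tau>(1)] by (intro W_diff)
    ultimately have r: "poly g z \<in> R" using g_R deg_g by (simp add: Q_def)
    have "g - [:poly g z:] = 0"
    proof (rule ccontr)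
      assume nz: "g - [:poly g z:] \<noteq> 0"
      have "card B \<le> Polynomial.degree (g - [:poly g z:])"
        using r g_R nz by (intro disjoint_R R.diff_polys R.const_polys) auto
      moreover have "Polynomial.degree (g - [:poly g z:]) < card B"
        using deg_g by (intro degree_diff_less) auto
      ultimately show False by simp
    qed
    then have "poly.coeff g 0 = poly g z" by (metis coeff_pCons_0 eq_iff_diff_eq_0)
    then show ?thesis using gz by (simp add: g_def \<tau>.coeff_map h_0 \<tau>.zero)
  qed
  moreover have "poly h z \<in> E" using fixed_E fixed hz_W W_L by blast
  ultimately show ?thesis using hz_W by blast
qed

theorem additive_generator:
  "\<exists>A t. A \<in> polys_over (K \<inter> V) \<and> additive_poly K A \<and> t \<in> E \<and> t \<notin> K \<and>
     is_min_poly K t (A - [:poly A t:])"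
proof -
  obtain w where w: "w \<in> W" "w \<in> E" "w \<notin> R"
    and w_fix: "\<And>\<tau>. \<tau> \<in> G \<Longrightarrow> \<tau> z = z \<Longrightarrow> \<tau> w = w"
    using W_meets_E by blast
  \<comment> \<open>The differences of conjugates are made integral by a common factor
    \<open>c\<close> from \<open>K\<close>, on which every automorphism in \<open>G\<close> is
    trivial.\<close>
  have "finite ((\<lambda>u. u - w) ` orbit_of N w)" using finite_orbit[of N w] N_G by blast
  from integral_multiple_finite[OF val.val_ring_axioms this]
  obtain c where c: "c \<in> K" "c \<noteq> 0" "\<And>a. a \<in> (\<lambda>u. u - w) ` orbit_of N w \<Longrightarrow> c * a \<in> V"
    by blast
  have c_R: "c \<in> R" using c(1) K_R by blast
  define t where "t = c * w"
  have t_W: "t \<in> W" using W_R_linear[OF w(1) R.zero c_R] by (simp add: t_def)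
  have t_E: "t \<in> E" unfolding t_def using c(1) K_E w(2) by (intro E.mult) auto
  have t_R: "t \<notin> R"
  proof
    assume "t \<in> R"
    then have "inverse c * t \<in> R" using c_R by (intro R.mult R.inverse)
    then show False using w(3) c(2) by (simp add: t_def mult.assoc[symmetric])
  qed
  define S where "S = {\<sigma> t - t | \<sigma>. \<sigma> \<in> N}"
  have S_image: "S = (\<lambda>u. u - t) ` orbit_of N t" by (auto simp: S_def orbit_of_def)
  have fin_orb: "finite (orbit_of N t)" using N_G by (intro finite_orbit) auto
  have fin_S: "finite S" unfolding S_image using fin_orb by simp
  have S_V: "S \<subseteq> V"
  proof
    fix s assume "s \<in> S"
    then obtain \<sigma> where \<sigma>: "\<sigma> \<in> N" "s = \<sigma> t - t" by (auto simp: S_def)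
    then have "s = c * (\<sigma> w - w)"
      using field_aut.mult[OF G_hom[OF N_G[OF \<sigma>(1)]]] R_fixed[OF \<sigma>(1) c_R] by (simp add: t_def algebra_simps)
    then show "s \<in> V" using c(3) \<sigma>(1) by (auto simp: orbit_of_def)
  qed
  have S_R: "S \<subseteq> R" using t_W by (auto simp: S_def W_def)
  have "(\<lambda>x. x) \<in> N" using N_group by (simp add: aut_subgroup_def)
  then have S_0: "0 \<in> S" by (force simp: S_def)
  \<comment> \<open>\<open>\<sigma> \<mapsto> \<sigma> t - t\<close> is a homomorphism because
    \<open>N\<close> fixes its values, which lie in \<open>R\<close>.\<close>
  have S_add: "a + b \<in> S" if ab: "a \<in> S" "b \<in> S" for a b
  proof -
    from ab obtain \<sigma> \<tau> where \<sigma>: "\<sigma> \<in> N" "a = \<sigma> t - t" and \<tau>: "\<tau> \<in> N" "b = \<tau> t - t"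
      by (auto simp: S_def)
    interpret \<sigma>: field_aut \<sigma> using \<sigma>(1) by (intro G_hom N_G)
    have "\<sigma> b = b" using R_fixed[OF \<sigma>(1)] S_R ab by blast
    then have "a + b = (\<sigma> \<circ> \<tau>) t - t" by (simp add: \<sigma>(2) \<tau>(2) \<sigma>.diff algebra_simps)
    then show ?thesis using aut_subgroupD(6)[OF N_group \<sigma>(1) \<tau>(1)] unfolding S_def by blast
  qed
  have S_minus: "- a \<in> S" if a: "a \<in> S" for a
  proof -
    from a obtain \<sigma> where \<sigma>: "\<sigma> \<in> N" "a = \<sigma> t - t" by (auto simp: S_def)
    define \<tau> where "\<tau> = inv_into UNIV \<sigma>"
    have \<tau>: "\<tau> \<in> N" "\<tau> (\<sigma> t) = t" using aut_subgroupD[OF N_group \<sigma>(1)] by (auto simp: \<tau>_def)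
    interpret \<tau>: field_aut \<tau> using \<tau>(1) by (intro G_hom N_G)
    have "\<tau> a = a" using R_fixed[OF \<tau>(1)] S_R a by blast
    then have "- a = \<tau> t - t" using \<tau>(2) by (simp add: \<sigma>(2) \<tau>.diff algebra_simps)
    then show ?thesis using \<tau>(1) unfolding S_def by blast
  qed
  define A where "A = (\<Prod>a\<in>S. [:- a, 1:])"
  have A_add: "poly A (x + y) = poly A x + poly A y" for x y
    unfolding A_def by (rule additive_linear_prod[OF fin_S S_0 S_add S_minus])
  define f where "f = (\<Prod>u\<in>orbit_of N t. [:- u, 1:])"
  have card: "card S = card (orbit_of N t)"
    unfolding S_image by (rule card_image) (auto simp: inj_on_def)
  have pos: "card S > 0" using fin_S S_0 by (auto simp: card_gt_0_iff)
  \<comment> \<open>Both are monic of degree \<open>card S\<close> and vanish on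
    \<open>t + S\<close>, the orbit of \<open>t\<close>.\<close>
  have f_eq: "A - [:poly A t:] = f"
  proof (rule poly_eqI_degree_lead_coeff[where n = "card S" and A = "orbit_of N t"])
    show "poly.coeff (A - [:poly A t:]) (card S) = poly.coeff f (card S)"
      using degree_linear_prod(2)[OF fin_S] degree_linear_prod(2)[OF fin_orb] pos
      by (simp add: A_def f_def card coeff_pCons split: nat.split)
    show "card S \<le> card (orbit_of N t)" by (simp add: card)
    show "Polynomial.degree (A - [:poly A t:]) \<le> card S"
      using degree_linear_prod(1)[OF fin_S] by (intro degree_diff_le) (auto simp: A_def)
    show "Polynomial.degree f \<le> card S"
      using degree_linear_prod(1)[OF fin_orb] by (simp add: f_def card)
    fix u assume u: "u \<in> orbit_of N t"
    then have "u - t \<in> S" by (auto simp: S_image)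
    then have "poly A (u - t) = 0" using fin_S by (auto simp: A_def poly_prod)
    then have "poly A u = poly A t" using A_add[of "u - t" t] by simp
    moreover have "poly f u = 0" using u fin_orb by (auto simp: f_def poly_prod)
    ultimately show "poly (A - [:poly A t:]) u = poly f u" by simp
  qed
  \<comment> \<open>By transitivity of \<open>N\<close> on \<open>B\<close>, an element of
    \<open>N\<close> corrects \<open>\<tau>\<close> to an automorphism fixing \<open>z\<close>,
    hence \<open>w\<close> and \<open>t\<close>. So \<open>f\<close> is the minimal polynomial over
    \<open>K\<close>.\<close>
  have orb: "orbit_of G t = orbit_of N t"
  proof
    show "orbit_of N t \<subseteq> orbit_of G t" using N_G by (auto simp: orbit_of_def)
    show "orbit_of G t \<subseteq> orbit_of N t"
    proof
      fix u assume "u \<in> orbit_of G t"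
      then obtain \<tau> where \<tau>: "\<tau> \<in> G" "u = \<tau> t" by (auto simp: orbit_of_def)
      obtain n where n: "n \<in> N" "n z = \<tau> z" using N_transitive[OF G_B[OF \<tau>(1) z_B]] by blast
      define \<rho> where "\<rho> = inv_into UNIV n \<circ> \<tau>"
      have "\<rho> \<in> G" unfolding \<rho>_def using N_G[OF n(1)] \<tau>(1) by (intro aut_over_comp aut_over_inv)
      moreover have "\<rho> z = z" using aut_subgroupD(4)[OF N_group n(1), of z] n(2) by (simp add: \<rho>_def)
      ultimately have "\<rho> t = t"
        using w_fix field_aut.mult[OF G_hom, of \<rho> c w] c(1) by (simp add: t_def aut_over_fix)
      then have "u = n t" using aut_subgroupD(5)[OF N_group n(1), of u] \<tau>(2) by (simp add: \<rho>_def)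
      then show "u \<in> orbit_of N t" using n(1) by (simp add: orbit_of_def)
    qed
  qed
  have f_min: "is_min_poly K t f"
    using min_poly_orbit[of t] t_W W_L by (auto simp: orb f_def)
  then have f_K: "f \<in> polys_over K" by (simp add: is_min_poly_def)
  \<comment> \<open>\<open>A\<close> differs from \<open>f\<close> only in the constant term, and
    that of \<open>A\<close> is 0.\<close>
  have "poly A 0 = 0" using fin_S S_0 by (auto simp: A_def poly_prod)
  then have "poly.coeff A i \<in> K" for i
  proof (cases i)
    case (Suc k)
    then have "poly.coeff A i = poly.coeff f i" by (simp flip: f_eq)
    then show ?thesis using f_K by (simp add: polys_over_def)
  qed (simp add: zero poly_0_coeff_0)
  then have A_K: "A \<in> polys_over K" by (simp add: polys_over_def)
  moreover have "A \<in> polys_over V"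
    unfolding A_def using S_V by (intro val.O.prod_polys val.O.linear_polys) auto
  ultimately have "A \<in> polys_over (K \<inter> V)" by (auto simp: polys_over_def)
  moreover have "additive_poly K A" using A_K A_add by (rule additive_polyI)
  ultimately show ?thesis using f_min t_E t_R K_R f_eq by blast
qed

end

section \<open>Linear disjointness from the ramification field\<close>

lemma rsquarefree_linear_prod:
  fixes S :: "'a::field set"
  assumes S: "finite S"
  shows "rsquarefree (\<Prod>y\<in>S. [:- y, 1:])"
  unfolding rsquarefree_def
proof (intro conjI allI)
  show "(\<Prod>y\<in>S. [:- y, 1:]) \<noteq> 0" using S by simp
  fix a
  show "Polynomial.order a (\<Prod>y\<in>S. [:- y, 1:]) = 0 \<or> Polynomial.order a (\<Prod>y\<in>S. [:- y, 1:]) = 1"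
  proof (cases "a \<in> S")
    case False
    then have "poly (\<Prod>y\<in>S. [:- y, 1:]) a \<noteq> 0" using S by (auto simp: poly_prod)
    then show ?thesis by (simp add: order_0I)
  next
    case True
    define h where "h = (\<Prod>y\<in>S - {a}. [:- y, 1:])"
    have "(\<Prod>y\<in>S. [:- y, 1:]) = [:- a, 1:] ^ 1 * h"
      unfolding h_def power_one_right by (rule prod.remove[OF S True])
    moreover have h: "poly h a \<noteq> 0" using S by (auto simp: h_def poly_prod)
    then have "h \<noteq> 0" by auto
    then have "Polynomial.order a ([:- a, 1:] ^ 1 * h) =
        Polynomial.order a ([:- a, 1:] ^ 1) + Polynomial.order a h"
      by (intro order_mult) (simp del: mult_pCons_left)
    moreover have "Polynomial.order a h = 0" using h by (rule order_0I)
    moreover have "Polynomial.order a ([:- a, 1:] ^ 1) = 1" by (rule order_power_n_n)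
    ultimately show ?thesis by presburger
  qed
qed

lemma (in split_extension) L_sep_closure: "L \<subseteq> sep_closure K"
proof
  fix x assume "x \<in> L"
  from min_poly_orbit[OF this] rsquarefree_linear_prod finite_orbit[of G x]
  show "x \<in> sep_closure K" unfolding sep_closure_def by blast
qed

text \<open>An element of the ramification group, restricted to \<open>L\<close>, extends to an
  automorphism of the algebraic closure. The extension belongs to the wild group, whose condition
  concerns only \<open>L\<close>.\<close>

lemma (in split_extension) wild_fixed_in_ramification_field:
  assumes v: "valuation_on UNIV v"
  shows "{x \<in> L. \<forall>\<sigma>\<in>wild_group K L {x. 0 < v x}. \<sigma> x = x} \<subseteq> ramification_field K v"
proof
  fix x assume x: "x \<in> {x \<in> L. \<forall>\<sigma>\<in>wild_group K L {x. 0 < v x}. \<sigma> x = x}"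
  have "\<sigma> x = x" if \<sigma>: "\<sigma> \<in> ramification_group K v" for \<sigma>
  proof -
    have gal: "\<sigma> \<in> gal_group (sep_closure K) K"
      and less: "\<And>y. y \<in> sep_closure K - {0} \<Longrightarrow> v y < v (\<sigma> y - y)"
      using \<sigma> by (auto simp: ramification_group_def)
    have hom: "\<sigma> (a + b) = \<sigma> a + \<sigma> b" "\<sigma> (a * b) = \<sigma> a * \<sigma> b" if "a \<in> L" "b \<in> L" for a b
      using gal subsetD[OF L_sep_closure that(1)] subsetD[OF L_sep_closure that(2)]
      by (auto simp: gal_group_def ring_iso_def ring_hom_def ring_of_type_algebra_def)
    have fix_K: "\<sigma> a = a" if "a \<in> K" for a using gal that by (auto simp: gal_group_def)
    have "iso_graph K {(a, \<sigma> a) | a. a \<in> L}"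
      unfolding iso_graph_def using K_L hom fix_K zero by (auto intro: L.add L.mult)
    from iso_graph_extend[OF this] obtain \<tau> where \<tau>: "\<tau> \<in> G" "\<And>a. a \<in> L \<Longrightarrow> \<tau> a = \<sigma> a"
      by blast
    have "\<tau> \<in> wild_group K L {x. 0 < v x}"
      unfolding wild_group_def
    proof (intro CollectI conjI ballI \<tau>(1))
      fix y assume y: "y \<in> L - {0}"
      then have "v y < v (\<tau> y - y)" using less[of y] L_sep_closure \<tau>(2) by auto
      then show "0 < v ((\<tau> y - y) / y)" using valuation_less_iff(1)[OF v] y by blast
    qed
    then show ?thesis using x \<tau>(2) by auto
  qed
  then show "x \<in> ramification_field K v"
    using x L_sep_closure by (auto simp: ramification_field_def)
qed

text \<open>Independence is a property of sets, so distinctness of the powers is what matches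
  relations with polynomials. Bounding the coefficients instead of the degree includes
  \<open>d = 0\<close>.\<close>

lemma lin_indep_over_powers_iff:
  assumes inj: "inj_on (\<lambda>i. z ^ i) {..<d}" and "ring_set F"
  shows "lin_indep_over F ((\<lambda>i. z ^ i) ` {..<d}) \<longleftrightarrow>
         (\<forall>g\<in>polys_over F. (\<forall>i\<ge>d. poly.coeff g i = 0) \<and> poly g z = 0 \<longrightarrow> g = 0)"
    (is "?L \<longleftrightarrow> ?R")
proof
  interpret ring_set F by fact
  let ?S = "(\<lambda>i. z ^ i) ` {..<d}"
  have poly_sum_lt: "poly g z = (\<Sum>i<d. poly.coeff g i * z ^ i)" if "\<forall>i\<ge>d. poly.coeff g i = 0" for g
  proof -
    have "poly g z = (\<Sum>i\<in>{..Polynomial.degree g} \<union> {..<d}. poly.coeff g i * z ^ i)"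
      unfolding poly_altdef by (intro sum.mono_neutral_left) (auto simp: coeff_eq_0)
    also have "\<dots> = (\<Sum>i<d. poly.coeff g i * z ^ i)"
      using that by (intro sum.mono_neutral_right) auto
    finally show ?thesis .
  qed
  {
    assume L: ?L
    show ?R
    proof (intro ballI impI)
      fix g assume g: "g \<in> polys_over F" "(\<forall>i\<ge>d. poly.coeff g i = 0) \<and> poly g z = 0"
      define c where "c x = poly.coeff g (the_inv_into {..<d} (\<lambda>i. z ^ i) x)" for x
      have c: "c (z ^ i) = poly.coeff g i" if "i < d" for i
        using the_inv_into_f_f[OF inj, of i] that by (simp add: c_def)
      have "(\<Sum>x\<in>?S. c x * x) = (\<Sum>i<d. poly.coeff g i * z ^ i)"
        by (subst sum.reindex[OF inj]) (auto simp: c)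
      then have "(\<Sum>x\<in>?S. c x * x) = 0" using g(2) poly_sum_lt[of g] by simp
      moreover have "\<forall>x\<in>?S. c x \<in> F" using g(1) by (auto simp: c_def polys_over_def)
      ultimately have "\<forall>x\<in>?S. c x = 0" using L unfolding lin_indep_over_def by blast
      then have "poly.coeff g i = 0" for i using c g(2) by (cases "i < d") auto
      then show "g = 0" by (simp add: poly_eq_iff)
    qed
  next
    assume R: ?R
    show ?L
      unfolding lin_indep_over_def
    proof (intro allI impI)
      fix T c
      assume T: "finite T \<and> T \<subseteq> ?S \<and> (\<forall>x\<in>T. c x \<in> F) \<and> (\<Sum>x\<in>T. c x * x) = 0"
      \<comment> \<open>\<open>T\<close> may omit some of the powers; these get the coefficient
        0.\<close>
      define b where "b x = (if x \<in> T then c x else 0)" for x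
      define g where "g = (\<Sum>i<d. Polynomial.monom (b (z ^ i)) i)"
      have cg: "poly.coeff g i = (if i < d then b (z ^ i) else 0)" for i
        by (simp add: g_def Polynomial.coeff_sum)
      have "g \<in> polys_over F" using T zero by (auto simp: polys_over_def cg b_def)
      moreover have "poly g z = 0"
      proof -
        have "poly g z = (\<Sum>i<d. b (z ^ i) * z ^ i)" by (simp add: g_def poly_sum poly_monom)
        also have "\<dots> = (\<Sum>x\<in>?S. b x * x)" by (subst sum.reindex[OF inj]) auto
        also have "\<dots> = (\<Sum>x\<in>T. c x * x)"
          using T by (intro sum.mono_neutral_cong_right) (auto simp: b_def)
        finally show ?thesis using T by simp
      qed
      ultimately have "g = 0" using R cg by simp
      then have "b (z ^ i) = 0" if "i < d" for i using cg[of i] that by simp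
      then have "\<forall>x\<in>?S. b x = 0" by blast
      then have "b x = 0" if "x \<in> T" for x using T that by blast
      then show "\<forall>x\<in>T. c x = 0" by (simp add: b_def)
    qed
  }
qed

lemma (in alg_ext) min_poly_inj_powers:
  assumes f: "is_min_poly K z f"
  shows "inj_on (\<lambda>i. z ^ i) {..<Polynomial.degree f}"
proof -
  have "\<not> z ^ i = z ^ j" if ij: "i < j" "j < Polynomial.degree f" for i j
  proof
    assume eq: "z ^ i = z ^ j"
    define g where "g = Polynomial.monom 1 j - Polynomial.monom (1 :: 'a) i"
    have "poly.coeff g j = 1" using ij by (simp add: g_def)
    then have "g \<noteq> 0" by auto
    moreover have "g \<in> polys_over K" unfolding g_def by (intro diff_polys monom_polys one)
    moreover have "poly g z = 0" by (simp add: g_def poly_monom eq)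
    moreover have "Polynomial.degree g \<le> j"
      unfolding g_def using ij by (intro degree_diff_le) (auto simp: degree_monom_eq)
    ultimately show False using f ij unfolding is_min_poly_def by fastforce
  qed
  then show ?thesis by (metis (no_types, lifting) inj_onI lessThan_iff linorder_neqE_nat)
qed

text \<open>The powers of \<open>z\<close> below the degree of \<open>f\<close> are independent over
  \<open>K\<close>, hence over \<open>F\<close>; a nonzero \<open>g\<close> of smaller degree would
  be a relation between them.\<close>

lemma (in alg_ext) linearly_disjoint_min_degree:
  assumes f: "is_min_poly K z f" and disj: "linearly_disjoint K E F" and "ring_set F"
    and pow: "\<And>i. z ^ i \<in> E"
    and g: "g \<in> polys_over F" "g \<noteq> 0" "poly g z = 0"
  shows "Polynomial.degree f \<le> Polynomial.degree g"
proof (rule ccontr)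
  assume less: "\<not> Polynomial.degree f \<le> Polynomial.degree g"
  note inj = min_poly_inj_powers[OF f]
  let ?S = "(\<lambda>i. z ^ i) ` {..<Polynomial.degree f}"
  have "lin_indep_over K ?S"
    unfolding lin_indep_over_powers_iff[OF inj ring_set_axioms]
  proof (intro ballI impI)
    fix h assume h: "h \<in> polys_over K"
      "(\<forall>i\<ge>Polynomial.degree f. poly.coeff h i = 0) \<and> poly h z = 0"
    show "h = 0"
    proof (rule ccontr)
      assume h0: "h \<noteq> 0"
      then have "Polynomial.degree f \<le> Polynomial.degree h" using f h by (simp add: is_min_poly_def)
      with h have "lead_coeff h = 0" by blast
      with h0 show False by simp
    qed
  qed
  then have "lin_indep_over F ?S" using disj pow unfolding linearly_disjoint_def by blast
  then show False
    unfolding lin_indep_over_powers_iff[OF inj \<open>ring_set F\<close>] using g less by (force simp: coeff_eq_0)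
qed

text \<open>By conjugation, a multiple root would make \<open>z\<close> a root of
  \<open>pderiv f\<close>, which has smaller degree than \<open>f\<close>.\<close>

lemma (in alg_ext) min_poly_split:
  assumes f: "is_min_poly K z f" and nz: "pderiv f \<noteq> 0"
  shows "f = (\<Prod>y\<in>{y. poly f y = 0}. [:- y, 1:])"
proof -
  have f': "f \<in> polys_over K" "lead_coeff f = 1" "poly f z = 0" "f \<noteq> 0"
    using f by (auto simp: is_min_poly_def)
  have simple: "poly (pderiv f) a \<noteq> 0" if a: "poly f a = 0" for a
  proof
    assume 0: "poly (pderiv f) a = 0"
    obtain \<sigma> where \<sigma>: "\<sigma> \<in> aut_over K" "\<sigma> z = a" by (rule min_poly_conjugate[OF f a])
    interpret \<sigma>: field_aut \<sigma> using \<sigma>(1) by (rule aut_over_field_aut)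
    have "\<sigma> (poly (pderiv f) z) = 0"
      using aut_over_poly[OF \<sigma>(1) pderiv_polys[OF f'(1)], of z] \<sigma>(2) 0 by simp
    then have "Polynomial.degree f \<le> Polynomial.degree (pderiv f)"
      using f nz pderiv_polys[OF f'(1)] by (simp add: is_min_poly_def \<sigma>.eq_0_iff)
    moreover have "Polynomial.degree (pderiv f) < Polynomial.degree f"
      using nz by (intro degree_lessI) (auto simp: coeff_pderiv coeff_eq_0)
    ultimately show False by simp
  qed
  obtain M where M: "f = (\<Prod>x\<in>#M. [:- x, 1:])"
    using alg_closed_imp_factorization[OF f'(4)] f'(2) by auto
  have le: "count M a \<le> 1" for a
  proof (rule ccontr)
    assume "\<not> count M a \<le> 1"
    then have "a \<in># M" by (simp add: not_less_eq_eq flip: count_greater_zero_iff)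
    then obtain M1 where M1: "M = add_mset a M1" by (blast dest: multi_member_split)
    with \<open>\<not> count M a \<le> 1\<close> have "a \<in># M1" by (simp flip: count_greater_zero_iff)
    then obtain M2 where "M1 = add_mset a M2" by (blast dest: multi_member_split)
    with M M1 have "f = [:- a, 1:] * ([:- a, 1:] * (\<Prod>x\<in>#M2. [:- x, 1:]))" by simp
    then have "poly f a = 0" "poly (pderiv f) a = 0" by (simp_all add: pderiv_mult del: mult_pCons_left)
    with simple show False by blast
  qed
  have roots: "set_mset M = {y. poly f y = 0}"
    by (auto simp: M poly_prod_mset prod_mset_zero_iff)
  have "count M a = count (mset_set (set_mset M)) a" for a
    using le[of a] by (cases "a \<in># M") (auto simp: le_Suc_eq count_eq_zero_iff)
  then have "M = mset_set {y. poly f y = 0}" by (simp add: multiset_eq_iff roots)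
  then show ?thesis using M by (simp add: prod_unfold_prod_mset)
qed

section \<open>Minimal purely wild extensions\<close>

lemma is_subfield_adjoin: "is_subfield (adjoin K x)"
  unfolding adjoin_def
proof (rule hull_in)
  fix T :: "'a set set"
  assume "Ball T is_subfield"
  then have F: "\<And>F. F \<in> T \<Longrightarrow> field_set F" by (simp add: is_subfield_iff)
  note R = field_set.axioms(1)[OF F]
  have "field_set (\<Inter>T)"
    by unfold_locales
      (auto intro: ring_set.zero[OF R] ring_set.one[OF R] ring_set.add[OF R] ring_set.mult[OF R]
        ring_set.uminus[OF R] field_set.inverse[OF F])
  then show "is_subfield (\<Inter>T)" by (simp add: is_subfield_iff)
qed

lemma minimal_extension_adjoin:
  assumes min: "minimal_extension K E" and t: "t \<in> E" "t \<notin> K"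
  shows "E = adjoin K t"
proof -
  have E: "is_subfield E" "K \<subseteq> E" using min by (auto simp: minimal_extension_def)
  have sub: "insert t K \<subseteq> adjoin K t" unfolding adjoin_def by (rule hull_subset)
  have "adjoin K t \<subseteq> E" unfolding adjoin_def using E t by (intro hull_minimal) auto
  moreover have "is_subfield (adjoin K t)" by (rule is_subfield_adjoin)
  ultimately have "adjoin K t = K \<or> adjoin K t = E"
    using min sub unfolding minimal_extension_def by blast
  with sub t show ?thesis by blast
qed

text \<open>
  In the inseparable case the polynomial is \<open>X\<^sup>p\<close>, because the \<open>p\<close>-th power of an element of least
  degree lies in \<open>K\<close>.
\<close>

lemma (in alg_ext) inseparable_power:
  assumes p: "prime CHAR('a)" and f: "is_min_poly K z f" and z: "z \<in> E - K"
    and E: "\<And>n. z ^ n \<in> E" and deriv: "pderiv f = 0"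
    and least: "\<And>x g. x \<in> E - K \<Longrightarrow> is_min_poly K x g \<Longrightarrow> Polynomial.degree f \<le> Polynomial.degree g"
  shows "is_min_poly K z (Polynomial.monom 1 CHAR('a) - [:z ^ CHAR('a):])"
proof -
  define p where "p = CHAR('a)"
  have p1: "p > 1" using p prime_gt_1_nat by (simp add: p_def)
  have f': "f \<in> polys_over K" "lead_coeff f = 1" "poly f z = 0"
    using f by (auto simp: is_min_poly_def)
  have pos: "Polynomial.degree f > 0"
  proof (rule ccontr)
    assume "\<not> Polynomial.degree f > 0"
    then have "f = 1" using f'(2) by (metis degree_eq_zeroE gr0I lead_coeff_pCons(2) one_pCons)
    with f'(3) show False by simp
  qed
  have coeff_0: "p dvd i" if "poly.coeff f i \<noteq> 0" for i
  proof (cases i)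
    case (Suc k)
    have "of_nat i * poly.coeff f i = poly.coeff (pderiv f) k" by (simp add: coeff_pderiv Suc)
    then have "of_nat i = (0 :: 'a)" using that deriv by simp
    then show ?thesis by (simp add: of_nat_eq_0_iff_char_dvd p_def)
  qed simp
  then obtain e where e: "Polynomial.degree f = p * e" using f'(2) by (metis dvdE one_neq_zero)
  then have e0: "e > 0" using pos by simp
  then have p_le: "p \<le> Polynomial.degree f" using e by simp
  \<comment> \<open>All exponents in \<open>f\<close> are multiples of \<open>p\<close>, so
    \<open>f\<close> is \<open>g\<close> evaluated at \<open>X ^ p\<close>.\<close>
  define g where "g = (\<Sum>j\<le>e. Polynomial.monom (poly.coeff f (p * j)) j)"
  have cg: "poly.coeff g j = (if j \<le> e then poly.coeff f (p * j) else 0)" for j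
    by (simp add: g_def Polynomial.coeff_sum)
  have g: "g \<in> polys_over K" using f'(1) by (simp add: polys_over_def cg zero)
  have g0: "g \<noteq> 0" using f'(2) e cg[of e] by auto
  have "poly f z = (\<Sum>i\<in>(\<lambda>j. p * j) ` {..e}. poly.coeff f i * z ^ i)"
    unfolding poly_altdef e
  proof (rule sum.mono_neutral_right)
    show "\<forall>i\<in>{..p * e} - (\<lambda>j. p * j) ` {..e}. poly.coeff f i * z ^ i = 0"
    proof
      fix i assume i: "i \<in> {..p * e} - (\<lambda>j. p * j) ` {..e}"
      have "\<not> p dvd i"
      proof
        assume "p dvd i"
        then obtain j where "i = p * j" by (rule dvdE)
        with i p1 show False by auto
      qed
      then show "poly.coeff f i * z ^ i = 0" using coeff_0 by auto
    qed
  qed auto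
  also have "\<dots> = (\<Sum>j\<le>e. poly.coeff f (p * j) * (z ^ p) ^ j)"
    using p1 by (subst sum.reindex) (auto simp: inj_on_def power_mult)
  also have "\<dots> = poly g (z ^ p)" by (simp add: g_def poly_sum poly_monom)
  finally have g_root: "poly g (z ^ p) = 0" using f'(3) by simp
  \<comment> \<open>Otherwise \<open>z ^ p\<close> would be an element of \<open>E - K\<close> of
    degree at most \<open>e\<close>, below the least degree \<open>p * e\<close>.\<close>
  have zp: "z ^ p \<in> K"
  proof (rule ccontr)
    assume "z ^ p \<notin> K"
    then have zE: "z ^ p \<in> E - K" using E by simp
    obtain h where h: "is_min_poly K (z ^ p) h" by (rule min_poly_exists)
    have "Polynomial.degree f \<le> Polynomial.degree h" using least[OF zE h] .
    also have "\<dots> \<le> Polynomial.degree g" using h g g0 g_root by (simp add: is_min_poly_def)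
    also have "\<dots> \<le> e" by (rule degree_le) (simp add: cg)
    also have "\<dots> < Polynomial.degree f" using e e0 p1 by simp
    finally show False by simp
  qed
  define A where "A = Polynomial.monom 1 p - [:z ^ p:]"
  have deg: "Polynomial.degree A = p" and lc: "poly.coeff A p = 1"
  proof -
    show lc: "poly.coeff A p = 1" using p1 by (simp add: A_def coeff_pCons split: nat.split)
    have "Polynomial.degree A \<le> p" unfolding A_def by (intro degree_diff_le) (auto simp: degree_monom_le)
    moreover have "p \<le> Polynomial.degree A" using lc by (intro le_degree) simp
    ultimately show "Polynomial.degree A = p" by simp
  qed
  have "is_min_poly K z A"
    unfolding is_min_poly_def
  proof (intro conjI ballI impI)
    show "A \<in> polys_over K" unfolding A_def using zp one by (intro diff_polys monom_polys const_polys)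
    show "poly A z = 0" by (simp add: A_def poly_monom)
    show "lead_coeff A = 1" by (simp add: deg lc)
    fix h assume h: "h \<in> polys_over K" "h \<noteq> 0 \<and> poly h z = 0"
    then have "Polynomial.degree f \<le> Polynomial.degree h" using f by (simp add: is_min_poly_def)
    with p_le deg show "Polynomial.degree A \<le> Polynomial.degree h" by simp
  qed
  then show ?thesis by (simp add: A_def p_def)
qed

theorem theorem13:
  fixes K K1 :: "'a::alg_closed_field set"
    and v :: "'a \<Rightarrow> 'g::linordered_ab_group_add extended"
    and p :: nat
  assumes "is_subfield K" and "\<forall>x::'a. algebraic_over K x"
    and "CHAR('a) = p" and "p > 0"
    and "valuation_on UNIV v" and "henselian K v"
    and "purely_wild K K1 v" and "minimal_extension K K1"
  shows "\<exists>A \<theta>. A \<in> polys_over (valuation_ring K v) \<and> additive_poly K A \<and>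
           \<theta> \<in> K1 \<and> K1 = adjoin K \<theta> \<and> is_min_poly K \<theta> (A - [:poly A \<theta>:])"
proof -
  have prime: "prime CHAR('a)" using assms(3,4) by (intro prime_CHAR_semidom) simp
  note v = assms(5) and min = assms(8)
  interpret alg_ext K
    using assms(1,2) unfolding is_subfield_iff algebraic_over_def by (simp add: alg_ext_def alg_ext_axioms_def)
  have K1: "is_subfield K1" "K \<subseteq> K1" using min by (auto simp: minimal_extension_def)
  interpret F: field_set K1 using K1(1) by (simp add: is_subfield_iff)
  interpret K1: alg_ext K1 using K1(2) F.add F.mult by (rule alg_ext_of_subring)
  interpret val: val_ring "{x. 0 \<le> v x}" "{x. 0 < v x}" using v by (rule valuation_val_ring)
  have ring: "valuation_ring K v = K \<inter> {x. 0 \<le> v x}" by (auto simp: valuation_ring_def)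
  have in_ring: "0 \<in> valuation_ring K v" "1 \<in> valuation_ring K v"
    using zero one val.O.zero val.O.one by (auto simp: ring)
  show ?thesis
  proof (cases "K1 = K")
    \<comment> \<open>\<open>minimal_extension\<close> admits the trivial extension; there the
      polynomial \<open>X\<close> and the element 0 work.\<close>
    case True
    have "insert 0 K = K" using zero by blast
    then have "K1 = adjoin K 0"
      using assms(1) True hull_same[of is_subfield K] by (simp add: adjoin_def)
    moreover have "[:0, 1:] \<in> polys_over (valuation_ring K v)"
      using in_ring by (auto simp: polys_over_def coeff_pCons split: nat.split)
    moreover have "additive_poly K [:0, 1:]"
      by (rule additive_polyI) (auto simp: X_polys)
    moreover have "is_min_poly K 0 [:0, 1:]"
      unfolding is_min_poly_def
    proof (intro conjI ballI impI X_polys)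
      fix g :: "'a poly" assume "g \<noteq> 0 \<and> poly g 0 = 0"
      then have "Polynomial.degree g \<noteq> 0" by (metis degree_eq_zeroE pCons_0_0 poly_const_conv)
      then show "Polynomial.degree [:0, 1 :: 'a:] \<le> Polynomial.degree g" by simp
    qed auto
    ultimately show ?thesis using F.zero by (intro exI[of _ "[:0, 1:]"] exI[of _ 0]) simp
  next
    case False
    \<comment> \<open>The least degree outside \<open>K\<close> is what forces
      \<open>z ^ p \<in> K\<close> in the inseparable case.\<close>
    define Q where "Q d \<longleftrightarrow> (\<exists>z\<in>K1 - K. \<exists>f. is_min_poly K z f \<and> Polynomial.degree f = d)" for d
    obtain z0 where z0: "z0 \<in> K1 - K" using False K1(2) by blast
    obtain f0 where "is_min_poly K z0 f0" by (rule min_poly_exists)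
    with z0 have "Q (Polynomial.degree f0)" by (auto simp: Q_def)
    then have "Q (LEAST d. Q d)" by (rule LeastI)
    then obtain z f where z: "z \<in> K1 - K" and f: "is_min_poly K z f" "Polynomial.degree f = (LEAST d. Q d)"
      unfolding Q_def by blast
    have least: "Polynomial.degree f \<le> Polynomial.degree g" if "x \<in> K1 - K" "is_min_poly K x g" for x g
      unfolding f(2) using that by (intro Least_le) (auto simp: Q_def)
    have f': "f \<in> polys_over K" "lead_coeff f = 1" "poly f z = 0" "f \<noteq> 0"
      using f(1) by (auto simp: is_min_poly_def)
    have zpow: "z ^ n \<in> K1" for n using z by (intro F.power) simp
    show ?thesis
    proof (cases "pderiv f = 0")
      case True
      let ?A = "Polynomial.monom 1 p :: 'a poly"
      have "is_min_poly K z (?A - [:z ^ p:])"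
        using inseparable_power[OF prime f(1) z zpow True least] assms(3) by simp
      moreover have "?A \<in> polys_over (valuation_ring K v)" using in_ring by (simp add: polys_over_def)
      moreover have "additive_poly K ?A"
      proof (rule additive_polyI)
        show "?A \<in> polys_over K" using one by (rule monom_polys)
        show "poly ?A (x + y) = poly ?A x + poly ?A y" for x y
          using freshmans_dream[OF prime assms(3)[symmetric]] by (simp add: poly_monom)
      qed
      moreover have "K1 = adjoin K z" using min z by (intro minimal_extension_adjoin) auto
      ultimately show ?thesis using z by (intro exI[of _ ?A] exI[of _ z]) (simp add: poly_monom)
    next
      case False
      define B where "B = {y. poly f y = 0}"
      have fin_B: "finite B" unfolding B_def using f'(4) by (rule poly_roots_finite)
      have f_B: "f = (\<Prod>y\<in>B. [:- y, 1:])" unfolding B_def using f(1) False by (rule min_poly_split)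
      have deg_B: "Polynomial.degree f = card B" unfolding f_B using fin_B by (rule degree_linear_prod)
      interpret split_extension K B
        by unfold_locales (use fin_B f'(1) f_B in auto)
      have disj: "linearly_disjoint K K1 (ramification_field K v)"
        using assms(7) by (simp add: purely_wild_def)
      let ?N = "wild_group K L {x. 0 < v x}"
      let ?R = "{x \<in> L. \<forall>\<sigma>\<in>?N. \<sigma> x = x}"
      \<comment> \<open>Independence over the ramification field passes to its subset
        \<open>?R\<close>.\<close>
      have disj_R: "linearly_disjoint K K1 ?R"
      proof -
        have "lin_indep_over ?R S" if "lin_indep_over (ramification_field K v) S" for S
          using that wild_fixed_in_ramification_field[OF v] unfolding lin_indep_over_def by blast
        with disj show ?thesis unfolding linearly_disjoint_def by blast
      qed
      have "ring_set ?R"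
      proof -
        have hom: "field_aut \<sigma>" if "\<sigma> \<in> ?N" for \<sigma>
          using that G_hom by (auto simp: wild_group_def)
        show ?thesis
          by unfold_locales
            (auto simp: field_aut.zero[OF hom] field_aut.one[OF hom] field_aut.add[OF hom]
              field_aut.mult[OF hom] field_aut.uminus[OF hom]
              intro: L.zero L.one L.add L.mult L.uminus)
      qed
      interpret wild_setting K "{x. 0 \<le> v x}" "{x. 0 < v x}" K1 B z
      proof unfold_locales
        show "prime CHAR('a)" by (rule prime)
        show "\<sigma> x \<in> {x. 0 < v x}" if "\<sigma> \<in> G" "x \<in> {x. 0 < v x}" for \<sigma> x
          using henselian_aut[OF assms(6) v that(1)] that(2) by simp
        show "z \<in> B" using f'(3) by (simp add: B_def)
        show "z \<in> K1" "z \<notin> K" using z by auto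
        show "K \<subseteq> K1" by (rule K1(2))
        show "F = K \<or> F = K1" if "alg_ext F" "K \<subseteq> F" "F \<subseteq> K1" for F
          using min that unfolding minimal_extension_def is_subfield_iff alg_ext_def by blast
        show "card B \<le> Polynomial.degree g" if "g \<noteq> 0" "poly g z = 0" "g \<in> polys_over ?R" for g
          using linearly_disjoint_min_degree[OF f(1) disj_R \<open>ring_set ?R\<close> zpow that(3,1,2)] deg_B by simp
      qed
      from additive_generator obtain A t where A: "A \<in> polys_over (valuation_ring K v)" "additive_poly K A"
        and t: "t \<in> K1" "t \<notin> K" "is_min_poly K t (A - [:poly A t:])"
        unfolding ring by blast
      have "K1 = adjoin K t" using min t(1,2) by (rule minimal_extension_adjoin)
      with A t show ?thesis by blast
    qed
  qed
qed

end
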